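(* Let $\mathfrak{g}$ be a Kac--Moody algebra, $\lambda\in\mathfrak{h}^*$, and $V$ a highest weight $\mathfrak{g}$-module with highest weight $\lambda$. Assume $J_V^c\neq\emptyset$, put $n=|J_V^c|$, fix numbers $c(i)\in\mathbb{Z}_{\geq0}$ for $i\in J_V^c$, and set $\mu=\lambda-\sum_{i\in J_V^c}c(i)\alpha_i$. (a) Suppose $\lambda\in P^+$. Then for any basic enumeration $J_V^c=\{i_1,\dots,i_n\}$ of $(J_V^c,c)$, $$f_{i_1}^{c(i_1)}\cdots f_{i_n}^{c(i_n)}\cdot V_\lambda\neq0.$$ (b) Suppose $\lambda\in P^+$. Let $H_1',\dots,H_r'$ be the terminal independent sets obtained from all runs of the basic enumeration procedure on $(J_V^c,c)$. For each $t$ form $\{i\in H_t' : c(i)>\lambda(\alpha_i^\vee)\}$ (possibly $\emptyset$), and let $H_1,\dots,H_s$ be the distinct sets among these. Then $$\dim V_\mu\;\geq\;\sum_{t=1}^s\dim\big[L(w_{H_t}\bullet\lambda)\big]_\mu,\qquad\text{and}\quad \dim\big[L(w_{H_t}\bullet\lambda)\big]_\mu>0\ \text{ for each }t .$$ Moreover, the inequality remains valid if each $\mathfrak{g}$-simple $L(w_{H_t}\bullet\lambda)$ is replaced by the simple module $L_{J_V^c\setminus H_t}(w_{H_t}\bullet\lambda)$ over the subalgebra $\mathfrak{g}_{J_V^c\setminus H_t}$. (c$'$) For general $\lambda\in\mathfrak{h}^*$, let $m=|J_\lambda\cap J_V^c|\geq0$ and let $J_\lambda\cap J_V^c=\{i_1,\dots,i_m\}$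 be any basic enumeration of $(J_\lambda\cap J_V^c,\,c|_{J_\lambda\cap J_V^c})$. Then $$f_{i_1}^{c(i_1)}\cdots f_{i_m}^{c(i_m)}\cdot\Big(\prod_{i\in J_\lambda^c\cap J_V^c}f_i^{c(i)}\Big)\cdot V_\lambda\neq0,$$ where the factors $f_i^{c(i)}$, $i\in J_\lambda^c\cap J_V^c$, are multiplied in any fixed order. (c) For general $\lambda\in\mathfrak{h}^*$, the results analogous to (a) and (b) hold with refined enumerations: for any refined enumeration $J_V^c=\{j_1,\dots,j_n\}$ of $(J_V^c,c)$ one has $f_{j_1}^{c(j_1)}\cdots f_{j_n}^{c(j_n)}\cdot V_\lambda\neq0$; and if $H_1,\dots,H_s$ are the distinct refined terminal sets $H$ arising from all runs of the refined enumeration procedure on $(J_V^c,c)$, then $\dim V_\mu\geq\sum_{t=1}^s\dim[L(w_{H_t}\bullet\lambda)]_\mu$ with every summand positive, and the inequality remains valid if each $L(w_{H_t}\bullet\lambda)$ is replaced by $L_{J_V^c\setminus H_t}(w_{H_t}\bullet\lambda)$.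
   Context: $\mathfrak{g}=\mathfrak{g}(A)$ is the complex Kac--Moody Lie algebra of a generalized Cartan matrix $A$ (not necessarily symmetrizable) with finite index set $\mathcal{I}$ (the nodes of the Dynkin diagram), Cartan subalgebra $\mathfrak{h}$, simple roots $\alpha_i$, simple co-roots $\alpha_i^\vee$, Chevalley generators $e_i,f_i$, and Weyl group $W$ generated by simple reflections $s_i$ ($i\in\mathcal{I}$). $P^+\subset\mathfrak{h}^*$ is the set of dominant integral weights. $J_\lambda=\{i:\lambda(\alpha_i^\vee)\in\mathbb{Z}_{\geq0}\}$ (so $\lambda\in P^+$ iff $J_\lambda=\mathcal{I}$). A highest weight module is a nonzero quotient $V$ of the Verma module $M(\lambda)$; $V_\mu$ is the $\mu$-weight space, $\mathrm{wt}\,V$ the set of weights; $L(\lambda)$ is the simple quotient of $M(\lambda)$. Complements are in $\mathcal{I}$. For $I\subseteq\mathcal{I}$, $\mathfrak{g}_I$ is the Kac--Moody subalgebra of $\mathfrak{g}$ generated by a suitable Cartan subalgebra $\mathfrak{h}_I\subseteq\mathfrak{h}$ and $e_i,f_i$ ($i\in I$), and $L_I(\nu)$ is the simple highest weight $\mathfrak{g}_I$-module with highest weight $\nu$, on which $\mathfrak{h}$ acts so that the highest weight vector has $\mathfrak{h}$-weight $\nu$ (so that $\mathfrak{h}$-weight spaces make sense). The dot action is $w\bullet\lambda=w(\lambda+\rho)-\rho$, where $\rho(\alpha_i^\vee)=1$ for all $i$. A subset of $\mathcal{I}$ is independent if no two distinct nodes in it are joined by an edge of the Dynkin diagram ($\emptyset$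 is independent). For independent $H$, $w_H=\prod_{i\in H}s_i$. $J_V\subseteq J_\lambda$ is the union of all independent $I\subseteq J_\lambda$ such that $\lambda-\sum_{i\in I}(\lambda(\alpha_i^\vee)+1)\alpha_i\notin\mathrm{wt}\,V$ and which are minimal under inclusion with this property. Basic enumeration procedure on $(I,c)$, for $I\subseteq\mathcal{I}$ and $c:I\to\mathbb{Z}_{\geq0}$: put $I_1=I$. At stage $k\geq1$: if $I_k$ is not independent, choose any two adjacent nodes $a_1,a_2\in I_k$, choose $i_k\in\{a_1,a_2\}$ with $c(i_k)=\min\{c(a_1),c(a_2)\}$, put $I_{k+1}=I_k\setminus\{i_k\}$ and pass to stage $k+1$. If $I_k$ is independent, stop, and list the elements of $I_k$ in any order as $i_k,i_{k+1},\dots,i_{|I|}$. The resulting list $i_1,\dots,i_{|I|}$ is a basic enumeration of $(I,c)$, and the final $I_k$ is the terminal independent set of the run. Refined enumeration procedure on $(I,c)$, for given $\lambda$, where $I\subseteq\mathcal{I}$ has $n$ elements and $c:I\to\mathbb{Z}_{\geq0}$: let $m=|J_\lambda\cap I|$ and write, in any order, $J_\lambda^c\cap I=\{j_{m+1},\dots,j_n\}$. Run the basic procedure on $(J_\lambda\cap I,c)$, obtaining $\{i_1,\dots,i_m\}$ with terminal independent set $H'=\{i_{k+1},\dots,i_m\}$ (nodes $i_1,\dots,i_k$ having been removed). Let $$H=\Big\{i\in H' : c(i)>\lambda(\alpha_i^\vee)-\sum_{t=m+1}^n c(j_t)\,\alpha_{j_t}(\alpha_i^\vee)\Big\}.$$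 Put $j_t=i_t$ for $1\leq t\leq k$, list $H'\setminus H=\{j_{k+1},\dots,j_r\}$ and $H=\{j_{r+1},\dots,j_m\}$ in any order. The list $j_1,\dots,j_n$ is a refined enumeration, and $H$ is its refined terminal set (for $I\subseteq J_\lambda^c$, any enumeration is allowed and $H=\emptyset$). *)

theory Defs
  imports "HOL-Analysis.Analysis" "HOL-Library.Poly_Mapping"
begin

section \<open>Complex vector spaces and Lie algebras\<close>

class complex_vector = ab_group_add +
  fixes scaleC :: "complex \<Rightarrow> 'a \<Rightarrow> 'a"  (infixr "*\<^sub>C" 75)
  assumes scaleC_add_right: "a *\<^sub>C (x + y) = a *\<^sub>C x + a *\<^sub>C y"
    and scaleC_add_left: "(a + b) *\<^sub>C x = a *\<^sub>C x + b *\<^sub>C x"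
    and scaleC_scaleC: "a *\<^sub>C b *\<^sub>C x = (a * b) *\<^sub>C x"
    and scaleC_one: "1 *\<^sub>C x = x"

interpretation cvs: vector_space "scaleC :: complex \<Rightarrow> 'a \<Rightarrow> 'a::complex_vector"
  by unfold_locales (simp_all add: scaleC_add_right scaleC_add_left scaleC_scaleC scaleC_one)

class complex_lie_algebra = complex_vector +
  fixes bracket :: "'a \<Rightarrow> 'a \<Rightarrow> 'a"
  assumes bracket_add_left: "bracket (x + y) z = bracket x z + bracket y z"
    and bracket_add_right: "bracket x (y + z) = bracket x y + bracket x z"
    and bracket_scaleC_left: "bracket (a *\<^sub>C x) y = a *\<^sub>C bracket x y"
    and bracket_scaleC_right: "bracket x (a *\<^sub>C y) = a *\<^sub>C bracket x y"
    and bracket_self: "bracket x x = 0"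
    and jacobi: "bracket x (bracket y z) + bracket y (bracket z x) + bracket z (bracket x y) = 0"

definition lie_subalgebra :: "'g::complex_lie_algebra set \<Rightarrow> bool" where
  "lie_subalgebra S \<longleftrightarrow> cvs.subspace S \<and> (\<forall>x\<in>S. \<forall>y\<in>S. bracket x y \<in> S)"

definition lie_ideal :: "'g::complex_lie_algebra set \<Rightarrow> bool" where
  "lie_ideal S \<longleftrightarrow> cvs.subspace S \<and> (\<forall>x. \<forall>y\<in>S. bracket x y \<in> S)"

definition linear_functional_on :: "'g::complex_vector set \<Rightarrow> ('g \<Rightarrow> complex) \<Rightarrow> bool" where
  "linear_functional_on h \<phi> \<longleftrightarrow>
     (\<forall>x\<in>h. \<forall>y\<in>h. \<phi> (x + y) = \<phi> x + \<phi> y) \<and> (\<forall>a. \<forall>x\<in>h. \<phi> (a *\<^sub>C x) = a * \<phi> x)"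


section \<open>Kac--Moody algebras\<close>

text \<open>Weights and roots are functions on the whole Lie algebra of which only the restriction to
  the Cartan subalgebra matters.\<close>

record ('i::finite, 'g) km_data =
  cartan_matrix :: "int ^ 'i ^ 'i"
  cartan :: "'g set"
  coroot :: "'i \<Rightarrow> 'g"
  root :: "'i \<Rightarrow> 'g \<Rightarrow> complex"
  e_gen :: "'i \<Rightarrow> 'g"
  f_gen :: "'i \<Rightarrow> 'g"

definition generalized_cartan_matrix :: "int ^ 'i::finite ^ 'i \<Rightarrow> bool" where
  "generalized_cartan_matrix A \<longleftrightarrow>
     (\<forall>i. A $ i $ i = 2) \<and> (\<forall>i j. i \<noteq> j \<longrightarrow> A $ i $ j \<le> 0) \<and>
     (\<forall>i j. A $ i $ j = 0 \<longleftrightarrow> A $ j $ i = 0)"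

text \<open>\<open>realization g I h\<close>: the space \<open>h\<close> together with the simple roots (restricted to \<open>h\<close>) and the
  simple coroots with index in \<open>I\<close> is a realization of the principal submatrix \<open>A\<^sub>I\<close>. The rank of
  \<open>A\<^sub>I\<close> is computed on the matrix padded with zeros, and the condition
  \<open>dim h = 2 * card I - rank A\<^sub>I\<close> is expressed by a finite basis \<open>B\<close> of \<open>h\<close>.\<close>

definition realization :: "('i::finite, 'g::complex_lie_algebra) km_data \<Rightarrow> 'i set \<Rightarrow> 'g set \<Rightarrow> bool" where
  "realization \<g> I h \<longleftrightarrow>
     (\<exists>B. finite B \<and> cvs.independent B \<and> cvs.span B = h \<and>
        card B + rank ((\<chi> i j. if i \<in> I \<and> j \<in> I then of_int (cartan_matrix \<g> $ i $ j) else 0)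
            :: complex ^ 'i ^ 'i) = 2 * card I) \<and>
     (\<forall>i\<in>I. coroot \<g> i \<in> h) \<and>
     (\<forall>i\<in>I. linear_functional_on h (root \<g> i)) \<and>
     (\<forall>a. (\<Sum>i\<in>I. a i *\<^sub>C coroot \<g> i) = 0 \<longrightarrow> (\<forall>i\<in>I. a i = 0)) \<and>
     (\<forall>a. (\<forall>x\<in>h. (\<Sum>i\<in>I. a i * root \<g> i x) = 0) \<longrightarrow> (\<forall>i\<in>I. a i = 0)) \<and>
     (\<forall>i\<in>I. \<forall>j\<in>I. root \<g> j (coroot \<g> i) = of_int (cartan_matrix \<g> $ i $ j))"

text \<open>The algebra \<open>g(A)\<close> is the quotient of the Lie algebra with generators \<open>h, e\<^sub>i, f\<^sub>i\<close> and the
  relations below by its largest ideal that intersects \<open>h\<close> trivially.  A Lie algebra is such a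
  quotient iff it is generated by \<open>h, e\<^sub>i, f\<^sub>i\<close>, satisfies the relations, contains \<open>h\<close> faithfully,
  and has no nonzero ideal intersecting \<open>h\<close> trivially.\<close>

definition kac_moody :: "('i::finite, 'g::complex_lie_algebra) km_data \<Rightarrow> bool" where
  "kac_moody \<g> \<longleftrightarrow>
     generalized_cartan_matrix (cartan_matrix \<g>) \<and>
     realization \<g> UNIV (cartan \<g>) \<and>
     (\<forall>x\<in>cartan \<g>. \<forall>y\<in>cartan \<g>. bracket x y = 0) \<and>
     (\<forall>i j. bracket (e_gen \<g> i) (f_gen \<g> j) = (if i = j then coroot \<g> i else 0)) \<and>
     (\<forall>x\<in>cartan \<g>. \<forall>i. bracket x (e_gen \<g> i) = root \<g> i x *\<^sub>C e_gen \<g> i) \<and>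
     (\<forall>x\<in>cartan \<g>. \<forall>i. bracket x (f_gen \<g> i) = - (root \<g> i x *\<^sub>C f_gen \<g> i)) \<and>
     lie_subalgebra hull (cartan \<g> \<union> range (e_gen \<g>) \<union> range (f_gen \<g>)) = UNIV \<and>
     (\<forall>\<rr>. lie_ideal \<rr> \<and> \<rr> \<inter> cartan \<g> = {0} \<longrightarrow> \<rr> = {0})"

definition adjacent :: "('i::finite, 'g) km_data \<Rightarrow> 'i \<Rightarrow> 'i \<Rightarrow> bool" where
  "adjacent \<g> i j \<longleftrightarrow> i \<noteq> j \<and> cartan_matrix \<g> $ i $ j \<noteq> 0"

definition independent_nodes :: "('i::finite, 'g) km_data \<Rightarrow> 'i set \<Rightarrow> bool" where
  "independent_nodes \<g> I \<longleftrightarrow> (\<forall>i\<in>I. \<forall>j\<in>I. \<not> adjacent \<g> i j)"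

text \<open>With \<open>h = cartan g\<close> and \<open>I = UNIV\<close>, the subalgebra \<open>km_subalgebra g h I\<close> is the whole algebra.\<close>

definition km_subalgebra :: "('i::finite, 'g::complex_lie_algebra) km_data \<Rightarrow> 'g set \<Rightarrow> 'i set \<Rightarrow> 'g set" where
  "km_subalgebra \<g> h I = lie_subalgebra hull (h \<union> e_gen \<g> ` I \<union> f_gen \<g> ` I)"

definition n_plus :: "('i::finite, 'g::complex_lie_algebra) km_data \<Rightarrow> 'i set \<Rightarrow> 'g set" where
  "n_plus \<g> I = lie_subalgebra hull (e_gen \<g> ` I)"


section \<open>Modules\<close>

text \<open>A module lives on a linear subspace \<open>vspace M\<close> of its type, so that families of modules of
  different dimensions fit in one type.\<close>

record ('g, 'v) rep =
  vspace :: "'v set"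
  act :: "'g \<Rightarrow> 'v \<Rightarrow> 'v"

definition lie_module :: "'g::complex_lie_algebra set \<Rightarrow> ('g, 'v::complex_vector) rep \<Rightarrow> bool" where
  "lie_module S M \<longleftrightarrow>
     cvs.subspace (vspace M) \<and>
     (\<forall>x\<in>S. \<forall>v\<in>vspace M. act M x v \<in> vspace M) \<and>
     (\<forall>x\<in>S. \<forall>v\<in>vspace M. \<forall>w\<in>vspace M. act M x (v + w) = act M x v + act M x w) \<and>
     (\<forall>x\<in>S. \<forall>a. \<forall>v\<in>vspace M. act M x (a *\<^sub>C v) = a *\<^sub>C act M x v) \<and>
     (\<forall>x\<in>S. \<forall>y\<in>S. \<forall>v\<in>vspace M. act M (x + y) v = act M x v + act M y v) \<and>
     (\<forall>a. \<forall>x\<in>S. \<forall>v\<in>vspace M. act M (a *\<^sub>C x) v = a *\<^sub>C act M x v) \<and>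
     (\<forall>x\<in>S. \<forall>y\<in>S. \<forall>v\<in>vspace M.
        act M (bracket x y) v = act M x (act M y v) - act M y (act M x v))"

definition submodule :: "'g::complex_lie_algebra set \<Rightarrow> ('g, 'v::complex_vector) rep \<Rightarrow> 'v set \<Rightarrow> bool" where
  "submodule S M N \<longleftrightarrow> cvs.subspace N \<and> N \<subseteq> vspace M \<and> (\<forall>x\<in>S. \<forall>v\<in>N. act M x v \<in> N)"

definition simple_module :: "'g::complex_lie_algebra set \<Rightarrow> ('g, 'v::complex_vector) rep \<Rightarrow> bool" where
  "simple_module S M \<longleftrightarrow>
     lie_module S M \<and> vspace M \<noteq> {0} \<and> (\<forall>N. submodule S M N \<longrightarrow> N = {0} \<or> N = vspace M)"

text \<open>The dimension \<open>cvs.dim\<close> is \<open>0\<close> on infinite-dimensional spaces. It is only applied to weight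
  spaces of highest weight modules, which are finite-dimensional as there are finitely many nodes.\<close>

definition wt_space :: "('i::finite, 'g) km_data \<Rightarrow> ('g, 'v::complex_vector) rep \<Rightarrow> ('g \<Rightarrow> complex) \<Rightarrow> 'v set" where
  "wt_space \<g> M \<mu> = {v \<in> vspace M. \<forall>x\<in>cartan \<g>. act M x v = \<mu> x *\<^sub>C v}"

definition is_weight :: "('i::finite, 'g) km_data \<Rightarrow> ('g, 'v::complex_vector) rep \<Rightarrow> ('g \<Rightarrow> complex) \<Rightarrow> bool" where
  "is_weight \<g> M \<mu> \<longleftrightarrow> wt_space \<g> M \<mu> \<noteq> {0}"


section \<open>Verma modules and highest weight modules\<close>

text \<open>Lists form the free monoid, so that the ring \<open>'g list \<Rightarrow>\<^sub>0 complex\<close> is the free associative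
  complex algebra on the elements of \<open>'g\<close>.\<close>

instantiation list :: (type) monoid_add
begin
definition zero_list :: "'a list" where "zero_list = []"
definition plus_list :: "'a list \<Rightarrow> 'a list \<Rightarrow> 'a list" where "plus_list = (@)"
instance by standard (simp_all add: zero_list_def plus_list_def)
end

abbreviation scalar :: "complex \<Rightarrow> 'g list \<Rightarrow>\<^sub>0 complex" where
  "scalar a \<equiv> Poly_Mapping.single [] a"

abbreviation letter :: "'g \<Rightarrow> 'g list \<Rightarrow>\<^sub>0 complex" where
  "letter x \<equiv> Poly_Mapping.single [x] 1"

definition free_alg :: "'g set \<Rightarrow> ('g list \<Rightarrow>\<^sub>0 complex) set" where
  "free_alg S = {t. Poly_Mapping.keys t \<subseteq> lists S}"

text \<open>For a subalgebra \<open>S\<close> with Cartan subalgebra \<open>h\<close> and positive part \<open>n\<close>, the rules \<open>linear\<close>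
  and \<open>bracket\<close> present the universal enveloping algebra \<open>U(S)\<close> as a quotient of the free algebra,
  and the remaining ones generate the left ideal \<open>U(S) n + \<Sum>\<^sub>x U(S) (x - \<Lambda>(x))\<close> for \<open>x \<in> h\<close>.
  Thus \<open>free_alg S / verma_ideal S h n \<Lambda>\<close> is the Verma module \<open>M(\<Lambda>)\<close> of \<open>S\<close>.\<close>

inductive_set verma_ideal ::
  "'g::complex_lie_algebra set \<Rightarrow> 'g set \<Rightarrow> 'g set \<Rightarrow> ('g \<Rightarrow> complex) \<Rightarrow> ('g list \<Rightarrow>\<^sub>0 complex) set"
  for S h n :: "'g set" and \<Lambda> :: "'g \<Rightarrow> complex" where
  zero: "0 \<in> verma_ideal S h n \<Lambda>"
| add: "s \<in> verma_ideal S h n \<Lambda> \<Longrightarrow> t \<in> verma_ideal S h n \<Lambda> \<Longrightarrow> s + t \<in> verma_ideal S h n \<Lambda>"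
| left_mult: "r \<in> free_alg S \<Longrightarrow> t \<in> verma_ideal S h n \<Lambda> \<Longrightarrow> r * t \<in> verma_ideal S h n \<Lambda>"
| linear: "x \<in> S \<Longrightarrow> y \<in> S \<Longrightarrow> r \<in> free_alg S \<Longrightarrow>
    (letter (a *\<^sub>C x + b *\<^sub>C y) - scalar a * letter x - scalar b * letter y) * r
      \<in> verma_ideal S h n \<Lambda>"
| bracket: "x \<in> S \<Longrightarrow> y \<in> S \<Longrightarrow> r \<in> free_alg S \<Longrightarrow>
    (letter (bracket x y) - (letter x * letter y - letter y * letter x)) * r
      \<in> verma_ideal S h n \<Lambda>"
| raising: "x \<in> n \<Longrightarrow> letter x \<in> verma_ideal S h n \<Lambda>"
| weight: "x \<in> h \<Longrightarrow> letter x - scalar (\<Lambda> x) \<in> verma_ideal S h n \<Lambda>"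

text \<open>A homomorphism from the Verma module onto \<open>M\<close>, given as a map on the free algebra
  that vanishes on \<open>verma_ideal\<close>. It sends the generator of the Verma module to \<open>\<pi> 1\<close>.\<close>

definition verma_quotient_map ::
  "'g::complex_lie_algebra set \<Rightarrow> 'g set \<Rightarrow> 'g set \<Rightarrow> ('g \<Rightarrow> complex) \<Rightarrow> ('g, 'v::complex_vector) rep
     \<Rightarrow> (('g list \<Rightarrow>\<^sub>0 complex) \<Rightarrow> 'v) \<Rightarrow> bool" where
  "verma_quotient_map S h n \<Lambda> M \<pi> \<longleftrightarrow>
     (\<forall>s\<in>free_alg S. \<forall>t\<in>free_alg S. \<pi> (s + t) = \<pi> s + \<pi> t) \<and>
     (\<forall>a. \<forall>t\<in>free_alg S. \<pi> (scalar a * t) = a *\<^sub>C \<pi> t) \<and>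
     (\<forall>x\<in>S. \<forall>t\<in>free_alg S. \<pi> (letter x * t) = act M x (\<pi> t)) \<and>
     (\<forall>t\<in>verma_ideal S h n \<Lambda>. \<pi> t = 0) \<and>
     \<pi> ` free_alg S = vspace M"

definition highest_weight_module ::
  "('i::finite, 'g::complex_lie_algebra) km_data \<Rightarrow> ('g \<Rightarrow> complex) \<Rightarrow> ('g, 'v::complex_vector) rep \<Rightarrow> bool" where
  "highest_weight_module \<g> \<Lambda> M \<longleftrightarrow>
     lie_module UNIV M \<and> vspace M \<noteq> {0} \<and>
     (\<exists>\<pi>. verma_quotient_map UNIV (cartan \<g>) (n_plus \<g> UNIV) \<Lambda> M \<pi>)"

definition simple_hw_module ::
  "('i::finite, 'g::complex_lie_algebra) km_data \<Rightarrow> ('g \<Rightarrow> complex) \<Rightarrow> ('g, 'v::complex_vector) rep \<Rightarrow> bool" where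
  "simple_hw_module \<g> \<Lambda> M \<longleftrightarrow> highest_weight_module \<g> \<Lambda> M \<and> simple_module UNIV M"

text \<open>\<open>M\<close> is the simple highest weight module \<open>L\<^sub>I(\<nu>)\<close> over \<open>g\<^sub>I = km_subalgebra g h\<^sub>I I\<close>, and the
  action extends to \<open>g\<^sub>I + h\<close> so that the highest weight vector has \<open>h\<close>-weight \<open>\<nu>\<close>.\<close>

definition levi_simple_hw_module ::
  "('i::finite, 'g::complex_lie_algebra) km_data \<Rightarrow> 'g set \<Rightarrow> 'i set \<Rightarrow> ('g \<Rightarrow> complex)
     \<Rightarrow> ('g, 'v::complex_vector) rep \<Rightarrow> bool" where
  "levi_simple_hw_module \<g> hI I \<nu> M \<longleftrightarrow>
     lie_module (km_subalgebra \<g> (cartan \<g>) I) M \<and>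
     simple_module (km_subalgebra \<g> hI I) M \<and>
     (\<exists>\<pi>. verma_quotient_map (km_subalgebra \<g> hI I) hI (n_plus \<g> I) \<nu> M \<pi> \<and>
          \<pi> 1 \<in> wt_space \<g> M \<nu>)"


section \<open>Weights\<close>

definition J_wt :: "('i::finite, 'g) km_data \<Rightarrow> ('g \<Rightarrow> complex) \<Rightarrow> 'i set" where
  "J_wt \<g> \<Lambda> = {i. \<Lambda> (coroot \<g> i) \<in> \<nat>}"

definition dominant_integral :: "('i::finite, 'g::complex_lie_algebra) km_data \<Rightarrow> ('g \<Rightarrow> complex) set" where
  "dominant_integral \<g> = {\<Lambda>. linear_functional_on (cartan \<g>) \<Lambda> \<and> (\<forall>i. \<Lambda> (coroot \<g> i) \<in> \<nat>)}"

definition lower_weight ::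
  "('i::finite, 'g) km_data \<Rightarrow> ('g \<Rightarrow> complex) \<Rightarrow> 'i set \<Rightarrow> ('i \<Rightarrow> complex) \<Rightarrow> 'g \<Rightarrow> complex" where
  "lower_weight \<g> \<Lambda> I a = (\<lambda>x. \<Lambda> x - (\<Sum>i\<in>I. a i * root \<g> i x))"

definition is_hole ::
  "('i::finite, 'g) km_data \<Rightarrow> ('g \<Rightarrow> complex) \<Rightarrow> ('g, 'v::complex_vector) rep \<Rightarrow> 'i set \<Rightarrow> bool" where
  "is_hole \<g> \<Lambda> V I \<longleftrightarrow>
     I \<subseteq> J_wt \<g> \<Lambda> \<and> independent_nodes \<g> I \<and>
     \<not> is_weight \<g> V (lower_weight \<g> \<Lambda> I (\<lambda>i. \<Lambda> (coroot \<g> i) + 1))"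

definition J_mod ::
  "('i::finite, 'g) km_data \<Rightarrow> ('g \<Rightarrow> complex) \<Rightarrow> ('g, 'v::complex_vector) rep \<Rightarrow> 'i set" where
  "J_mod \<g> \<Lambda> V = \<Union> {I. is_hole \<g> \<Lambda> V I \<and> (\<forall>I'. I' \<subset> I \<longrightarrow> \<not> is_hole \<g> \<Lambda> V I')}"

definition simple_reflection :: "('i::finite, 'g) km_data \<Rightarrow> 'i \<Rightarrow> ('g \<Rightarrow> complex) \<Rightarrow> 'g \<Rightarrow> complex" where
  "simple_reflection \<g> i \<Lambda> = (\<lambda>x. \<Lambda> x - \<Lambda> (coroot \<g> i) * root \<g> i x)"

text \<open>The product of the commuting reflections \<open>s\<^sub>i\<close>, \<open>i \<in> H\<close>; only meaningful for independent \<open>H\<close>.\<close>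

definition w_prod :: "('i::finite, 'g) km_data \<Rightarrow> 'i set \<Rightarrow> ('g \<Rightarrow> complex) \<Rightarrow> 'g \<Rightarrow> complex" where
  "w_prod \<g> H = Finite_Set.fold (\<lambda>i w. simple_reflection \<g> i \<circ> w) id H"

definition weyl_vector :: "('i::finite, 'g::complex_lie_algebra) km_data \<Rightarrow> ('g \<Rightarrow> complex) \<Rightarrow> bool" where
  "weyl_vector \<g> \<rho> \<longleftrightarrow> linear_functional_on (cartan \<g>) \<rho> \<and> (\<forall>i. \<rho> (coroot \<g> i) = 1)"

definition dot_action ::
  "('g \<Rightarrow> complex) \<Rightarrow> (('g \<Rightarrow> complex) \<Rightarrow> 'g \<Rightarrow> complex) \<Rightarrow> ('g \<Rightarrow> complex) \<Rightarrow> 'g \<Rightarrow> complex" where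
  "dot_action \<rho> w \<Lambda> = (\<lambda>x. w (\<lambda>y. \<Lambda> y + \<rho> y) x - \<rho> x)"


section \<open>Enumeration procedures\<close>

text \<open>\<open>basic_run g c I rs H\<close>: some run of the basic procedure on \<open>(I, c)\<close> removes the nodes \<open>rs\<close>
  in this order and stops at the independent set \<open>H\<close>.\<close>

inductive basic_run :: "('i::finite, 'g) km_data \<Rightarrow> ('i \<Rightarrow> nat) \<Rightarrow> 'i set \<Rightarrow> 'i list \<Rightarrow> 'i set \<Rightarrow> bool"
  for \<g> :: "('i::finite, 'g) km_data" and c :: "'i \<Rightarrow> nat" where
  stop: "independent_nodes \<g> I \<Longrightarrow> basic_run \<g> c I [] I"
| step: "a1 \<in> I \<Longrightarrow> a2 \<in> I \<Longrightarrow> adjacent \<g> a1 a2 \<Longrightarrow> i \<in> {a1, a2} \<Longrightarrow> c i = min (c a1) (c a2) \<Longrightarrow>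
    basic_run \<g> c (I - {i}) rs H \<Longrightarrow> basic_run \<g> c I (i # rs) H"

definition listing :: "'i list \<Rightarrow> 'i set \<Rightarrow> bool" where
  "listing xs X \<longleftrightarrow> distinct xs \<and> set xs = X"

definition basic_enumeration ::
  "('i::finite, 'g) km_data \<Rightarrow> ('i \<Rightarrow> nat) \<Rightarrow> 'i set \<Rightarrow> 'i list \<Rightarrow> bool" where
  "basic_enumeration \<g> c I is \<longleftrightarrow>
     (\<exists>rs H hs. basic_run \<g> c I rs H \<and> listing hs H \<and> is = rs @ hs)"

definition basic_terminal_sets :: "('i::finite, 'g) km_data \<Rightarrow> ('i \<Rightarrow> nat) \<Rightarrow> 'i set \<Rightarrow> 'i set set" where
  "basic_terminal_sets \<g> c I = {H. \<exists>rs. basic_run \<g> c I rs H}"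

text \<open>The real parts below only serve the comparison: for nodes of \<open>J_wt g \<Lambda>\<close> the complex numbers
  concerned are integers.\<close>

definition basic_cut :: "('i::finite, 'g) km_data \<Rightarrow> ('g \<Rightarrow> complex) \<Rightarrow> ('i \<Rightarrow> nat) \<Rightarrow> 'i set \<Rightarrow> 'i set" where
  "basic_cut \<g> \<Lambda> c H' = {i \<in> H'. real (c i) > Re (\<Lambda> (coroot \<g> i))}"

definition refined_cut ::
  "('i::finite, 'g) km_data \<Rightarrow> ('g \<Rightarrow> complex) \<Rightarrow> ('i \<Rightarrow> nat) \<Rightarrow> 'i set \<Rightarrow> 'i set \<Rightarrow> 'i set" where
  "refined_cut \<g> \<Lambda> c I H' =
     {i \<in> H'. real (c i) >
        Re (\<Lambda> (coroot \<g> i) - (\<Sum>j \<in> I - J_wt \<g> \<Lambda>. of_nat (c j) * root \<g> j (coroot \<g> i)))}"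

definition refined_enumeration ::
  "('i::finite, 'g) km_data \<Rightarrow> ('g \<Rightarrow> complex) \<Rightarrow> ('i \<Rightarrow> nat) \<Rightarrow> 'i set \<Rightarrow> 'i list \<Rightarrow> bool" where
  "refined_enumeration \<g> \<Lambda> c I js \<longleftrightarrow>
     (\<exists>rs H' ds hs ns.
        basic_run \<g> c (J_wt \<g> \<Lambda> \<inter> I) rs H' \<and>
        listing ds (H' - refined_cut \<g> \<Lambda> c I H') \<and>
        listing hs (refined_cut \<g> \<Lambda> c I H') \<and>
        listing ns (I - J_wt \<g> \<Lambda>) \<and>
        js = rs @ ds @ hs @ ns)"

definition refined_terminal_sets ::
  "('i::finite, 'g) km_data \<Rightarrow> ('g \<Rightarrow> complex) \<Rightarrow> ('i \<Rightarrow> nat) \<Rightarrow> 'i set \<Rightarrow> 'i set set" where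
  "refined_terminal_sets \<g> \<Lambda> c I =
     refined_cut \<g> \<Lambda> c I ` basic_terminal_sets \<g> c (J_wt \<g> \<Lambda> \<inter> I)"

text \<open>The operator \<open>f\<^bsub>i\<^sub>1\<^esub>\<^bsup>c(i\<^sub>1)\<^esup> \<dots> f\<^bsub>i\<^sub>n\<^esub>\<^bsup>c(i\<^sub>n)\<^esup>\<close> for \<open>is = [i\<^sub>1, \<dots>, i\<^sub>n]\<close>; the last factor acts first.\<close>

definition f_monomial ::
  "('i::finite, 'g) km_data \<Rightarrow> ('g, 'v) rep \<Rightarrow> ('i \<Rightarrow> nat) \<Rightarrow> 'i list \<Rightarrow> 'v \<Rightarrow> 'v" where
  "f_monomial \<g> M c is = foldr (\<lambda>i. (act M (f_gen \<g> i)) ^^ c i) is"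

end

theory Submission
  imports Defs
begin

text \<open>
  Let \<open>v\<close> be the highest weight vector of \<open>V\<close> and \<open>K\<close> the complement of \<open>J_mod \<g> \<Lambda> V\<close>. A hole contains a
  minimal hole, so no independent \<open>H \<subseteq> K\<close> of nodes with labels \<open>\<Lambda>(\<alpha>\<^sub>i\<^sup>\<or>)\<close> in the natural numbers is a
  hole (\<open>is_weight_singular_weight\<close>). As the \<open>f\<^sub>i\<close> at nonadjacent nodes commute
  (\<open>bracket_f_f_nonadjacent\<close>), the weight space concerned is spanned by one monomial. Hence the
  product of the \<open>f\<^sub>i\<close> with exponents \<open>\<Lambda>(\<alpha>\<^sub>i\<^sup>\<or>) + 1\<close>, \<open>i \<in> H\<close>, takes \<open>v\<close> to a nonzero vector. That vector
  is maximal (killed by all \<open>e\<^sub>i\<close>) of weight \<open>w\<^sub>H \<bullet> \<Lambda>\<close>; call it the singular vector of \<open>H\<close>.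

  Monomials in which every node occurs at most once are shown to be nonzero on a maximal vector by
  two devices. If the label at \<open>i\<close> of the weight reached so far is an integer not less than the
  exponent of \<open>f\<^sub>i\<close>, then \<open>sl\<^sub>2\<close>-theory allows the factor to be put in front
  (\<open>f_monomial_nonzero_Cons\<close>). The enumeration procedures provide this inequality: a removed node
  has a neighbour with at least the same exponent that is applied earlier
  (\<open>f_monomial_nonzero_run\<close>). If the label of the maximal vector at \<open>j\<close> is not a natural number, then
  the factor at \<open>j\<close> can be stripped off with powers of \<open>e\<^sub>j\<close>, which commute with all the other factors
  (\<open>f_monomial_nonzero_strip\<close>). After the singular vector of \<open>H\<close> has been reached, the labels at \<open>H\<close>
  are negative, so this applies to the remaining exponents there. Together this gives the
  nonvanishing statements in \<open>V\<close> (\<open>basic_monomial_nonzero\<close>) as well as a nonzero vector of weight \<open>\<mu>\<close> in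
  every highest weight module of highest weight \<open>w\<^sub>H \<bullet> \<Lambda>\<close> (\<open>refined_monomial_nonzero\<close>), hence the positivity
  of the summands.

  For the inequality, the coefficient by which an e-word takes an f-word of the same length back to
  the maximal vector depends only on the highest weight (\<open>contraction\<close>), and in a simple module these
  coefficients detect whether a combination of words vanishes (\<open>simple_nondegenerate\<close>). Bases of the
  weight spaces of the simple modules, written in f-words and applied to the singular vectors of
  \<open>V\<close>, are therefore jointly independent: apply e-words as long as the longest f-words involved, and
  use that the singular vectors have different weights (\<open>sum_dim_simple_le\<close>). The argument is the same for the simple
  modules of \<open>\<g>\<close> and of its Levi subalgebras.
\<close>

section \<open>Linear algebra over the complex numbers\<close>

lemma card_le_dim_of_independent_family:
  fixes x :: "'a \<Rightarrow> 'v::complex_vector"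
  assumes fin: "finite A" and indep: "\<And>k. (\<Sum>a\<in>A. k a *\<^sub>C x a) = 0 \<Longrightarrow> \<forall>a\<in>A. k a = 0"
    and sub: "x ` A \<subseteq> S" and S: "S \<subseteq> cvs.span B" and B: "finite B"
  shows "card A \<le> cvs.dim S"
proof -
  have inj: "inj_on x A"
  proof (rule inj_onI, rule ccontr)
    fix a b assume ab: "a \<in> A" "b \<in> A" "x a = x b" "a \<noteq> b"
    let ?k = "\<lambda>t. if t = a then 1 else if t = b then -1 else (0::complex)"
    have "(\<Sum>t\<in>A. ?k t *\<^sub>C x t) = (\<Sum>t\<in>{a,b}. ?k t *\<^sub>C x t)"
      by (rule sum.mono_neutral_right) (use ab fin in auto)
    also have "\<dots> = 0" using ab by (simp add: scaleC_one)
    finally have "\<forall>t\<in>A. ?k t = 0" by (rule indep)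
    then show False using ab(1) by fastforce
  qed
  have ind: "cvs.independent (x ` A)"
  proof (rule cvs.independent_if_scalars_zero)
    show "finite (x ` A)" using fin by simp
    fix f y assume "(\<Sum>v\<in>x ` A. f v *\<^sub>C v) = 0" and y: "y \<in> x ` A"
    then have "(\<Sum>a\<in>A. f (x a) *\<^sub>C x a) = 0" by (simp add: sum.reindex[OF inj] o_def)
    then show "f y = 0" using indep[of "\<lambda>a. f (x a)"] y by auto
  qed
  obtain C where C: "C \<subseteq> S" "cvs.independent C" "S \<subseteq> cvs.span C" "card C = cvs.dim S"
    using cvs.basis_exists by blast
  have "finite C" using cvs.independent_span_bound[OF B C(2)] C(1) S by auto
  then have "card (x ` A) \<le> card C"
    using cvs.independent_span_bound[OF _ ind, of C] sub C(3) by auto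
  then show ?thesis using C(4) by (simp add: card_image[OF inj])
qed

section \<open>Modules over Levi subalgebras\<close>

text \<open>Everything below happens inside modules over \<open>\<g>\<^sub>I + \<h>\<close>, with the full Cartan
  subalgebra: this makes \<open>\<h>\<close>-weights available and covers \<open>\<g>\<close>-modules (\<open>I = UNIV\<close>), the simple
  modules of the Levi subalgebras and the adjoint module at once.\<close>

locale kac_moody_algebra =
  fixes \<g> :: "('i::finite, 'g::complex_lie_algebra) km_data"
  assumes km: "kac_moody \<g>"
begin

lemma matrix_diag: "cartan_matrix \<g> $ i $ i = 2"
  and matrix_off_diag: "i \<noteq> j \<Longrightarrow> cartan_matrix \<g> $ i $ j \<le> 0"
  and matrix_zero_sym: "cartan_matrix \<g> $ i $ j = 0 \<longleftrightarrow> cartan_matrix \<g> $ j $ i = 0"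
  using km by (auto simp: kac_moody_def generalized_cartan_matrix_def)

lemma realization_UNIV: "realization \<g> UNIV (cartan \<g>)"
  using km by (simp add: kac_moody_def)

lemma cartan_subspace: "cvs.subspace (cartan \<g>)"
proof -
  obtain B where "cvs.span B = cartan \<g>" using realization_UNIV by (auto simp: realization_def)
  then show ?thesis by (metis cvs.subspace_span)
qed

lemma coroot_in_cartan: "coroot \<g> i \<in> cartan \<g>"
  and root_linear: "linear_functional_on (cartan \<g>) (root \<g> i)"
  and root_coroot: "root \<g> j (coroot \<g> i) = of_int (cartan_matrix \<g> $ i $ j)"
  and roots_independent:
    "(\<And>x. x \<in> cartan \<g> \<Longrightarrow> (\<Sum>j\<in>UNIV. a j * root \<g> j x) = 0) \<Longrightarrow> a i = 0"
  using realization_UNIV by (auto simp: realization_def)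

lemma cartan_abelian: "x \<in> cartan \<g> \<Longrightarrow> y \<in> cartan \<g> \<Longrightarrow> bracket x y = 0"
  and bracket_e_f: "bracket (e_gen \<g> i) (f_gen \<g> j) = (if i = j then coroot \<g> i else 0)"
  and bracket_h_e: "x \<in> cartan \<g> \<Longrightarrow> bracket x (e_gen \<g> i) = root \<g> i x *\<^sub>C e_gen \<g> i"
  and bracket_h_f: "x \<in> cartan \<g> \<Longrightarrow> bracket x (f_gen \<g> i) = - (root \<g> i x *\<^sub>C f_gen \<g> i)"
  and no_ideal: "lie_ideal \<rr> \<Longrightarrow> \<rr> \<inter> cartan \<g> = {0} \<Longrightarrow> \<rr> = {0}"
  and generated: "km_subalgebra \<g> (cartan \<g>) UNIV = UNIV"
  using km by (auto simp: kac_moody_def km_subalgebra_def)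

lemma lie_subalgebra_km_subalgebra: "lie_subalgebra (km_subalgebra \<g> h I)"
  unfolding km_subalgebra_def
  by (rule hull_in) (auto simp: lie_subalgebra_def intro!: cvs.subspace_Inter)

lemma km_subalgebra_generators:
  "x \<in> h \<Longrightarrow> x \<in> km_subalgebra \<g> h I"
  "i \<in> I \<Longrightarrow> e_gen \<g> i \<in> km_subalgebra \<g> h I"
  "i \<in> I \<Longrightarrow> f_gen \<g> i \<in> km_subalgebra \<g> h I"
  unfolding km_subalgebra_def by (auto intro!: hull_inc)

lemma km_subalgebra_mono: "h \<subseteq> h' \<Longrightarrow> km_subalgebra \<g> h I \<subseteq> km_subalgebra \<g> h' I"
  unfolding km_subalgebra_def by (rule hull_mono) auto

definition weight_below :: "('g \<Rightarrow> complex) \<Rightarrow> ('i \<Rightarrow> nat) \<Rightarrow> 'g \<Rightarrow> complex" where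
  "weight_below \<nu> n = lower_weight \<g> \<nu> UNIV (\<lambda>i. of_nat (n i))"

lemma weight_below_apply: "weight_below \<nu> n x = \<nu> x - (\<Sum>i\<in>UNIV. of_nat (n i) * root \<g> i x)"
  by (simp add: weight_below_def lower_weight_def)

lemma weight_below_inject:
  assumes "\<And>x. x \<in> cartan \<g> \<Longrightarrow> weight_below \<nu> n x = weight_below \<nu> m x"
  shows "n = m"
proof
  fix i
  have "(of_nat (n i) - of_nat (m i) :: complex) = 0"
  proof (rule roots_independent)
    fix x assume "x \<in> cartan \<g>"
    from assms[OF this] show "(\<Sum>j\<in>UNIV. (of_nat (n j) - of_nat (m j)) * root \<g> j x) = 0"
      by (simp add: weight_below_apply left_diff_distrib sum_subtractf)
  qed
  then show "n i = m i" by simp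
qed

text \<open>In an e-word the first letter acts first, in an f-word the last one: f-words are read as
  monomials, e-words as the order in which they are stripped off.\<close>

definition f_word :: "('g, 'v) rep \<Rightarrow> 'i list \<Rightarrow> 'v \<Rightarrow> 'v" where
  "f_word M w = foldr (\<lambda>i. act M (f_gen \<g> i)) w"

definition e_word :: "('g, 'v) rep \<Rightarrow> 'i list \<Rightarrow> 'v \<Rightarrow> 'v" where
  "e_word M u = fold (\<lambda>i. act M (e_gen \<g> i)) u"

lemma f_word_simps [simp]:
  "f_word M [] x = x" "f_word M (i # w) x = act M (f_gen \<g> i) (f_word M w x)"
  by (simp_all add: f_word_def)

lemma f_word_append: "f_word M (w @ w') x = f_word M w (f_word M w' x)"
  by (simp add: f_word_def)

lemma e_word_simps [simp]:
  "e_word M [] x = x" "e_word M (i # u) x = e_word M u (act M (e_gen \<g> i) x)"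
  by (simp_all add: e_word_def)

end

locale levi_module = kac_moody_algebra \<g> for \<g> :: "('i::finite, 'g::complex_lie_algebra) km_data" +
  fixes I :: "'i set" and M :: "('g, 'v::complex_vector) rep"
  assumes lie_module: "lie_module (km_subalgebra \<g> (cartan \<g>) I) M"
begin

abbreviation "S \<equiv> km_subalgebra \<g> (cartan \<g>) I"
abbreviation "E i \<equiv> act M (e_gen \<g> i)"
abbreviation "F i \<equiv> act M (f_gen \<g> i)"

lemmas generators = km_subalgebra_generators[where h = "cartan \<g>" and I = I]
lemmas coroot_in = generators(1)[OF coroot_in_cartan]

lemma vspace_subspace: "cvs.subspace (vspace M)"
  and act_closed: "x \<in> S \<Longrightarrow> v \<in> vspace M \<Longrightarrow> act M x v \<in> vspace M"
  and act_add: "x \<in> S \<Longrightarrow> v \<in> vspace M \<Longrightarrow> w \<in> vspace M \<Longrightarrow> act M x (v + w) = act M x v + act M x w"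
  and act_scale: "x \<in> S \<Longrightarrow> v \<in> vspace M \<Longrightarrow> act M x (a *\<^sub>C v) = a *\<^sub>C act M x v"
  and act_add_left: "x \<in> S \<Longrightarrow> y \<in> S \<Longrightarrow> v \<in> vspace M \<Longrightarrow> act M (x + y) v = act M x v + act M y v"
  and act_scale_left: "x \<in> S \<Longrightarrow> v \<in> vspace M \<Longrightarrow> act M (a *\<^sub>C x) v = a *\<^sub>C act M x v"
  and act_bracket: "x \<in> S \<Longrightarrow> y \<in> S \<Longrightarrow> v \<in> vspace M \<Longrightarrow>
        act M (bracket x y) v = act M x (act M y v) - act M y (act M x v)"
  using lie_module by (auto simp: lie_module_def)

lemmas vspace_closed =
  cvs.subspace_0[OF vspace_subspace] cvs.subspace_add[OF vspace_subspace]
  cvs.subspace_scale[OF vspace_subspace] cvs.subspace_diff[OF vspace_subspace]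
  cvs.subspace_sum[OF vspace_subspace]

lemma E_closed: "i \<in> I \<Longrightarrow> v \<in> vspace M \<Longrightarrow> E i v \<in> vspace M"
  and F_closed: "i \<in> I \<Longrightarrow> v \<in> vspace M \<Longrightarrow> F i v \<in> vspace M"
  by (auto intro: act_closed generators)

lemma act_zero: "x \<in> S \<Longrightarrow> act M x 0 = 0"
  using act_scale[of x 0 0] vspace_closed(1) by simp

lemma act_sum:
  "x \<in> S \<Longrightarrow> (\<And>a. a \<in> A \<Longrightarrow> v a \<in> vspace M) \<Longrightarrow> act M x (sum v A) = (\<Sum>a\<in>A. act M x (v a))"
  by (induction A rule: infinite_finite_induct) (auto simp: act_zero act_add vspace_closed)

lemma act_zero_left: "v \<in> vspace M \<Longrightarrow> act M 0 v = 0"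
  using act_scale_left[OF coroot_in, of v 0] by simp

lemma f_word_closed: "w \<in> lists I \<Longrightarrow> x \<in> vspace M \<Longrightarrow> f_word M w x \<in> vspace M"
  by (induction w) (auto intro: F_closed)

lemma e_word_add:
  "u \<in> lists I \<Longrightarrow> x \<in> vspace M \<Longrightarrow> y \<in> vspace M \<Longrightarrow> e_word M u (x + y) = e_word M u x + e_word M u y"
  by (induction u arbitrary: x y) (auto simp: act_add generators E_closed)

lemma e_word_scale: "u \<in> lists I \<Longrightarrow> x \<in> vspace M \<Longrightarrow> e_word M u (a *\<^sub>C x) = a *\<^sub>C e_word M u x"
  by (induction u arbitrary: x) (auto simp: act_scale generators E_closed)

lemma e_word_zero: "u \<in> lists I \<Longrightarrow> e_word M u 0 = 0"
  by (induction u) (auto simp: act_zero generators)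

lemma e_word_sum:
  "u \<in> lists I \<Longrightarrow> (\<And>a. a \<in> A \<Longrightarrow> v a \<in> vspace M) \<Longrightarrow>
   e_word M u (sum v A) = (\<Sum>a\<in>A. e_word M u (v a))"
  by (induction A rule: infinite_finite_induct) (auto simp: e_word_zero e_word_add vspace_closed)

lemma E_F:
  assumes "i \<in> I" "j \<in> I" "x \<in> vspace M"
  shows "E i (F j x) = F j (E i x) + (if i = j then act M (coroot \<g> i) x else 0)"
proof -
  have "act M (bracket (e_gen \<g> i) (f_gen \<g> j)) x = E i (F j x) - F j (E i x)"
    using assms by (intro act_bracket generators)
  then show ?thesis using assms(3) by (auto simp: bracket_e_f act_zero_left algebra_simps split: if_splits)
qed

lemma h_F:
  assumes "h \<in> cartan \<g>" "j \<in> I" "x \<in> vspace M"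
  shows "act M h (F j x) = F j (act M h x) - root \<g> j h *\<^sub>C F j x"
proof -
  have "act M (bracket h (f_gen \<g> j)) x = act M h (F j x) - F j (act M h x)"
    using assms by (intro act_bracket generators)
  moreover have "bracket h (f_gen \<g> j) = (- root \<g> j h) *\<^sub>C f_gen \<g> j"
    using assms by (simp add: bracket_h_f)
  ultimately have "(- root \<g> j h) *\<^sub>C F j x = act M h (F j x) - F j (act M h x)"
    using assms act_scale_left[of "f_gen \<g> j" x "- root \<g> j h"] by (simp add: generators)
  then show ?thesis by (simp add: algebra_simps)
qed

lemma h_E:
  assumes "h \<in> cartan \<g>" "j \<in> I" "x \<in> vspace M"
  shows "act M h (E j x) = E j (act M h x) + root \<g> j h *\<^sub>C E j x"
proof -
  have "act M (bracket h (e_gen \<g> j)) x = act M h (E j x) - E j (act M h x)"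
    using assms by (intro act_bracket generators)
  then have "root \<g> j h *\<^sub>C E j x = act M h (E j x) - E j (act M h x)"
    using assms by (simp add: bracket_h_e act_scale_left generators)
  then show ?thesis by (simp add: algebra_simps)
qed

text \<open>The elements of \<open>S\<close> that preserve a given subspace form a Lie subalgebra, so it suffices to
  test stability on generators.\<close>

lemma submodule_if_generators_stable:
  assumes N: "cvs.subspace N" "N \<subseteq> vspace M"
    and h: "\<And>x v. x \<in> cartan \<g> \<Longrightarrow> v \<in> N \<Longrightarrow> act M x v \<in> N"
    and e: "\<And>i v. i \<in> I \<Longrightarrow> v \<in> N \<Longrightarrow> E i v \<in> N"
    and f: "\<And>i v. i \<in> I \<Longrightarrow> v \<in> N \<Longrightarrow> F i v \<in> N"
  shows "submodule S M N"
proof -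
  let ?T = "{x \<in> S. \<forall>v\<in>N. act M x v \<in> N}"
  have S: "cvs.subspace S" "\<And>x y. x \<in> S \<Longrightarrow> y \<in> S \<Longrightarrow> bracket x y \<in> S"
    using lie_subalgebra_km_subalgebra by (auto simp: lie_subalgebra_def)
  have "lie_subalgebra ?T"
    unfolding lie_subalgebra_def
  proof (intro conjI ballI)
    show "cvs.subspace ?T"
      unfolding cvs.subspace_def using S(1) N
      by (auto simp: subset_iff act_add_left act_scale_left act_zero_left
          cvs.subspace_0 cvs.subspace_add cvs.subspace_scale)
  next
    fix x y assume "x \<in> ?T" "y \<in> ?T"
    then show "bracket x y \<in> ?T"
      using S(2) N by (auto simp: subset_iff act_bracket intro!: cvs.subspace_diff)
  qed
  then have "S \<subseteq> ?T"
    unfolding km_subalgebra_def[of _ "cartan \<g>" I]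
    using h e f by (intro hull_minimal) (auto simp: km_subalgebra_def[symmetric] generators)
  then show ?thesis using N by (auto simp: submodule_def)
qed

section \<open>Weight vectors\<close>

lemma wt_spaceD: "x \<in> wt_space \<g> M \<kappa> \<Longrightarrow> x \<in> vspace M"
  "x \<in> wt_space \<g> M \<kappa> \<Longrightarrow> h \<in> cartan \<g> \<Longrightarrow> act M h x = \<kappa> h *\<^sub>C x"
  by (auto simp: wt_space_def)

lemma subspace_wt_space: "cvs.subspace (wt_space \<g> M \<kappa>)"
  unfolding cvs.subspace_def wt_space_def
  by (auto simp: vspace_closed act_zero act_add act_scale generators scaleC_add_right cvs.scale_left_commute)

lemma F_wt_space:
  assumes "x \<in> wt_space \<g> M \<kappa>" "j \<in> I"
  shows "F j x \<in> wt_space \<g> M (\<lambda>h. \<kappa> h - root \<g> j h)"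
  using assms
  by (auto simp: wt_space_def F_closed h_F act_scale generators cvs.scale_left_diff_distrib)

lemma sum_Suc_root:
  "(\<Sum>i\<in>UNIV. of_nat (if i = j then Suc (n i) else n i) * root \<g> i h)
     = (\<Sum>i\<in>UNIV. of_nat (n i) * root \<g> i h) + root \<g> j h"
proof -
  have "(\<Sum>i\<in>UNIV. of_nat (if i = j then Suc (n i) else n i) * root \<g> i h)
     = (\<Sum>i\<in>UNIV. of_nat (n i) * root \<g> i h + (if i = j then root \<g> i h else 0))"
    by (intro sum.cong) (auto simp: algebra_simps)
  then show ?thesis by (simp add: sum.distrib)
qed

lemma f_word_wt_space:
  assumes "x \<in> wt_space \<g> M \<kappa>" "w \<in> lists I"
  shows "f_word M w x \<in> wt_space \<g> M (weight_below \<kappa> (count_list w))"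
  using assms(2)
proof (induction w)
  case Nil
  then show ?case using assms(1) by (simp add: weight_below_apply[abs_def])
next
  case (Cons j w)
  have "weight_below \<kappa> (count_list (j # w)) = (\<lambda>h. weight_below \<kappa> (count_list w) h - root \<g> j h)"
  proof
    fix h
    have "(\<Sum>i\<in>UNIV. of_nat (count_list (j # w) i) * root \<g> i h)
      = (\<Sum>i\<in>UNIV. of_nat (if i = j then Suc (count_list w i) else count_list w i) * root \<g> i h)"
      by (intro sum.cong) auto
    then show "weight_below \<kappa> (count_list (j # w)) h = weight_below \<kappa> (count_list w) h - root \<g> j h"
      unfolding weight_below_apply by (simp only: sum_Suc_root) simp
  qed
  then show ?case using F_wt_space[of "f_word M w x" "weight_below \<kappa> (count_list w)" j] Cons
    by (simp del: count_list.simps)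
qed

text \<open>Vectors of different weights are independent: applying \<open>h - \<kappa> b h\<close> for a suitable \<open>h\<close> in the
  Cartan subalgebra removes the summand indexed by \<open>b\<close> and rescales \<open>z\<close> by a nonzero factor.\<close>

lemma weight_vector_eq_zero:
  assumes "finite B"
    and "z \<in> wt_space \<g> M \<kappa>0" "z = (\<Sum>b\<in>B. y b)"
    and "\<And>b. b \<in> B \<Longrightarrow> y b \<in> wt_space \<g> M (\<kappa> b)"
    and "\<And>b. b \<in> B \<Longrightarrow> \<exists>h\<in>cartan \<g>. \<kappa> b h \<noteq> \<kappa>0 h"
  shows "z = 0"
  using assms
proof (induction B arbitrary: z y rule: finite_induct)
  case empty
  then show ?case by simp
next
  case (insert b B)
  obtain h where h: "h \<in> cartan \<g>" "\<kappa> b h \<noteq> \<kappa>0 h" using insert.prems(4)[of b] by auto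
  have y: "\<And>t. t \<in> insert b B \<Longrightarrow> y t \<in> vspace M" using insert.prems(3) wt_spaceD by blast
  have "\<kappa>0 h *\<^sub>C z = act M h z" using insert.prems(1) h wt_spaceD by simp
  also have "\<dots> = (\<Sum>t\<in>insert b B. act M h (y t))"
    using insert.prems(2) y h by (simp only: act_sum generators)
  also have "\<dots> = (\<Sum>t\<in>insert b B. \<kappa> t h *\<^sub>C y t)"
    by (intro sum.cong) (use insert.prems(3) h wt_spaceD in auto)
  finally have "(\<kappa>0 h - \<kappa> b h) *\<^sub>C z = (\<Sum>t\<in>insert b B. \<kappa> t h *\<^sub>C y t) - \<kappa> b h *\<^sub>C z"
    by (simp add: cvs.scale_left_diff_distrib)
  also have "\<dots> = (\<Sum>t\<in>insert b B. (\<kappa> t h - \<kappa> b h) *\<^sub>C y t)"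
    unfolding insert.prems(2) by (simp only: cvs.scale_left_diff_distrib sum_subtractf cvs.scale_sum_right)
  also have "\<dots> = (\<Sum>t\<in>B. (\<kappa> t h - \<kappa> b h) *\<^sub>C y t)" using insert.hyps by simp
  finally have eq: "(\<kappa>0 h - \<kappa> b h) *\<^sub>C z = (\<Sum>t\<in>B. (\<kappa> t h - \<kappa> b h) *\<^sub>C y t)" .
  have "(\<kappa>0 h - \<kappa> b h) *\<^sub>C z = 0"
    by (rule insert.IH[OF _ eq])
      (use insert.prems in \<open>auto intro: cvs.subspace_scale[OF subspace_wt_space]\<close>)
  then show ?case using h by simp
qed

lemma weight_component_of_span:
  assumes x: "x \<in> cvs.span (y ` W)" "x \<in> wt_space \<g> M \<kappa>0"
    and y: "\<And>w. w \<in> W \<Longrightarrow> y w \<in> wt_space \<g> M (\<kappa> w)"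
  shows "x \<in> cvs.span (y ` {w\<in>W. \<forall>h\<in>cartan \<g>. \<kappa> w h = \<kappa>0 h})"
proof -
  obtain T k where T: "finite T" "T \<subseteq> y ` W" "x = (\<Sum>a\<in>T. k a *\<^sub>C a)"
    using x(1) unfolding cvs.span_explicit by auto
  obtain W' where W': "W' \<subseteq> W" "inj_on y W'" "T = y ` W'" using T(2) by (meson subset_image_inj)
  have fin: "finite W'" using T(1) W' finite_image_iff by blast
  define A where "A = {w\<in>W'. \<forall>h\<in>cartan \<g>. \<kappa> w h = \<kappa>0 h}"
  define B where "B = W' - A"
  let ?s = "\<lambda>A. \<Sum>w\<in>A. k (y w) *\<^sub>C y w"
  have split: "x = ?s A + ?s B"
  proof -
    have "x = ?s W'" using T(3) W' by (simp add: sum.reindex)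
    also have "\<dots> = ?s A + ?s B"
      unfolding B_def using fin by (subst sum.subset_diff[of A]) (auto simp: A_def)
    finally show ?thesis .
  qed
  have memb: "w \<in> W' \<Longrightarrow> k (y w) *\<^sub>C y w \<in> wt_space \<g> M (\<kappa> w)" for w
    using W' y by (blast intro: cvs.subspace_scale[OF subspace_wt_space])
  have "w \<in> A \<Longrightarrow> k (y w) *\<^sub>C y w \<in> wt_space \<g> M \<kappa>0" for w
    using memb[of w] by (auto simp: A_def wt_space_def)
  then have "?s A \<in> wt_space \<g> M \<kappa>0" by (rule cvs.subspace_sum[OF subspace_wt_space])
  then have "?s B \<in> wt_space \<g> M \<kappa>0"
    using cvs.subspace_diff[OF subspace_wt_space x(2)] split by (metis add_diff_cancel_left')
  then have "?s B = 0"
    by (rule weight_vector_eq_zero[where B = B and \<kappa> = \<kappa>, rotated])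
      (use memb fin in \<open>auto simp: B_def A_def\<close>)
  then have "x = ?s A" using split by simp
  also have "\<dots> \<in> cvs.span (y ` {w\<in>W. \<forall>h\<in>cartan \<g>. \<kappa> w h = \<kappa>0 h})"
    using W'(1) by (intro cvs.span_sum cvs.span_scale cvs.span_base) (auto simp: A_def)
  finally show ?thesis .
qed

end

section \<open>Maximal vectors\<close>

context kac_moody_algebra
begin

text \<open>The coefficient of \<open>m\<close> in \<open>e_word u (f_word w m)\<close> for words of equal length and a maximal
  vector \<open>m\<close> of weight \<open>\<nu>\<close>. It depends on \<open>\<nu>\<close> but on no module, which is what allows linear
  independence to be carried from one module to another.\<close>

fun contraction :: "('g \<Rightarrow> complex) \<Rightarrow> 'i list \<Rightarrow> 'i list \<Rightarrow> complex" where
  "contraction \<nu> [] w = 1"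
| "contraction \<nu> (i # u) w = (\<Sum>p<length w. if w ! p = i
     then weight_below \<nu> (count_list (drop (Suc p) w)) (coroot \<g> i)
          * contraction \<nu> u (take p w @ drop (Suc p) w) else 0)"

end

context levi_module
begin

definition maximal_vector :: "('g \<Rightarrow> complex) \<Rightarrow> 'v \<Rightarrow> bool" where
  "maximal_vector \<nu> m \<longleftrightarrow> m \<in> wt_space \<g> M \<nu> \<and> (\<forall>i\<in>I. E i m = 0)"

lemma maximal_vector_closed: "maximal_vector \<nu> m \<Longrightarrow> m \<in> vspace M"
  by (simp add: maximal_vector_def wt_space_def)

text \<open>Moving \<open>e\<^sub>i\<close> through an f-word deletes one letter \<open>i\<close> at a time and picks up the value at
  \<open>\<alpha>\<^sub>i\<^sup>\<or>\<close> of the weight of what stands to the right of it.\<close>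

lemma E_f_word:
  assumes m: "maximal_vector \<nu> m" and i: "i \<in> I" and "w \<in> lists I"
  shows "E i (f_word M w m) = (\<Sum>p<length w. if w ! p = i
     then weight_below \<nu> (count_list (drop (Suc p) w)) (coroot \<g> i)
          *\<^sub>C f_word M (take p w @ drop (Suc p) w) m else 0)"
  using assms(3)
proof (induction w)
  case Nil
  then show ?case using m i by (simp add: maximal_vector_def)
next
  case (Cons j w)
  then have j: "j \<in> I" and w: "w \<in> lists I" by auto
  note mc = maximal_vector_closed[OF m]
  let ?c = "\<lambda>p. weight_below \<nu> (count_list (drop (Suc p) w)) (coroot \<g> i)"
  let ?x = "\<lambda>p. f_word M (take p w @ drop (Suc p) w) m"
  have x: "?x p \<in> vspace M" for p
    using w by (intro f_word_closed mc) (auto dest: in_set_takeD in_set_dropD)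
  have "E i (F j (f_word M w m)) = F j (E i (f_word M w m))
      + (if i = j then act M (coroot \<g> i) (f_word M w m) else 0)"
    by (rule E_F) (use i j w mc f_word_closed in auto)
  also have "F j (E i (f_word M w m)) = (\<Sum>p<length w. if w ! p = i then ?c p *\<^sub>C F j (?x p) else 0)"
    unfolding Cons.IH
    by (subst act_sum) (use j x in \<open>auto simp: generators vspace_closed act_scale act_zero intro!: sum.cong\<close>)
  also have "act M (coroot \<g> i) (f_word M w m) =
      weight_below \<nu> (count_list w) (coroot \<g> i) *\<^sub>C f_word M w m"
    using f_word_wt_space[of m \<nu> w] m w coroot_in_cartan
    by (auto simp: maximal_vector_def dest: wt_spaceD(2))
  finally show ?case by (simp add: sum.lessThan_Suc_shift add.commute del: sum.lessThan_Suc cong: if_cong)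
qed

definition lower_part :: "'v \<Rightarrow> 'v set" where
  "lower_part m = cvs.span ((\<lambda>w. f_word M w m) ` (lists I - {[]}))"

definition generated_by :: "'v \<Rightarrow> 'v set" where
  "generated_by m = cvs.span ((\<lambda>w. f_word M w m) ` lists I)"

lemma lists_delete: "w \<in> lists I \<Longrightarrow> take p w @ drop (Suc p) w \<in> lists I"
  by (auto dest: in_set_takeD in_set_dropD)

lemma e_word_f_word:
  assumes m: "maximal_vector \<nu> m" and "u \<in> lists I" "w \<in> lists I"
  shows "length u = length w \<Longrightarrow> e_word M u (f_word M w m) = contraction \<nu> u w *\<^sub>C m"
    and "length w < length u \<Longrightarrow> e_word M u (f_word M w m) = 0"
    and "length u < length w \<Longrightarrow> e_word M u (f_word M w m) \<in> lower_part m"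
  using assms(2,3)
proof (induction u arbitrary: w)
  case Nil
  { case 1 then show ?case by (simp add: scaleC_one)
  next case 2 then show ?case by simp
  next case 3 then show ?case by (auto simp: lower_part_def intro!: cvs.span_base) }
next
  case (Cons i u)
  then have i: "i \<in> I" and u: "u \<in> lists I" by auto
  let ?d = "\<lambda>w p. take p w @ drop (Suc p) w"
  have expand: "e_word M (i # u) (f_word M w m) = (\<Sum>p<length w. if w ! p = i
     then weight_below \<nu> (count_list (drop (Suc p) w)) (coroot \<g> i)
          *\<^sub>C e_word M u (f_word M (?d w p) m) else 0)" if w: "w \<in> lists I" for w
  proof -
    have cl: "f_word M (?d w p) m \<in> vspace M" for p
      using f_word_closed[OF lists_delete[OF w] maximal_vector_closed[OF m]] .
    have "e_word M (i # u) (f_word M w m) = (\<Sum>p<length w. e_word M u (if w ! p = i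
     then weight_below \<nu> (count_list (drop (Suc p) w)) (coroot \<g> i)
          *\<^sub>C f_word M (?d w p) m else 0))"
      by (simp only: e_word_simps E_f_word[OF m i w])
        (subst e_word_sum[OF u], auto simp: cl vspace_closed)
    also have "\<dots> = (\<Sum>p<length w. if w ! p = i
     then weight_below \<nu> (count_list (drop (Suc p) w)) (coroot \<g> i)
          *\<^sub>C e_word M u (f_word M (?d w p) m) else 0)"
      by (intro sum.cong) (use cl u in \<open>auto simp: e_word_scale e_word_zero\<close>)
    finally show ?thesis .
  qed
  { case 1
    then have w: "w \<in> lists I" and len: "length w = Suc (length u)" by auto
    have "e_word M u (f_word M (?d w p) m) = contraction \<nu> u (?d w p) *\<^sub>C m" if "p < length w" for p
      using Cons.IH(1)[of "?d w p"] lists_delete[OF w] u len that by simp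
    then show ?case
      unfolding expand[OF w] by (auto simp: cvs.scale_sum_left intro!: sum.cong)
  next
    case 2
    then have w: "w \<in> lists I" and len: "length w < Suc (length u)" by auto
    have "e_word M u (f_word M (?d w p) m) = 0" if "p < length w" for p
      using Cons.IH(2)[of "?d w p"] lists_delete[OF w] u len that by simp
    then show ?case unfolding expand[OF w] by (intro sum.neutral) auto
  next
    case 3
    then have w: "w \<in> lists I" and len: "Suc (length u) < length w" by auto
    have "e_word M u (f_word M (?d w p) m) \<in> lower_part m" if "p < length w" for p
      using Cons.IH(3)[of "?d w p"] lists_delete[OF w] u len that by simp
    then show ?case unfolding expand[OF w]
      by (auto simp: lower_part_def intro!: cvs.span_sum cvs.span_scale cvs.span_zero) }
qed

lemma act_span:
  assumes "x \<in> S" "X \<subseteq> vspace M" "cvs.subspace T" "\<And>v. v \<in> X \<Longrightarrow> act M x v \<in> T" "v \<in> cvs.span X"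
  shows "act M x v \<in> T"
proof -
  have "cvs.span X \<subseteq> {v \<in> vspace M. act M x v \<in> T}"
    by (rule cvs.span_minimal)
      (use assms in \<open>auto simp: cvs.subspace_def act_add act_scale act_zero
         vspace_closed\<close>)
  then show ?thesis using assms(5) by auto
qed

lemma words_closed: "m \<in> vspace M \<Longrightarrow> W \<subseteq> lists I \<Longrightarrow> (\<lambda>w. f_word M w m) ` W \<subseteq> vspace M"
  by (auto intro!: f_word_closed)

lemma generated_by_subset: "m \<in> vspace M \<Longrightarrow> generated_by m \<subseteq> vspace M"
  unfolding generated_by_def by (intro cvs.span_minimal words_closed vspace_subspace) auto

lemma submodule_generated_by:
  assumes m: "maximal_vector \<nu> m"
  shows "submodule S M (generated_by m)"
proof -
  note mc = maximal_vector_closed[OF m]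
  let ?X = "(\<lambda>w. f_word M w m) ` lists I"
  have X: "?X \<subseteq> vspace M" using words_closed[OF mc] by blast
  have base: "w \<in> lists I \<Longrightarrow> f_word M w m \<in> cvs.span ?X" for w by (auto intro!: cvs.span_base)
  show ?thesis
  proof (rule submodule_if_generators_stable)
    show "cvs.subspace (generated_by m)" by (simp add: generated_by_def)
    show "generated_by m \<subseteq> vspace M" by (rule generated_by_subset[OF mc])
  next
    fix h v assume h: "h \<in> cartan \<g>" and v: "v \<in> generated_by m"
    have "act M h (f_word M w m) \<in> cvs.span ?X" if w: "w \<in> lists I" for w
      using f_word_wt_space[of m \<nu> w] m w h base[OF w]
      by (auto simp: maximal_vector_def wt_space_def intro: cvs.span_scale)
    then show "act M h v \<in> generated_by m"
      using act_span[OF generators(1)[OF h] X, of "cvs.span ?X" v] v by (auto simp: generated_by_def)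
  next
    fix i v assume i: "i \<in> I" and v: "v \<in> generated_by m"
    have "E i (f_word M w m) \<in> cvs.span ?X" if w: "w \<in> lists I" for w
      unfolding E_f_word[OF m i w]
      by (intro cvs.span_sum) (auto intro!: cvs.span_scale base lists_delete w cvs.span_zero)
    then show "E i v \<in> generated_by m"
      using act_span[OF generators(2)[OF i] X, of "cvs.span ?X" v] v by (auto simp: generated_by_def)
    have "F i (f_word M w m) \<in> cvs.span ?X" if w: "w \<in> lists I" for w
      using base[of "i # w"] i w by simp
    then show "F i v \<in> generated_by m"
      using act_span[OF generators(3)[OF i] X, of "cvs.span ?X" v] v by (auto simp: generated_by_def)
  qed
qed

lemma mem_generated_by: "m \<in> generated_by m"
  unfolding generated_by_def by (rule cvs.span_base) (auto intro!: image_eqI[where x = "[]"])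

text \<open>By independence of the simple roots, the weight of an f-word determines its content.\<close>

lemma weight_space_of_words:
  assumes m: "maximal_vector \<nu> m" and W: "W \<subseteq> lists I"
    and x: "x \<in> cvs.span ((\<lambda>w. f_word M w m) ` W)" "x \<in> wt_space \<g> M (weight_below \<nu> n)"
  shows "x \<in> cvs.span ((\<lambda>w. f_word M w m) ` {w\<in>W. count_list w = n})"
proof -
  have "x \<in> cvs.span ((\<lambda>w. f_word M w m) `
      {w\<in>W. \<forall>h\<in>cartan \<g>. weight_below \<nu> (count_list w) h = weight_below \<nu> n h})"
    using x W m
    by (intro weight_component_of_span[where \<kappa> = "\<lambda>w. weight_below \<nu> (count_list w)"] f_word_wt_space)
      (auto simp: maximal_vector_def)
  also have "{w\<in>W. \<forall>h\<in>cartan \<g>. weight_below \<nu> (count_list w) h = weight_below \<nu> n h}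
      = {w\<in>W. count_list w = n}"
    by (auto intro: weight_below_inject)
  finally show ?thesis .
qed

lemma maximal_vector_notin_lower_part:
  assumes m: "maximal_vector \<nu> m" "m \<noteq> 0"
  shows "m \<notin> lower_part m"
proof
  assume "m \<in> lower_part m"
  moreover have "weight_below \<nu> (\<lambda>_. 0) = \<nu>" by (simp add: weight_below_apply fun_eq_iff)
  ultimately have "m \<in> cvs.span ((\<lambda>w. f_word M w m) ` {w \<in> lists I - {[]}. count_list w = (\<lambda>_. 0)})"
    using m by (intro weight_space_of_words[OF m(1)]) (auto simp: lower_part_def maximal_vector_def)
  moreover have "{w \<in> lists I - {[]}. count_list w = (\<lambda>_. 0)} = {}"
    by (auto simp: fun_eq_iff neq_Nil_conv)
  ultimately show False using m(2) by (simp del: Collect_empty_eq)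
qed

end

section \<open>The Serre relation for nonadjacent nodes\<close>

context kac_moody_algebra
begin

lemma bracket_zero: "bracket x 0 = (0::'g)" "bracket 0 x = (0::'g)"
  using bracket_scaleC_right[of x 0 0] bracket_scaleC_left[of 0 0 x] by simp_all

lemma bracket_swap: "bracket x y = - bracket y (x::'g)"
proof -
  have "bracket (x + y) (x + y) = bracket x y + bracket y x"
    by (simp only: bracket_add_left bracket_add_right) (simp add: bracket_self)
  then show ?thesis by (simp add: bracket_self eq_neg_iff_add_eq_0)
qed

lemma levi_module_adjoint: "levi_module \<g> UNIV \<lparr>vspace = UNIV, act = bracket\<rparr>"
proof unfold_locales
  have "bracket (bracket x y) z = bracket x (bracket y z) - bracket y (bracket x z)" for x y z :: 'g
    using jacobi[of x y z] bracket_swap[of z "bracket x y"] bracket_swap[of z x]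
      bracket_scaleC_right[of y "-1" "bracket x z"]
    by (simp add: algebra_simps)
  then show "lie_module (km_subalgebra \<g> (cartan \<g>) UNIV) \<lparr>vspace = UNIV, act = bracket\<rparr>"
    by (auto simp: lie_module_def bracket_add_left bracket_add_right
        bracket_scaleC_left bracket_scaleC_right)
qed

text \<open>In the adjoint module \<open>[f\<^sub>i, f\<^sub>j]\<close> is maximal of weight \<open>-\<alpha>\<^sub>i - \<alpha>\<^sub>j\<close>. Hence the submodule that it
  generates has only nonzero weights: it is an ideal that meets the Cartan subalgebra trivially.\<close>

lemma bracket_f_f_nonadjacent:
  assumes "i \<noteq> j" "cartan_matrix \<g> $ i $ j = 0"
  shows "bracket (f_gen \<g> i) (f_gen \<g> j) = 0"
proof -
  interpret ad: levi_module \<g> UNIV "\<lparr>vspace = UNIV, act = bracket\<rparr>"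
    by (rule levi_module_adjoint)
  define m where "m = bracket (f_gen \<g> i) (f_gen \<g> j)"
  define \<nu> where "\<nu> = (\<lambda>h. - root \<g> j h - root \<g> i h)"
  have sym: "cartan_matrix \<g> $ j $ i = 0" using assms(2) matrix_zero_sym by simp
  have "f_gen \<g> j \<in> wt_space \<g> \<lparr>vspace = UNIV, act = bracket\<rparr> (\<lambda>h. - root \<g> j h)"
    by (auto simp: wt_space_def bracket_h_f)
  then have wt: "m \<in> wt_space \<g> \<lparr>vspace = UNIV, act = bracket\<rparr> \<nu>"
    using ad.F_wt_space[of "f_gen \<g> j" "\<lambda>h. - root \<g> j h" i] by (simp add: m_def \<nu>_def)
  have "bracket (e_gen \<g> k) m = 0" for k
  proof -
    have "bracket (e_gen \<g> k) m = bracket (f_gen \<g> i) (bracket (e_gen \<g> k) (f_gen \<g> j))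
        + (if k = i then bracket (coroot \<g> k) (f_gen \<g> j) else 0)"
      using ad.E_F[of k i "f_gen \<g> j"] by (simp add: m_def)
    also have "\<dots> = 0"
      using assms sym bracket_swap[of "f_gen \<g> i" "coroot \<g> j"]
      by (auto simp: bracket_e_f bracket_zero bracket_h_f coroot_in_cartan root_coroot)
    finally show ?thesis .
  qed
  then have m: "ad.maximal_vector \<nu> m" using wt by (simp add: ad.maximal_vector_def)
  let ?N = "ad.generated_by m"
  have ideal: "lie_ideal ?N"
    using ad.submodule_generated_by[OF m] by (auto simp: submodule_def lie_ideal_def generated)
  have "y = 0" if "y \<in> ?N" "y \<in> cartan \<g>" for y
  proof -
    let ?W = "{w \<in> lists UNIV. \<forall>h\<in>cartan \<g>. weight_below \<nu> (count_list w) h = (0::complex)}"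
    have "y \<in> wt_space \<g> \<lparr>vspace = UNIV, act = bracket\<rparr> (\<lambda>_. 0)"
      using that(2) by (auto simp: wt_space_def cartan_abelian)
    then have "y \<in> cvs.span ((\<lambda>w. f_word \<lparr>vspace = UNIV, act = bracket\<rparr> w m) ` ?W)"
      using that(1) wt unfolding ad.generated_by_def
      by (intro ad.weight_component_of_span[where \<kappa> = "\<lambda>w. weight_below \<nu> (count_list w)"]
          ad.f_word_wt_space) auto
    moreover have "?W = {}"
    proof (rule equals0I)
      fix w assume w: "w \<in> ?W"
      let ?a = "\<lambda>k. of_nat (count_list w k) + (if k = i then 1 else 0)
          + (if k = j then 1 else 0) :: complex"
      have "?a i = 0"
      proof (rule roots_independent[where a = ?a])
        fix h assume "h \<in> cartan \<g>"
        then have "weight_below \<nu> (count_list w) h = 0" using w by simp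
        then have "- (root \<g> i h + root \<g> j h + (\<Sum>k\<in>UNIV. of_nat (count_list w k) * root \<g> k h)) = 0"
          by (simp add: weight_below_apply \<nu>_def algebra_simps)
        then have "(\<Sum>k\<in>UNIV. of_nat (count_list w k) * root \<g> k h) + root \<g> i h + root \<g> j h = 0"
          by (simp only: neg_equal_0_iff_equal add.commute add.left_commute add.assoc)
        then show "(\<Sum>k\<in>UNIV. ?a k * root \<g> k h) = 0"
          by (simp add: distrib_right sum.distrib if_distrib
              [where f = "\<lambda>x. x * _"] cong: if_cong)
      qed
      then have "of_nat (count_list w i + 1) = (0::complex)" using assms(1) by (simp add: add.commute)
      then show False unfolding of_nat_eq_0_iff by simp
    qed
    ultimately show ?thesis by (simp del: Collect_empty_eq)
  qed
  then have "?N \<inter> cartan \<g> = {0}"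
    using cvs.subspace_0[OF cartan_subspace] ideal by (auto simp: lie_ideal_def cvs.subspace_0)
  then have "?N = {0}" using no_ideal ideal by blast
  then show ?thesis using ad.mem_generated_by[of m] by (simp add: m_def)
qed

end

context levi_module
begin

lemma F_commute:
  assumes "i \<in> I" "j \<in> I" "\<not> adjacent \<g> i j" "x \<in> vspace M"
  shows "F i (F j x) = F j (F i x)"
proof (cases "i = j")
  case False
  then have "bracket (f_gen \<g> i) (f_gen \<g> j) = 0"
    using assms by (intro bracket_f_f_nonadjacent) (auto simp: adjacent_def)
  then show ?thesis
    using act_bracket[of "f_gen \<g> i" "f_gen \<g> j" x] assms by (simp add: generators act_zero_left)
qed simp

end

section \<open>Simple highest weight modules\<close>

context levi_module
begin

lemma lower_part_h: 
  assumes m: "maximal_vector \<nu> m" and h: "h \<in> cartan \<g>" and x: "x \<in> lower_part m"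
  shows "act M h x \<in> lower_part m"
proof -
  have "act M h (f_word M w m) \<in> lower_part m" if w: "w \<in> lists I - {[]}" for w
  proof -
    have "act M h (f_word M w m) = weight_below \<nu> (count_list w) h *\<^sub>C f_word M w m"
      using f_word_wt_space[of m \<nu> w] m w h by (auto simp: maximal_vector_def wt_space_def)
    moreover have "f_word M w m \<in> lower_part m"
      using w unfolding lower_part_def by (intro cvs.span_base imageI)
    ultimately show ?thesis by (simp add: lower_part_def cvs.span_scale)
  qed
  then show ?thesis
    using act_span[OF generators(1)[OF h] words_closed, of m "lists I - {[]}" "lower_part m" x]
      maximal_vector_closed[OF m] x by (auto simp: lower_part_def)
qed

lemma lower_part_F: 
  assumes m: "m \<in> vspace M" and j: "j \<in> I" and x: "x \<in> lower_part m"
  shows "F j x \<in> lower_part m"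
proof -
  have "F j (f_word M w m) \<in> lower_part m" if w: "w \<in> lists I - {[]}" for w
    using w j unfolding lower_part_def
    by (auto intro!: cvs.span_base image_eqI[where x = "j # w"])
  then show ?thesis
    using act_span[OF generators(3)[OF j] words_closed, of m "lists I - {[]}" "lower_part m" x]
      m x by (auto simp: lower_part_def)
qed

text \<open>The vectors that no e-word carries outside the lower part form a submodule, and \<open>m\<close> is not
  among them; in a simple module that submodule vanishes.\<close>

lemma simple_nondegenerate:
  assumes m: "maximal_vector \<nu> m" "m \<noteq> 0" and simple: "simple_module S' M" "S' \<subseteq> S"
    and x: "x \<in> vspace M" "\<And>u. u \<in> lists I \<Longrightarrow> e_word M u x \<in> lower_part m"
  shows "x = 0"
proof -
  define R where "R = {x \<in> vspace M. \<forall>u\<in>lists I. e_word M u x \<in> lower_part m}"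
  note mc = maximal_vector_closed[OF m(1)]
  have sub: "cvs.subspace (lower_part m)" by (simp add: lower_part_def)
  note sub_rules = cvs.subspace_add[OF sub] cvs.subspace_scale[OF sub]
    cvs.subspace_diff[OF sub] cvs.subspace_0[OF sub]
  have RD: "e_word M u v \<in> lower_part m" if "v \<in> R" "u \<in> lists I" for u v
    using that by (simp only: R_def mem_Collect_eq)
  have R0: "v \<in> lower_part m" if "v \<in> R" for v
    using RD[OF that, of "[]"] by simp
  have RE: "E i v \<in> R" if "i \<in> I" "v \<in> R" for i v
  proof -
    have "e_word M u (E i v) \<in> lower_part m" if "u \<in> lists I" for u
      using RD[OF \<open>v \<in> R\<close>, of "i # u"] \<open>i \<in> I\<close> that by simp
    then show ?thesis using that by (simp add: R_def E_closed)
  qed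
  have subR: "cvs.subspace R"
    unfolding cvs.subspace_def
  proof (intro conjI ballI allI)
    show "0 \<in> R" by (simp add: R_def vspace_closed e_word_zero sub_rules del: in_lists_conv_set)
  next
    fix x y assume "x \<in> R" "y \<in> R"
    then show "x + y \<in> R"
      by (simp add: R_def vspace_closed e_word_add sub_rules del: in_lists_conv_set)
  next
    fix a x assume "x \<in> R"
    then show "a *\<^sub>C x \<in> R"
      by (simp add: R_def vspace_closed e_word_scale sub_rules del: in_lists_conv_set)
  qed
  have Rh: "e_word M u (act M h v) \<in> lower_part m"
    if "u \<in> lists I" "h \<in> cartan \<g>" "v \<in> R" for u h v
    using that
  proof (induction u arbitrary: v)
    case Nil
    then have "v \<in> lower_part m" using R0 by blast
    then show ?case using Nil lower_part_h[OF m(1)] by simp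
  next
    case (Cons i u)
    have v: "v \<in> vspace M" using Cons by (simp add: R_def)
    have "E i (act M h v) = act M h (E i v) - root \<g> i h *\<^sub>C E i v"
      using h_E[of h i v] Cons v by (simp add: algebra_simps)
    then have "e_word M (i # u) (act M h v)
        = e_word M u (act M h (E i v) + (- root \<g> i h) *\<^sub>C E i v)" by simp
    also have "\<dots> = e_word M u (act M h (E i v)) + (- root \<g> i h) *\<^sub>C e_word M u (E i v)"
      using Cons v by (subst e_word_add)
        (auto simp: e_word_scale E_closed generators act_closed vspace_closed simp del: cvs.scale_minus_left)
    also have "\<dots> \<in> lower_part m"
      using Cons.IH[of "E i v"] RE[of i v] Cons
      by (intro sub_rules) (auto simp: R_def)
    finally show ?case .
  qed
  have Rf: "e_word M u (F j v) \<in> lower_part m" if "u \<in> lists I" "j \<in> I" "v \<in> R" for u j v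
    using that
  proof (induction u arbitrary: v)
    case Nil
    then have "v \<in> lower_part m" using R0 by blast
    then show ?case using Nil lower_part_F[OF mc] by simp
  next
    case (Cons i u)
    have v: "v \<in> vspace M" using Cons by (simp add: R_def)
    have "e_word M (i # u) (F j v)
        = e_word M u (F j (E i v)) + e_word M u (if i = j then act M (coroot \<g> i) v else 0)"
      using Cons v by (simp add: E_F) (subst e_word_add, auto simp: e_word_zero E_closed F_closed
          act_closed coroot_in vspace_closed)
    also have "\<dots> \<in> lower_part m"
      using Cons.IH[of "E i v"] RE[of i v] Rh[of u "coroot \<g> i" v] Cons coroot_in_cartan
      by (intro sub_rules) (auto simp: e_word_zero sub_rules)
    finally show ?case .
  qed
  have "submodule S M R"
    using subR RE Rh Rf
    by (intro submodule_if_generators_stable)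
      (auto simp: R_def F_closed intro: act_closed generators)
  then have "submodule S' M R" using simple(2) by (auto simp: submodule_def)
  moreover have "m \<notin> R"
    using maximal_vector_notin_lower_part[OF m] R0 by blast
  ultimately have "R = {0}" using simple(1) mc unfolding simple_module_def by metis
  moreover have "x \<in> R" using x unfolding R_def by simp
  ultimately show ?thesis by simp
qed

lemma finite_words_of_content: "finite {w :: 'i list. count_list w = n}"
proof (rule finite_subset)
  show "{w. count_list w = n} \<subseteq> {w. set w \<subseteq> UNIV \<and> length w = sum n UNIV}"
    by (auto simp: sum_count_set[OF subset_UNIV finite, symmetric])
  show "finite {w :: 'i list. set w \<subseteq> UNIV \<and> length w = sum n UNIV}"
    by (rule finite_lists_length_eq) simp
qed

lemma weight_space_subset_span_words:
  assumes m: "maximal_vector \<nu> m" and gen: "vspace M = generated_by m"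
  shows "wt_space \<g> M (weight_below \<nu> n)
    \<subseteq> cvs.span ((\<lambda>w. f_word M w m) ` {w \<in> lists I. count_list w = n})"
proof
  fix x assume x: "x \<in> wt_space \<g> M (weight_below \<nu> n)"
  then have "x \<in> generated_by m" using wt_spaceD(1) gen by metis
  then show "x \<in> cvs.span ((\<lambda>w. f_word M w m) ` {w \<in> lists I. count_list w = n})"
    unfolding generated_by_def by (rule weight_space_of_words[OF m order_refl _ x])
qed

lemma word_basis:
  assumes m: "maximal_vector \<nu> m" and gen: "vspace M = generated_by m"
  obtains W where "finite W" "W \<subseteq> lists I" "\<And>w. w \<in> W \<Longrightarrow> count_list w = n"
    "card W = cvs.dim (wt_space \<g> M (weight_below \<nu> n))"
    "\<And>k. (\<Sum>w\<in>W. k w *\<^sub>C f_word M w m) = 0 \<Longrightarrow> \<forall>w\<in>W. k w = 0"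
proof -
  let ?W = "{w \<in> lists I. count_list w = n}"
  let ?f = "\<lambda>w. f_word M w m"
  obtain B where B: "B \<subseteq> ?f ` ?W" "cvs.independent B" "?f ` ?W \<subseteq> cvs.span B"
    by (rule cvs.maximal_independent_subset[of "?f ` ?W"])
  have "\<exists>W\<subseteq>?W. inj_on ?f W \<and> B = ?f ` W" using B(1) by (rule iffD1[OF subset_image_inj])
  then obtain W where W: "W \<subseteq> ?W" "inj_on ?f W" "B = ?f ` W" by (elim exE conjE) rule
  have finW: "finite W" by (rule finite_subset[OF _ finite_words_of_content[of n]]) (use W(1) in blast)
  have "wt_space \<g> M (weight_below \<nu> n) \<subseteq> cvs.span B"
    using weight_space_subset_span_words[OF m gen, of n]
      cvs.span_minimal[OF B(3) cvs.subspace_span] by (rule order_trans)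
  then have span: "wt_space \<g> M (weight_below \<nu> n) \<subseteq> cvs.span B" .
  have sub: "B \<subseteq> wt_space \<g> M (weight_below \<nu> n)"
  proof -
    have "?f w \<in> wt_space \<g> M (weight_below \<nu> n)" if "w \<in> ?W" for w
      using f_word_wt_space[of m \<nu> w] m that by (auto simp: maximal_vector_def)
    then have "?f ` ?W \<subseteq> wt_space \<g> M (weight_below \<nu> n)" by (rule image_subsetI)
    with B(1) show ?thesis by (rule order_trans)
  qed
  have "card B = cvs.dim (wt_space \<g> M (weight_below \<nu> n))"
    by (rule cvs.basis_card_eq_dim[OF sub span B(2)])
  moreover have "card B = card W" using W by (simp add: card_image)
  moreover have "\<forall>w\<in>W. k w = 0" if "(\<Sum>w\<in>W. k w *\<^sub>C ?f w) = 0" for k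
  proof
    fix w assume w: "w \<in> W"
    define g where "g b = k (inv_into W ?f b)" for b
    have inv: "inv_into W ?f (?f v) = v" if "v \<in> W" for v using inv_into_f_f[OF W(2) that] .
    have "(\<Sum>b\<in>B. g b *\<^sub>C b) = (\<Sum>v\<in>W. g (?f v) *\<^sub>C ?f v)"
      unfolding W(3) by (simp add: sum.reindex[OF W(2)])
    also have "\<dots> = 0" using that inv by (simp add: g_def cong: sum.cong)
    finally have "(\<Sum>b\<in>B. g b *\<^sub>C b) = 0" .
    then have "g (?f w) = 0"
      by (rule cvs.independentD[OF B(2) _ order_refl, rotated]) (use W(3) finW w in simp_all)
    then show "k w = 0" using inv[OF w] by (simp add: g_def)
  qed
  ultimately show ?thesis using W(1) finW by (intro that[of W]) (simp_all add: subset_iff)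
qed

end

locale simple_levi_module = levi_module \<g> I M
  for \<g> :: "('i::finite, 'g::complex_lie_algebra) km_data" and I and M :: "('g, 'v::complex_vector) rep" +
  fixes \<nu> :: "'g \<Rightarrow> complex" and m :: 'v
  assumes max: "maximal_vector \<nu> m" and nonzero: "m \<noteq> 0" and gen: "vspace M = generated_by m"
    and simple: "\<exists>S'\<subseteq>S. simple_module S' M"

text \<open>A linear dependence among the chosen words applied to the \<open>m t\<close> is tested by e-words as long
  as the longest words involved. Shorter words are killed, and words of equal length contract to
  multiples of the \<open>m t\<close>, which are independent because their weights differ. The coefficients so
  obtained are those of the module \<open>L t\<close>, where they force the dependence to be trivial.\<close>

lemma (in levi_module) sum_dim_simple_le:
  fixes L :: "'t \<Rightarrow> ('g, 'l::complex_vector) rep"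
  assumes T: "finite T"
    and fin: "wt_space \<g> M \<mu> \<subseteq> cvs.span B" "finite B"
    and max: "\<And>t. t \<in> T \<Longrightarrow> maximal_vector (\<nu> t) (m t)" "\<And>t. t \<in> T \<Longrightarrow> m t \<noteq> 0"
    and distinct: "\<And>s t. s \<in> T \<Longrightarrow> t \<in> T \<Longrightarrow> s \<noteq> t \<Longrightarrow> \<exists>h\<in>cartan \<g>. \<nu> s h \<noteq> \<nu> t h"
    and \<mu>: "\<And>t. t \<in> T \<Longrightarrow> \<mu> = weight_below (\<nu> t) (n t)"
    and J: "\<And>t. t \<in> T \<Longrightarrow> J t \<subseteq> I"
    and simple: "\<And>t. t \<in> T \<Longrightarrow> \<exists>z. simple_levi_module \<g> (J t) (L t) (\<nu> t) z"
  shows "(\<Sum>t\<in>T. cvs.dim (wt_space \<g> (L t) \<mu>)) \<le> cvs.dim (wt_space \<g> M \<mu>)"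
proof -
  obtain z where z: "\<And>t. t \<in> T \<Longrightarrow> simple_levi_module \<g> (J t) (L t) (\<nu> t) (z t)"
    using simple by metis
  define P where "P t W \<longleftrightarrow> finite W \<and> W \<subseteq> lists (J t) \<and> (\<forall>w\<in>W. count_list w = n t)
    \<and> card W = cvs.dim (wt_space \<g> (L t) \<mu>)
    \<and> (\<forall>k. (\<Sum>w\<in>W. k w *\<^sub>C f_word (L t) w (z t)) = 0 \<longrightarrow> (\<forall>w\<in>W. k w = 0))" for t W
  have "\<exists>W. P t W" if t: "t \<in> T" for t
  proof -
    interpret L: simple_levi_module \<g> "J t" "L t" "\<nu> t" "z t" by (rule z[OF t])
    show ?thesis
    proof (rule L.word_basis[OF L.max L.gen, of "n t"])
      fix W
      assume "finite W" "W \<subseteq> lists (J t)" "\<And>w. w \<in> W \<Longrightarrow> count_list w = n t"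
        "card W = cvs.dim (wt_space \<g> (L t) (weight_below (\<nu> t) (n t)))"
        "\<And>k. (\<Sum>w\<in>W. k w *\<^sub>C f_word (L t) w (z t)) = 0 \<Longrightarrow> \<forall>w\<in>W. k w = 0"
      then have "P t W" unfolding P_def \<mu>[OF t] by blast
      then show ?thesis ..
    qed
  qed
  then obtain W where PW: "\<And>t. t \<in> T \<Longrightarrow> P t (W t)" by metis
  then have W: "\<And>t. t \<in> T \<Longrightarrow> finite (W t)" "\<And>t. t \<in> T \<Longrightarrow> W t \<subseteq> lists (J t)"
    "\<And>t w. t \<in> T \<Longrightarrow> w \<in> W t \<Longrightarrow> count_list w = n t"
    "\<And>t. t \<in> T \<Longrightarrow> card (W t) = cvs.dim (wt_space \<g> (L t) \<mu>)"
    "\<And>t k. t \<in> T \<Longrightarrow> (\<Sum>w\<in>W t. k w *\<^sub>C f_word (L t) w (z t)) = 0 \<Longrightarrow> \<forall>w\<in>W t. k w = 0"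
    unfolding P_def by blast+
  define N where "N t = sum (n t) UNIV" for t
  have len: "length w = N t" if "t \<in> T" "w \<in> W t" for t w
    using sum_count_set[OF subset_UNIV finite, of w] W(3)[OF that] by (simp add: N_def)
  have WI: "w \<in> lists I" if "t \<in> T" "w \<in> W t" for t w
    using W(2)[OF that(1)] J[OF that(1)] that(2) by auto
  have mc: "t \<in> T \<Longrightarrow> m t \<in> vspace M" for t using max(1) maximal_vector_closed by blast
  let ?x = "\<lambda>(t, w). f_word M w (m t)"
  have "card (Sigma T W) \<le> cvs.dim (wt_space \<g> M \<mu>)"
  proof (rule card_le_dim_of_independent_family[where x = ?x and B = B])
    show "finite (Sigma T W)" using T W(1) by auto
    show "wt_space \<g> M \<mu> \<subseteq> cvs.span B" "finite B" by (rule fin)+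
    show "?x ` Sigma T W \<subseteq> wt_space \<g> M \<mu>"
    proof clarify
      fix t w assume tw: "t \<in> T" "w \<in> W t"
      have "f_word M w (m t) \<in> wt_space \<g> M (weight_below (\<nu> t) (count_list w))"
        using max(1)[OF tw(1)] WI[OF tw] by (intro f_word_wt_space) (simp_all add: maximal_vector_def)
      then show "f_word M w (m t) \<in> wt_space \<g> M \<mu>" using \<mu>[OF tw(1)] W(3)[OF tw] by simp
    qed
    fix k :: "'t \<times> 'i list \<Rightarrow> complex"
    assume "(\<Sum>a\<in>Sigma T W. k a *\<^sub>C ?x a) = 0"
    then have dep: "(\<Sum>t\<in>T. \<Sum>w\<in>W t. k (t, w) *\<^sub>C f_word M w (m t)) = 0"
      using T W(1) by (subst sum.Sigma) (auto simp: case_prod_unfold)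
    define T' where "T' = {t \<in> T. \<exists>w\<in>W t. k (t, w) \<noteq> 0}"
    have "T' = {}"
    proof (rule ccontr)
      assume "T' \<noteq> {}"
      \<comment> \<open>Among the modules with a nonzero coefficient, take one whose words are longest.\<close>
      moreover have "finite T'" using T by (simp add: T'_def)
      ultimately have "Max (N ` T') \<in> N ` T'" by (intro Max_in) auto
      then obtain t0 where "t0 \<in> T'" "N t0 = Max (N ` T')" by auto
      then have t0: "t0 \<in> T'" "\<And>t. t \<in> T' \<Longrightarrow> N t \<le> N t0"
        using \<open>finite T'\<close> by auto
      then have t0T: "t0 \<in> T" by (simp add: T'_def)
      interpret L: simple_levi_module \<g> "J t0" "L t0" "\<nu> t0" "z t0" by (rule z[OF t0T])
      have coeff: "(\<Sum>w\<in>W t0. k (t0, w) * contraction (\<nu> t0) u w) = 0"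
        if u: "u \<in> lists (J t0)" "length u = N t0" for u
      proof -
        have uI: "u \<in> lists I" using u(1) J[OF t0T] by auto
        define a where "a t = (if N t = N t0 then \<Sum>w\<in>W t. k (t, w) * contraction (\<nu> t) u w else 0)" for t
        have e: "k (t, w) *\<^sub>C e_word M u (f_word M w (m t))
            = (if N t = N t0 then (k (t, w) * contraction (\<nu> t) u w) *\<^sub>C m t else 0)"
          if tw: "t \<in> T" "w \<in> W t" for t w
        proof (cases "k (t, w) = 0")
          case False
          then have "N t \<le> N t0" using t0(2) tw by (auto simp: T'_def)
          then show ?thesis
            using e_word_f_word(1,2)[OF max(1)[OF tw(1)] uI WI[OF tw]] len[OF tw] u(2)
            by (auto simp: le_less)
        qed simp
        have cl: "t \<in> T \<Longrightarrow> w \<in> W t \<Longrightarrow> f_word M w (m t) \<in> vspace M" for t w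
          by (intro f_word_closed WI mc)
        have "0 = e_word M u (\<Sum>t\<in>T. \<Sum>w\<in>W t. k (t, w) *\<^sub>C f_word M w (m t))"
          using dep uI by (simp add: e_word_zero)
        also have "\<dots> = (\<Sum>t\<in>T. \<Sum>w\<in>W t. k (t, w) *\<^sub>C e_word M u (f_word M w (m t)))"
          using uI cl by (simp add: e_word_sum e_word_scale vspace_closed cong: sum.cong)
        also have "\<dots> = (\<Sum>t\<in>T. a t *\<^sub>C m t)"
          using e by (intro sum.cong refl) (auto simp: a_def cvs.scale_sum_left cong: sum.cong)
        also have "\<dots> = a t0 *\<^sub>C m t0 + (\<Sum>t\<in>T - {t0}. a t *\<^sub>C m t)"
          using T t0T by (simp add: sum.remove)
        finally have eq: "a t0 *\<^sub>C m t0 = (\<Sum>t\<in>T - {t0}. (- a t) *\<^sub>C m t)"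
          by (simp add: sum_negf eq_neg_iff_add_eq_0)
        have wt: "t \<in> T \<Longrightarrow> b *\<^sub>C m t \<in> wt_space \<g> M (\<nu> t)" for t b
          using max(1) by (auto simp: maximal_vector_def intro: cvs.subspace_scale[OF subspace_wt_space])
        have "a t0 *\<^sub>C m t0 = 0"
          by (rule weight_vector_eq_zero[OF _ wt[OF t0T] eq, where \<kappa> = \<nu>])
            (use T wt distinct t0T in \<open>auto simp del: cvs.scale_minus_left\<close>)
        then show ?thesis using max(2)[OF t0T] by (simp add: a_def)
      qed
      define y where "y = (\<Sum>w\<in>W t0. k (t0, w) *\<^sub>C f_word (L t0) w (z t0))"
      have cl: "w \<in> W t0 \<Longrightarrow> f_word (L t0) w (z t0) \<in> vspace (L t0)" for w
        using W(2)[OF t0T] L.f_word_closed L.maximal_vector_closed[OF L.max] by blast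
      obtain S' where S': "S' \<subseteq> L.S" "simple_module S' (L t0)" using L.simple by auto
      have "y = 0"
      proof (rule L.simple_nondegenerate[OF L.max L.nonzero S'(2,1)])
        show "y \<in> vspace (L t0)" unfolding y_def using cl by (intro L.vspace_closed)
        fix u assume u: "u \<in> lists (J t0)"
        have eq: "e_word (L t0) u y = (\<Sum>w\<in>W t0. k (t0, w) *\<^sub>C e_word (L t0) u (f_word (L t0) w (z t0)))"
          unfolding y_def using u cl by (simp add: L.e_word_sum L.e_word_scale L.vspace_closed cong: sum.cong)
        have lower: "e_word (L t0) u (f_word (L t0) w (z t0)) \<in> L.lower_part (z t0)"
          if "w \<in> W t0" "length u \<noteq> N t0" for w
        proof -
          have w: "w \<in> lists (J t0)" using W(2)[OF t0T] that(1) by blast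
          show ?thesis
            using L.e_word_f_word(2,3)[OF L.max u w] len[OF t0T that(1)] that(2)
            by (cases "length u < N t0") (auto simp: L.lower_part_def cvs.span_zero)
        qed
        have zero: "e_word (L t0) u y = 0" if "length u = N t0"
        proof -
          have "e_word (L t0) u y = (\<Sum>w\<in>W t0. (k (t0, w) * contraction (\<nu> t0) u w) *\<^sub>C z t0)"
            unfolding eq using L.e_word_f_word(1)[OF L.max u] W(2)[OF t0T] len[OF t0T] that
            by (intro sum.cong) (auto simp: subset_iff)
          also have "\<dots> = 0" using coeff[OF u that] by (simp add: cvs.scale_sum_left[symmetric])
          finally show ?thesis .
        qed
        show "e_word (L t0) u y \<in> L.lower_part (z t0)"
        proof (cases "length u = N t0")
          case True then show ?thesis using zero by (simp add: L.lower_part_def cvs.span_zero)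
        next
          case False
          then show ?thesis using lower unfolding eq L.lower_part_def
            by (intro cvs.span_sum cvs.span_scale) auto
        qed
      qed
      then have "\<forall>w\<in>W t0. k (t0, w) = 0" using W(5)[OF t0T] by (simp add: y_def)
      then show False using t0(1) by (auto simp: T'_def)
    qed
    then show "\<forall>a\<in>Sigma T W. k a = 0" by (auto simp: T'_def)
  qed
  also have "card (Sigma T W) = (\<Sum>t\<in>T. cvs.dim (wt_space \<g> (L t) \<mu>))"
    using T W(1,4) by (simp add: card_SigmaI)
  finally show ?thesis .
qed

section \<open>Quotients of Verma modules\<close>

context levi_module
begin

lemma verma_quotient_map_word:
  assumes \<pi>: "verma_quotient_map S' h n \<nu> M \<pi>" and N: "\<And>x v. x \<in> S' \<Longrightarrow> v \<in> N \<Longrightarrow> act M x v \<in> N"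
    and sub: "cvs.subspace N" and one: "\<pi> 1 \<in> N" and t: "t \<in> free_alg S'"
  shows "\<pi> t \<in> N"
proof -
  have add: "\<pi> (s + t) = \<pi> s + \<pi> t" if "s \<in> free_alg S'" "t \<in> free_alg S'" for s t
    using \<pi> that unfolding verma_quotient_map_def by blast
  have scale: "\<pi> (scalar a * t) = a *\<^sub>C \<pi> t" if "t \<in> free_alg S'" for a t
    using \<pi> that unfolding verma_quotient_map_def by blast
  have letter: "\<pi> (letter x * t) = act M x (\<pi> t)" if "x \<in> S'" "t \<in> free_alg S'" for x t
    using \<pi> that unfolding verma_quotient_map_def by blast
  have single: "w \<in> lists S' \<Longrightarrow> Poly_Mapping.single w a \<in> free_alg S'" for w and a :: complex
    by (auto simp: free_alg_def)
  have word: "\<pi> (Poly_Mapping.single w 1) \<in> N" if "w \<in> lists S'" for w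
    using that
  proof (induction w)
    case Nil
    have "Poly_Mapping.single [] 1 = (1 :: 'g list \<Rightarrow>\<^sub>0 complex)"
      by (metis single_one zero_list_def)
    then show ?case using one by (simp only:)
  next
    case (Cons x w)
    have "Poly_Mapping.single (x # w) 1 = letter x * (Poly_Mapping.single w 1 :: 'g list \<Rightarrow>\<^sub>0 complex)"
      by (simp add: mult_single plus_list_def)
    then have "\<pi> (Poly_Mapping.single (x # w) 1) = act M x (\<pi> (Poly_Mapping.single w 1))"
      using letter[OF _ single, of x w 1] Cons by (simp only:)
    then show ?case using N Cons by (simp only:)
  qed
  have monomial: "\<pi> (Poly_Mapping.single w a) \<in> N" if w: "w \<in> lists S'" for w a
  proof -
    have "Poly_Mapping.single w a = scalar a * Poly_Mapping.single w 1"
      by (simp add: mult_single plus_list_def)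
    then have "\<pi> (Poly_Mapping.single w a) = a *\<^sub>C \<pi> (Poly_Mapping.single w 1)"
      using scale[OF single[OF w], of a 1] by (rule ssubst)
    then show ?thesis using word[OF w] cvs.subspace_scale[OF sub] by (simp only:)
  qed
  have zero_in: "0 \<in> free_alg S'" by (simp add: free_alg_def)
  have "\<pi> 0 = 0" using scale[OF zero_in, of 0] by (simp only: mult_zero_right cvs.scale_zero_left)
  then have zero: "\<pi> 0 \<in> N" using cvs.subspace_0[OF sub] by simp
  have "(\<Sum>w\<in>A. Poly_Mapping.single w (Poly_Mapping.lookup t w)) \<in> free_alg S' \<and>
      \<pi> (\<Sum>w\<in>A. Poly_Mapping.single w (Poly_Mapping.lookup t w)) \<in> N"
    if "finite A" "A \<subseteq> lists S'" for A
    using that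
  proof (induction A rule: finite_induct)
    case empty then show ?case using zero zero_in by (simp only: sum.empty)
  next
    case (insert w A)
    then have w: "w \<in> lists S'" by auto
    let ?s = "\<Sum>w\<in>A. Poly_Mapping.single w (Poly_Mapping.lookup t w)"
    have IH: "?s \<in> free_alg S'" "\<pi> ?s \<in> N" using insert by auto
    have "Poly_Mapping.single w (Poly_Mapping.lookup t w) + ?s \<in> free_alg S'"
      using IH(1) single[OF w, of "Poly_Mapping.lookup t w"]
        Poly_Mapping.keys_add[of "Poly_Mapping.single w (Poly_Mapping.lookup t w)" ?s]
      unfolding free_alg_def by blast
    moreover have "\<pi> (Poly_Mapping.single w (Poly_Mapping.lookup t w) + ?s) \<in> N"
      using cvs.subspace_add[OF sub monomial[OF w] IH(2)] add[OF single[OF w] IH(1)] by (simp only:)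
    ultimately show ?case using insert.hyps by (simp only: sum.insert simp_thms)
  qed
  from this[of "Poly_Mapping.keys t"] have "\<pi> (\<Sum>w\<in>Poly_Mapping.keys t. Poly_Mapping.single w (Poly_Mapping.lookup t w)) \<in> N"
    using t by (simp add: free_alg_def)
  moreover have "(\<Sum>w\<in>Poly_Mapping.keys t. Poly_Mapping.single w (Poly_Mapping.lookup t w)) = t"
    by (rule poly_mapping_eqI)
      (simp add: lookup_sum lookup_single when_def sum.delta' in_keys_iff)
  ultimately show ?thesis by (simp only:)
qed

lemma verma_quotient_map_letter:
  assumes "verma_quotient_map S' h n \<nu> M \<pi>" and x: "x \<in> S'"
  shows "\<pi> (letter x) = act M x (\<pi> 1)"
proof -
  have one: "(1 :: 'g list \<Rightarrow>\<^sub>0 complex) \<in> free_alg S'" by (simp add: free_alg_def zero_list_def)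
  then have "\<pi> (letter x * 1) = act M x (\<pi> 1)"
    using assms one unfolding verma_quotient_map_def by blast
  then show ?thesis by (simp only: mult_1_right)
qed

text \<open>The e-generators annihilate \<open>\<pi> 1\<close>, so the f-words span a submodule that contains \<open>\<pi> 1\<close>; the
  image of \<open>\<pi>\<close> is contained in every such submodule.\<close>

lemma verma_quotient_generator:
  assumes \<pi>: "verma_quotient_map S' h (n_plus \<g> I) \<nu> M \<pi>" and S': "S' \<subseteq> S" "e_gen \<g> ` I \<subseteq> S'"
    and wt: "\<pi> 1 \<in> wt_space \<g> M \<nu>"
  shows "maximal_vector \<nu> (\<pi> 1)" and "vspace M = generated_by (\<pi> 1)"
proof -
  show m: "maximal_vector \<nu> (\<pi> 1)"
    unfolding maximal_vector_def
  proof (intro conjI wt ballI)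
    fix i assume i: "i \<in> I"
    then have "e_gen \<g> i \<in> n_plus \<g> I" by (auto simp: n_plus_def intro: hull_inc)
    then have "letter (e_gen \<g> i) \<in> verma_ideal S' h (n_plus \<g> I) \<nu>"
      by (rule verma_ideal.raising)
    then have "\<pi> (letter (e_gen \<g> i)) = 0"
      using \<pi> unfolding verma_quotient_map_def by blast
    then show "E i (\<pi> 1) = 0" using verma_quotient_map_letter[OF \<pi>, of "e_gen \<g> i"] S'(2) i by auto
  qed
  have sub: "submodule S M (generated_by (\<pi> 1))" by (rule submodule_generated_by[OF m])
  have "\<pi> t \<in> generated_by (\<pi> 1)" if "t \<in> free_alg S'" for t
    by (rule verma_quotient_map_word[OF \<pi> _ _ mem_generated_by that])
      (use sub S'(1) in \<open>auto simp: submodule_def\<close>)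
  then have "\<pi> ` free_alg S' \<subseteq> generated_by (\<pi> 1)" by auto
  then show "vspace M = generated_by (\<pi> 1)"
    using \<pi> sub unfolding verma_quotient_map_def submodule_def by (metis subset_antisym)
qed

lemma generator_nonzero:
  assumes "maximal_vector \<nu> m" "vspace M = generated_by m" "vspace M \<noteq> {0}"
  shows "m \<noteq> 0"
proof
  assume "m = 0"
  have "f_word M w 0 = 0" if "w \<in> lists I" for w
    using that by (induction w) (auto simp: act_zero generators)
  then have "(\<lambda>w. f_word M w m) ` lists I \<subseteq> {0}" using \<open>m = 0\<close> by auto
  then have "generated_by m \<subseteq> {0}"
    unfolding generated_by_def by (rule cvs.span_minimal) simp
  then show False using assms(2,3) vspace_closed(1) by auto
qed

end

context kac_moody_algebra
begin

text \<open>The relation \<open>x = \<Lambda>(x)\<close> of the Verma module makes \<open>\<pi> 1\<close> a weight vector. For Levi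
  subalgebras this is part of the definition, because it concerns the larger Cartan subalgebra.\<close>

lemma highest_weight_module_generator:
  assumes "highest_weight_module \<g> \<nu> M"
  shows "levi_module \<g> UNIV M"
    and "\<exists>m. m \<noteq> 0 \<and> levi_module.maximal_vector \<g> UNIV M \<nu> m \<and> vspace M = levi_module.generated_by \<g> UNIV M m"
proof -
  show levi: "levi_module \<g> UNIV M"
    using assms by unfold_locales (simp add: highest_weight_module_def generated)
  interpret levi_module \<g> UNIV M by (rule levi)
  obtain \<pi> where \<pi>: "verma_quotient_map UNIV (cartan \<g>) (n_plus \<g> UNIV) \<nu> M \<pi>"
    using assms by (auto simp: highest_weight_module_def)
  have UN: "free_alg UNIV = (UNIV :: ('g list \<Rightarrow>\<^sub>0 complex) set)" by (auto simp: free_alg_def)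
  have add: "\<pi> (s + t) = \<pi> s + \<pi> t" and scale: "\<pi> (scalar a * t) = a *\<^sub>C \<pi> t" for s t a
    using \<pi> unfolding verma_quotient_map_def UN by blast+
  have range: "\<pi> t \<in> vspace M" for t
    using \<pi> unfolding verma_quotient_map_def UN by blast
  have "act M x (\<pi> 1) = \<nu> x *\<^sub>C \<pi> 1" if "x \<in> cartan \<g>" for x
  proof -
    have "letter x - scalar (\<nu> x) \<in> verma_ideal UNIV (cartan \<g>) (n_plus \<g> UNIV) \<nu>"
      by (rule verma_ideal.weight[OF that])
    then have "\<pi> (letter x - scalar (\<nu> x)) = 0"
      using \<pi> unfolding verma_quotient_map_def by blast
    then have "\<pi> (letter x) = \<pi> (scalar (\<nu> x))"
      using add[of "letter x - scalar (\<nu> x)" "scalar (\<nu> x)"]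
      by (simp only: diff_add_cancel add_0_left)
    also have "\<dots> = \<nu> x *\<^sub>C \<pi> 1" using scale[of "\<nu> x" 1] by (simp only: mult_1_right)
    finally show ?thesis using verma_quotient_map_letter[OF \<pi> UNIV_I, of x] by (simp only:)
  qed
  then have wt: "\<pi> 1 \<in> wt_space \<g> M \<nu>" using range by (simp add: wt_space_def)
  have "UNIV \<subseteq> S" by (simp add: generated)
  note gen = verma_quotient_generator[OF \<pi> this subset_UNIV wt]
  have "vspace M \<noteq> {0}" using assms by (simp add: highest_weight_module_def)
  then show "\<exists>m. m \<noteq> 0 \<and> maximal_vector \<nu> m \<and> vspace M = generated_by m"
    using generator_nonzero[OF gen] gen by (intro exI[of _ "\<pi> 1"] conjI)
qed

lemma simple_hw_module_levi:
  assumes "simple_hw_module \<g> \<nu> M"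
  shows "\<exists>m. simple_levi_module \<g> UNIV M \<nu> m"
proof -
  have hw: "highest_weight_module \<g> \<nu> M" and simple: "simple_module UNIV M"
    using assms by (auto simp: simple_hw_module_def)
  interpret levi_module \<g> UNIV M by (rule highest_weight_module_generator[OF hw])
  obtain m where m: "m \<noteq> 0" "maximal_vector \<nu> m" "vspace M = generated_by m"
    using highest_weight_module_generator(2)[OF hw] by auto
  have "\<exists>S'\<subseteq>S. simple_module S' M" using simple by (intro exI[of _ UNIV]) (simp add: generated)
  with m have "simple_levi_module \<g> UNIV M \<nu> m" by unfold_locales
  then show ?thesis by blast
qed

lemma levi_simple_hw_module_levi:
  assumes L: "levi_simple_hw_module \<g> hI I \<nu> M" and hI: "hI \<subseteq> cartan \<g>"
  shows "\<exists>m. simple_levi_module \<g> I M \<nu> m"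
proof -
  interpret levi_module \<g> I M
    using L by unfold_locales (simp add: levi_simple_hw_module_def)
  obtain \<pi> where \<pi>: "verma_quotient_map (km_subalgebra \<g> hI I) hI (n_plus \<g> I) \<nu> M \<pi>"
    and wt: "\<pi> 1 \<in> wt_space \<g> M \<nu>" and simple: "simple_module (km_subalgebra \<g> hI I) M"
    using L by (auto simp: levi_simple_hw_module_def)
  have sub: "km_subalgebra \<g> hI I \<subseteq> S" by (rule km_subalgebra_mono[OF hI])
  have "e_gen \<g> ` I \<subseteq> km_subalgebra \<g> hI I" by (auto intro: km_subalgebra_generators)
  note gen = verma_quotient_generator[OF \<pi> sub this wt]
  have nonzero: "\<pi> 1 \<noteq> 0"
    using generator_nonzero[OF gen] simple by (simp add: simple_module_def)
  have "\<exists>S'\<subseteq>S. simple_module S' M" using simple sub by blast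
  with gen nonzero have "simple_levi_module \<g> I M \<nu> (\<pi> 1)" by unfold_locales
  then show ?thesis by blast
qed

end

section \<open>Nonvanishing of monomials\<close>

context kac_moody_algebra
begin

lemma f_monomial_simps [simp]:
  "f_monomial \<g> M d [] x = x"
  "f_monomial \<g> M d (i # is) x = (act M (f_gen \<g> i) ^^ d i) (f_monomial \<g> M d is x)"
  by (simp_all add: f_monomial_def)

lemma f_monomial_append: "f_monomial \<g> M d (is @ js) x = f_monomial \<g> M d is (f_monomial \<g> M d js x)"
  by (simp add: f_monomial_def)

lemma f_monomial_cong:
  "(\<And>i. i \<in> set is \<Longrightarrow> d i = d' i) \<Longrightarrow> f_monomial \<g> M d is x = f_monomial \<g> M d' is x"
  by (induction "is") auto

definition monomial_word :: "('i \<Rightarrow> nat) \<Rightarrow> 'i list \<Rightarrow> 'i list" where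
  "monomial_word d is = concat (map (\<lambda>i. replicate (d i) i) is)"

lemma f_word_replicate: "f_word M (replicate k i) x = (act M (f_gen \<g> i) ^^ k) x"
  by (induction k) auto

lemma f_monomial_eq_f_word: "f_monomial \<g> M d is x = f_word M (monomial_word d is) x"
  by (induction "is") (auto simp: monomial_word_def f_word_append f_word_replicate)

lemma monomial_word_in_lists: "set is \<subseteq> J \<Longrightarrow> monomial_word d is \<in> lists J"
  by (auto simp: monomial_word_def)

lemma count_monomial_word:
  "distinct is \<Longrightarrow> count_list (monomial_word d is) j = (if j \<in> set is then d j else 0)"
proof (induction "is")
  case (Cons i "is")
  have "count_list (replicate k i) j = (if i = j then k else 0)" for k by (induction k) auto
  then show ?case using Cons by (auto simp: monomial_word_def)
qed (simp add: monomial_word_def)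

lemma sum_matrix_antimono:
  assumes "X \<subseteq> Y" "i \<notin> Y"
  shows "(\<Sum>k\<in>Y. int (d k) * cartan_matrix \<g> $ i $ k) \<le> (\<Sum>k\<in>X. int (d k) * cartan_matrix \<g> $ i $ k)"
proof -
  have "(\<Sum>k\<in>Y. int (d k) * cartan_matrix \<g> $ i $ k)
      = (\<Sum>k\<in>X. int (d k) * cartan_matrix \<g> $ i $ k) + (\<Sum>k\<in>Y - X. int (d k) * cartan_matrix \<g> $ i $ k)"
    using assms(1) by (subst sum.subset_diff[of X]) auto
  moreover have "(\<Sum>k\<in>Y - X. int (d k) * cartan_matrix \<g> $ i $ k) \<le> 0"
    using assms(2) by (intro sum_nonpos mult_nonneg_nonpos matrix_off_diag) auto
  ultimately show ?thesis by simp
qed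

lemma lower_weight_insert:
  "i \<notin> X \<Longrightarrow> lower_weight \<g> \<kappa> (insert i X) a h = lower_weight \<g> \<kappa> X a h - a i * root \<g> i h"
  by (simp add: lower_weight_def)

lemma lower_weight_coroot:
  "lower_weight \<g> \<kappa> X (\<lambda>k. of_nat (d k)) (coroot \<g> i)
     = \<kappa> (coroot \<g> i) - of_int (\<Sum>k\<in>X. int (d k) * cartan_matrix \<g> $ i $ k)"
  by (simp add: lower_weight_def root_coroot)

lemma basic_run_facts:
  "basic_run \<g> c X rs H \<Longrightarrow>
     distinct rs \<and> set rs \<inter> H = {} \<and> set rs \<union> H = X \<and> independent_nodes \<g> H"
  by (induction rule: basic_run.induct) auto

end

context levi_module
begin

lemma F_power_closed: "i \<in> I \<Longrightarrow> x \<in> vspace M \<Longrightarrow> (F i ^^ k) x \<in> vspace M"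
  by (induction k) (auto intro: F_closed)

lemma E_power_closed: "i \<in> I \<Longrightarrow> x \<in> vspace M \<Longrightarrow> (E i ^^ k) x \<in> vspace M"
  by (induction k) (auto intro: E_closed)

lemma E_power_scale: "i \<in> I \<Longrightarrow> x \<in> vspace M \<Longrightarrow> (E i ^^ k) (a *\<^sub>C x) = a *\<^sub>C (E i ^^ k) x"
  by (induction k) (auto simp: act_scale generators E_power_closed)

lemma F_power_scale: "i \<in> I \<Longrightarrow> x \<in> vspace M \<Longrightarrow> (F i ^^ k) (a *\<^sub>C x) = a *\<^sub>C (F i ^^ k) x"
  by (induction k) (auto simp: act_scale generators F_power_closed)

lemma F_power_wt_space:
  assumes "x \<in> wt_space \<g> M \<kappa>" "i \<in> I"
  shows "(F i ^^ k) x \<in> wt_space \<g> M (\<lambda>h. \<kappa> h - of_nat k * root \<g> i h)"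
proof (induction k)
  case 0 then show ?case using assms by simp
next
  case (Suc k)
  have eq: "(\<lambda>h. \<kappa> h - of_nat k * root \<g> i h - root \<g> i h) = (\<lambda>h. \<kappa> h - of_nat (Suc k) * root \<g> i h)"
    by (simp add: algebra_simps fun_eq_iff)
  show ?case using F_wt_space[OF Suc assms(2)] unfolding eq by simp
qed

lemma E_F_power:
  assumes x: "x \<in> wt_space \<g> M \<kappa>" and i: "i \<in> I" and Ex: "E i x = 0"
  shows "E i ((F i ^^ Suc k) x) = (of_nat (Suc k) * (\<kappa> (coroot \<g> i) - of_nat k)) *\<^sub>C (F i ^^ k) x"
proof (induction k)
  case 0
  have "E i (F i x) = F i 0 + \<kappa> (coroot \<g> i) *\<^sub>C x"
    using E_F[OF i i wt_spaceD(1)[OF x]] wt_spaceD(2)[OF x coroot_in_cartan] Ex by simp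
  then show ?case by (simp add: act_zero generators i)
next
  case (Suc k)
  let ?y = "(F i ^^ Suc k) x" and ?a = "\<kappa> (coroot \<g> i)"
  have y: "(F i ^^ k) x \<in> vspace M" "?y \<in> vspace M"
    using F_power_closed[OF i wt_spaceD(1)[OF x]] by blast+
  have h: "act M (coroot \<g> i) ?y = (?a - of_nat (Suc k) * 2) *\<^sub>C ?y"
    using wt_spaceD(2)[OF F_power_wt_space[OF x i, of "Suc k"] coroot_in_cartan, of i]
    by (simp only: root_coroot matrix_diag of_int_numeral)
  have "E i ((F i ^^ Suc (Suc k)) x) = F i (E i ?y) + act M (coroot \<g> i) ?y"
    using E_F[OF i i y(2)] by simp
  also have "F i (E i ?y) = (of_nat (Suc k) * (?a - of_nat k)) *\<^sub>C ?y"
    unfolding Suc by (simp add: act_scale generators i y)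
  also have "\<dots> + act M (coroot \<g> i) ?y
      = (of_nat (Suc (Suc k)) * (?a - of_nat (Suc k))) *\<^sub>C ?y"
    unfolding h cvs.scale_left_distrib[symmetric] by (rule arg_cong2[of _ _ _ _ "(*\<^sub>C)"])
      (simp_all add: algebra_simps)
  finally show ?case .
qed

lemma E_power_F_power:
  assumes x: "x \<in> wt_space \<g> M \<kappa>" and i: "i \<in> I" and Ex: "E i x = 0"
  shows "\<exists>a. (E i ^^ k) ((F i ^^ k) x) = a *\<^sub>C x \<and> ((\<forall>j<k. \<kappa> (coroot \<g> i) \<noteq> of_nat j) \<longrightarrow> a \<noteq> 0)"
proof (induction k)
  case 0 then show ?case by (intro exI[of _ 1]) (simp add: scaleC_one)
next
  case (Suc k)
  then obtain a where a: "(E i ^^ k) ((F i ^^ k) x) = a *\<^sub>C x"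
    "(\<forall>j<k. \<kappa> (coroot \<g> i) \<noteq> of_nat j) \<longrightarrow> a \<noteq> 0" by auto
  let ?b = "of_nat (Suc k) * (\<kappa> (coroot \<g> i) - of_nat k) :: complex"
  have "(E i ^^ Suc k) ((F i ^^ Suc k) x) = (E i ^^ k) (?b *\<^sub>C (F i ^^ k) x)"
    unfolding funpow_Suc_right[of k "E i"] o_apply E_F_power[OF assms] ..
  also have "\<dots> = ?b *\<^sub>C a *\<^sub>C x"
    by (subst E_power_scale[OF i F_power_closed[OF i wt_spaceD(1)[OF x]]]) (simp only: a(1))
  also have "\<dots> = (?b * a) *\<^sub>C x" by (rule scaleC_scaleC)
  finally have eq: "(E i ^^ Suc k) ((F i ^^ Suc k) x) = (?b * a) *\<^sub>C x" .
  have "?b * a \<noteq> 0" if "\<forall>j<Suc k. \<kappa> (coroot \<g> i) \<noteq> of_nat j"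
    using that a(2) by (auto simp del: of_nat_Suc)
  then show ?case using eq by blast
qed

lemma f_monomial_closed: "set is \<subseteq> I \<Longrightarrow> x \<in> vspace M \<Longrightarrow> f_monomial \<g> M d is x \<in> vspace M"
  by (induction "is") (auto intro: F_power_closed)

lemma f_monomial_scale:
  "set is \<subseteq> I \<Longrightarrow> x \<in> vspace M \<Longrightarrow> f_monomial \<g> M d is (a *\<^sub>C x) = a *\<^sub>C f_monomial \<g> M d is x"
  by (induction "is") (auto simp: F_power_scale f_monomial_closed)

lemma f_monomial_zero: "set is \<subseteq> I \<Longrightarrow> f_monomial \<g> M d is 0 = 0"
  using f_monomial_scale[of "is" 0 d 0] vspace_closed(1) by simp

lemma f_monomial_wt_space:
  assumes "x \<in> wt_space \<g> M \<kappa>" "set is \<subseteq> I" "distinct is"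
  shows "f_monomial \<g> M d is x \<in> wt_space \<g> M (lower_weight \<g> \<kappa> (set is) (\<lambda>i. of_nat (d i)))"
  using assms(2,3)
proof (induction "is")
  case Nil then show ?case using assms(1) by (simp add: lower_weight_def)
next
  case (Cons i "is")
  then have "lower_weight \<g> \<kappa> (set (i # is)) (\<lambda>i. of_nat (d i))
      = (\<lambda>h. lower_weight \<g> \<kappa> (set is) (\<lambda>i. of_nat (d i)) h - of_nat (d i) * root \<g> i h)"
    by (simp add: lower_weight_insert fun_eq_iff)
  then show ?case using F_power_wt_space[of "f_monomial \<g> M d is x" _ i "d i"] Cons by simp
qed

lemma E_F_power_commute:
  assumes "i \<in> I" "j \<in> I" "i \<noteq> j" "x \<in> vspace M"
  shows "E i ((F j ^^ k) x) = (F j ^^ k) (E i x)"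
proof (induction k)
  case (Suc k)
  then show ?case using assms E_F[of i j "(F j ^^ k) x"] by (simp add: F_power_closed)
qed simp

lemma E_f_monomial:
  assumes "i \<in> I" "set is \<subseteq> I" "i \<notin> set is" "x \<in> vspace M"
  shows "E i (f_monomial \<g> M d is x) = f_monomial \<g> M d is (E i x)"
  using assms(2,3)
  by (induction "is") (use assms(1,4) in \<open>auto simp: E_F_power_commute f_monomial_closed\<close>)

lemma E_power_f_monomial:
  assumes "i \<in> I" "set is \<subseteq> I" "i \<notin> set is" "x \<in> vspace M"
  shows "(E i ^^ k) (f_monomial \<g> M d is x) = f_monomial \<g> M d is ((E i ^^ k) x)"
  using assms by (induction k) (auto simp: E_f_monomial E_power_closed)

text \<open>A factor at a node \<open>j\<close> occurring nowhere else can be stripped off from the right, since \<open>e\<^sub>j\<close>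
  commutes with all the other factors and so meets the power of \<open>f\<^sub>j\<close> directly at the maximal vector,
  where the label is not a natural number and \<open>e\<^sub>j\<close> undoes \<open>f\<^sub>j\<close> up to a nonzero scalar.\<close>

lemma f_monomial_nonzero_strip:
  assumes x: "x \<in> wt_space \<g> M \<kappa>" "E j x = 0" and j: "j \<in> I" "j \<notin> set is" and "is": "set is \<subseteq> I"
    and nonzero: "f_monomial \<g> M d is x \<noteq> 0" and \<kappa>: "\<kappa> (coroot \<g> j) \<notin> \<nat>"
  shows "f_monomial \<g> M d (is @ [j]) x \<noteq> 0"
proof
  assume "f_monomial \<g> M d (is @ [j]) x = 0"
  then have zero: "f_monomial \<g> M d is ((F j ^^ d j) x) = 0" by (simp add: f_monomial_append)
  note xc = wt_spaceD(1)[OF x(1)]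
  obtain a where a: "(E j ^^ d j) ((F j ^^ d j) x) = a *\<^sub>C x" "a \<noteq> 0"
    using E_power_F_power[OF x(1) j(1) x(2), of "d j"] \<kappa> by (metis of_nat_in_Nats)
  have "a *\<^sub>C f_monomial \<g> M d is x = f_monomial \<g> M d is ((E j ^^ d j) ((F j ^^ d j) x))"
    using a f_monomial_scale[OF "is" xc] by simp
  also have "\<dots> = (E j ^^ d j) (f_monomial \<g> M d is ((F j ^^ d j) x))"
    using E_power_f_monomial[OF j(1) "is" j(2) F_power_closed[OF j(1) xc]] by simp
  also have "\<dots> = 0"
    using zero E_power_scale[OF j(1) vspace_closed(1), of "d j" 0] by simp
  finally show False using a(2) nonzero by simp
qed

lemma f_monomial_nonzero_strip_list:
  assumes x: "x \<in> wt_space \<g> M \<kappa>"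
    and "set is \<subseteq> I" "f_monomial \<g> M d is x \<noteq> 0"
    and "distinct (is @ ns)" "set ns \<subseteq> I"
    and "\<And>j. j \<in> set ns \<Longrightarrow> E j x = 0" "\<And>j. j \<in> set ns \<Longrightarrow> \<kappa> (coroot \<g> j) \<notin> \<nat>"
  shows "f_monomial \<g> M d (is @ ns) x \<noteq> 0"
  using assms(4-)
proof (induction ns rule: rev_induct)
  case Nil then show ?case using assms(3) by simp
next
  case (snoc j ns)
  then have "f_monomial \<g> M d (is @ ns) x \<noteq> 0" by auto
  then show ?case
    using f_monomial_nonzero_strip[OF x, of j "is @ ns" d] snoc.prems assms(2) by auto
qed

text \<open>If the integral label at \<open>i\<close> of the weight reached so far is at least the exponent of \<open>f\<^sub>i\<close>,
  then \<open>sl\<^sub>2\<close>-theory for \<open>e\<^sub>i, f\<^sub>i\<close> keeps the vector nonzero.\<close>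

lemma f_monomial_nonzero_Cons:
  assumes x: "x \<in> wt_space \<g> M \<kappa>" "E i x = 0" and i: "set (i # zs) \<subseteq> I" "distinct (i # zs)"
    and nonzero: "f_monomial \<g> M d zs x \<noteq> 0"
    and z: "\<kappa> (coroot \<g> i) = of_int z"
    and le: "int (d i) \<le> z - (\<Sum>k\<in>set zs. int (d k) * cartan_matrix \<g> $ i $ k)"
  shows "f_monomial \<g> M d (i # zs) x \<noteq> 0"
proof
  assume zero: "f_monomial \<g> M d (i # zs) x = 0"
  let ?y = "f_monomial \<g> M d zs x"
  let ?\<kappa> = "lower_weight \<g> \<kappa> (set zs) (\<lambda>i. of_nat (d i))"
  have iI: "i \<in> I" using i by simp
  have y: "?y \<in> wt_space \<g> M ?\<kappa>" using f_monomial_wt_space[OF x(1)] i by simp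
  have "E i ?y = f_monomial \<g> M d zs (E i x)"
    using E_f_monomial[OF iI _ _ wt_spaceD(1)[OF x(1)], of zs d] i by simp
  then have Ey: "E i ?y = 0" using f_monomial_zero[of zs d] x(2) i by simp
  have "?\<kappa> (coroot \<g> i) \<noteq> of_nat j" if "j < d i" for j
  proof -
    have "?\<kappa> (coroot \<g> i) = of_int (z - (\<Sum>k\<in>set zs. int (d k) * cartan_matrix \<g> $ i $ k))"
      unfolding lower_weight_coroot z by simp
    moreover have "(of_nat j :: complex) = of_int (int j)" by simp
    ultimately show ?thesis using le that by (metis of_int_eq_iff not_less of_nat_less_iff)
  qed
  then obtain a where a: "(E i ^^ d i) ((F i ^^ d i) ?y) = a *\<^sub>C ?y" "a \<noteq> 0"
    using E_power_F_power[OF y iI Ey, of "d i"] by blast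
  have "(E i ^^ d i) ((F i ^^ d i) ?y) = 0"
    using zero E_power_scale[OF iI vspace_closed(1), of "d i" 0] by simp
  then show False using a nonzero by simp
qed

lemma f_monomial_nonzero_append:
  assumes x: "x \<in> wt_space \<g> M \<kappa>" and zs: "f_monomial \<g> M d zs x \<noteq> 0"
    and "set (xs @ zs) \<subseteq> I" "distinct (xs @ zs)" "\<And>i. i \<in> set xs \<Longrightarrow> E i x = 0"
    and "\<And>i. i \<in> set xs \<Longrightarrow> \<exists>z. \<kappa> (coroot \<g> i) = of_int z \<and>
           int (d i) \<le> z - (\<Sum>k\<in>set zs. int (d k) * cartan_matrix \<g> $ i $ k)"
  shows "f_monomial \<g> M d (xs @ zs) x \<noteq> 0"
  using assms(3-)
proof (induction xs)
  case Nil then show ?case using zs by simp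
next
  case (Cons i xs)
  then have nonzero: "f_monomial \<g> M d (xs @ zs) x \<noteq> 0" by simp
  obtain z where z: "\<kappa> (coroot \<g> i) = of_int z"
    "int (d i) \<le> z - (\<Sum>k\<in>set zs. int (d k) * cartan_matrix \<g> $ i $ k)"
    using Cons.prems(4)[of i] by auto
  have "(\<Sum>k\<in>set (xs @ zs). int (d k) * cartan_matrix \<g> $ i $ k)
      \<le> (\<Sum>k\<in>set zs. int (d k) * cartan_matrix \<g> $ i $ k)"
    using Cons.prems(2) by (intro sum_matrix_antimono) auto
  then show ?case
    using f_monomial_nonzero_Cons[OF x _ _ _ nonzero z(1)] z(2) Cons.prems by simp
qed

text \<open>A removed node \<open>i\<close> has a neighbour \<open>a\<close> that is applied before it with \<open>c a \<ge> c i\<close>; this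
  alone raises the label at \<open>i\<close> to at least \<open>c i\<close>. Where \<open>a\<close> lies in the terminal set, its contribution
  is part of that of \<open>zs\<close>. The last hypothesis asks only for a lower bound in terms of \<open>H\<close>, because \<open>zs\<close> may
  contain further nodes and have other exponents than \<open>c\<close>, which a change of \<open>\<kappa>\<close> makes up for.\<close>

lemma f_monomial_nonzero_run:
  assumes run: "basic_run \<g> c X rs H"
    and x: "x \<in> wt_space \<g> M \<kappa>" and zs: "f_monomial \<g> M d zs x \<noteq> 0"
    and "set (rs @ zs) \<subseteq> I" "distinct (rs @ zs)" "\<And>i. i \<in> set rs \<Longrightarrow> E i x = 0"
    and "\<And>i. i \<in> set rs \<Longrightarrow> d i = c i"
    and "\<And>i. i \<in> set rs \<Longrightarrow> \<exists>z. \<kappa> (coroot \<g> i) = of_int z \<and>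
           - (\<Sum>k\<in>H. int (c k) * cartan_matrix \<g> $ i $ k)
             \<le> z - (\<Sum>k\<in>set zs. int (d k) * cartan_matrix \<g> $ i $ k)"
  shows "f_monomial \<g> M d (rs @ zs) x \<noteq> 0"
  using run assms(4-)
proof (induction rule: basic_run.induct)
  case (stop X)
  then show ?case using zs by simp
next
  case (step a1 X a2 i rs H)
  let ?A = "\<lambda>k. cartan_matrix \<g> $ i $ k"
  have nonzero: "f_monomial \<g> M d (rs @ zs) x \<noteq> 0" using step.IH step.prems by simp
  note facts = basic_run_facts[OF step.hyps(6)]
  obtain a where a: "a \<in> X - {i}" "?A a \<noteq> 0" "c i \<le> c a"
  proof (cases "i = a1")
    case True
    then show ?thesis using that[of a2] step.hyps by (auto simp: adjacent_def)
  next
    case False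
    then show ?thesis
      using that[of a1] step.hyps matrix_zero_sym[of i a1] by (auto simp: adjacent_def)
  qed
  have "?A a \<le> -1" using a matrix_off_diag[of i a] by fastforce
  then have "int (c a) * ?A a \<le> int (c a) * (-1)" by (intro mult_left_mono) auto
  then have "(\<Sum>k\<in>{a}. int (c k) * ?A k) \<le> - int (c i)" using a(3) by simp
  moreover have "(\<Sum>k\<in>X - {i}. int (c k) * ?A k) \<le> (\<Sum>k\<in>{a}. int (c k) * ?A k)"
    using a(1) by (intro sum_matrix_antimono) auto
  moreover have "(\<Sum>k\<in>X - {i}. int (c k) * ?A k)
      = (\<Sum>k\<in>set rs. int (c k) * ?A k) + (\<Sum>k\<in>H. int (c k) * ?A k)"
    using facts by (subst sum.union_disjoint[symmetric]) auto
  moreover have "(\<Sum>k\<in>set (rs @ zs). int (d k) * ?A k)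
      = (\<Sum>k\<in>set rs. int (c k) * ?A k) + (\<Sum>k\<in>set zs. int (d k) * ?A k)"
    using step.prems(2,4) by (simp add: sum.union_disjoint)
  moreover obtain z where z: "\<kappa> (coroot \<g> i) = of_int z"
    "- (\<Sum>k\<in>H. int (c k) * ?A k) \<le> z - (\<Sum>k\<in>set zs. int (d k) * ?A k)"
    using step.prems(5)[of i] by auto
  ultimately have "int (d i) \<le> z - (\<Sum>k\<in>set (rs @ zs). int (d k) * ?A k)"
    using step.prems(4)[of i] by simp
  then show ?case
    using f_monomial_nonzero_Cons[OF x _ _ _ nonzero z(1)] step.prems by simp
qed

section \<open>Independent sets of nodes\<close>

lemma F_power_commute:
  assumes "i \<in> I" "j \<in> I" "\<not> adjacent \<g> i j" "x \<in> vspace M"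
  shows "F i ((F j ^^ k) x) = (F j ^^ k) (F i x)"
proof (induction k)
  case (Suc k)
  then show ?case using F_commute[OF assms(1-3) F_power_closed[OF assms(2,4)], of k] by simp
qed simp

lemma F_f_monomial_independent:
  assumes "independent_nodes \<g> (set hs)" "distinct hs" "set hs \<subseteq> I" "i \<in> set hs" "x \<in> vspace M"
  shows "F i (f_monomial \<g> M d hs x) = f_monomial \<g> M (\<lambda>k. if k = i then Suc (d k) else d k) hs x"
  using assms(1-4)
proof (induction hs)
  case (Cons k ks)
  let ?d' = "\<lambda>k. if k = i then Suc (d k) else d k"
  have ks: "f_monomial \<g> M d ks x \<in> vspace M" using Cons.prems assms(5) by (simp add: f_monomial_closed)
  show ?case
  proof (cases "k = i")
    case True
    have "f_monomial \<g> M d ks x = f_monomial \<g> M ?d' ks x"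
      using Cons.prems True by (intro f_monomial_cong) auto
    then show ?thesis using True by simp
  next
    case False
    then have "i \<in> set ks" using Cons.prems by simp
    then have "F i (f_monomial \<g> M d ks x) = f_monomial \<g> M ?d' ks x"
      using Cons by (auto simp: independent_nodes_def)
    then show ?thesis
      using F_power_commute[of i k _ "d k", OF _ _ _ ks] Cons.prems False
      by (auto simp: independent_nodes_def)
  qed
qed simp

text \<open>The factors \<open>f\<^sub>i\<close> at independent nodes commute, so only the content of a word matters. Hence
  the weight space that decides whether an independent set is a hole is spanned by one monomial.\<close>

lemma f_word_independent:
  assumes hs: "independent_nodes \<g> (set hs)" "distinct hs" "set hs \<subseteq> I" and x: "x \<in> vspace M"
    and "w \<in> lists (set hs)"
  shows "f_word M w x = f_monomial \<g> M (count_list w) hs x"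
  using assms(5)
proof (induction w)
  case Nil
  have "f_monomial \<g> M (\<lambda>_. 0) hs x = x" by (induction hs) auto
  then show ?case by (simp add: fun_eq_iff[symmetric])
next
  case (Cons i w)
  then have "f_word M (i # w) x = f_monomial \<g> M (\<lambda>k. if k = i then Suc (count_list w k) else count_list w k) hs x"
    using F_f_monomial_independent[OF hs _ x, of i "count_list w"] by simp
  also have "\<dots> = f_monomial \<g> M (count_list (i # w)) hs x" by (rule f_monomial_cong) auto
  finally show ?case .
qed

lemma f_monomial_reorder:
  assumes "independent_nodes \<g> (set hs)" "distinct hs" "distinct hs'" "set hs' = set hs"
    "set hs \<subseteq> I" "x \<in> vspace M"
  shows "f_monomial \<g> M d hs' x = f_monomial \<g> M d hs x"
proof -
  have "f_monomial \<g> M d hs' x = f_monomial \<g> M (count_list (monomial_word d hs')) hs x"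
    unfolding f_monomial_eq_f_word[of M d hs']
    using assms monomial_word_in_lists[of hs' "set hs" d] by (intro f_word_independent) auto
  also have "\<dots> = f_monomial \<g> M d hs x"
    using assms by (intro f_monomial_cong) (simp add: count_monomial_word)
  finally show ?thesis .
qed

lemma f_monomial_add:
  assumes "independent_nodes \<g> (set hs)" "distinct hs" "set hs \<subseteq> I" "x \<in> vspace M"
  shows "f_monomial \<g> M d hs (f_monomial \<g> M d' hs x) = f_monomial \<g> M (\<lambda>i. d i + d' i) hs x"
proof -
  have "f_monomial \<g> M d hs (f_monomial \<g> M d' hs x)
      = f_word M (monomial_word d hs @ monomial_word d' hs) x"
    by (simp add: f_monomial_eq_f_word f_word_append)
  also have "\<dots> = f_monomial \<g> M (count_list (monomial_word d hs @ monomial_word d' hs)) hs x"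
    using assms monomial_word_in_lists[of hs "set hs"] by (intro f_word_independent) auto
  also have "\<dots> = f_monomial \<g> M (\<lambda>i. d i + d' i) hs x"
    using assms by (intro f_monomial_cong) (simp add: count_monomial_word)
  finally show ?thesis .
qed

end

section \<open>Weights and singular vectors attached to independent sets\<close>

context kac_moody_algebra
begin

text \<open>Meaningful at the nodes of \<open>J_wt \<g> \<Lambda>\<close>, where \<open>\<Lambda>(\<alpha>\<^sub>i\<^sup>\<or>)\<close> is a natural number.\<close>

definition dynkin_label :: "('g \<Rightarrow> complex) \<Rightarrow> 'i \<Rightarrow> nat" where
  "dynkin_label \<Lambda> i = nat \<lfloor>Re (\<Lambda> (coroot \<g> i))\<rfloor>"

lemma dynkin_label: "i \<in> J_wt \<g> \<Lambda> \<Longrightarrow> \<Lambda> (coroot \<g> i) = of_nat (dynkin_label \<Lambda> i)"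
  by (auto simp: J_wt_def dynkin_label_def elim: Nats_cases)

text \<open>For independent \<open>H \<subseteq> J_wt \<g> \<Lambda>\<close> this is \<open>w\<^sub>H \<bullet> \<Lambda>\<close>. The explicit form puts its values at coroots and its
  comparison with \<open>\<mu>\<close> within reach of integer arithmetic.\<close>

definition singular_weight :: "('g \<Rightarrow> complex) \<Rightarrow> 'i set \<Rightarrow> 'g \<Rightarrow> complex" where
  "singular_weight \<Lambda> H = lower_weight \<g> \<Lambda> H (\<lambda>i. of_nat (Suc (dynkin_label \<Lambda> i)))"

lemma lower_weight_eq_singular_weight:
  "H \<subseteq> J_wt \<g> \<Lambda> \<Longrightarrow> lower_weight \<g> \<Lambda> H (\<lambda>i. \<Lambda> (coroot \<g> i) + 1) = singular_weight \<Lambda> H"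
  by (auto simp: singular_weight_def lower_weight_def fun_eq_iff dynkin_label subset_iff
      intro!: sum.cong)

lemma simple_reflections_commute:
  assumes "\<not> adjacent \<g> i j"
  shows "simple_reflection \<g> i (simple_reflection \<g> j \<kappa>) = simple_reflection \<g> j (simple_reflection \<g> i \<kappa>)"
proof (cases "i = j")
  case False
  then have "cartan_matrix \<g> $ i $ j = 0" "cartan_matrix \<g> $ j $ i = 0"
    using assms matrix_zero_sym[of i j] by (auto simp: adjacent_def)
  then show ?thesis by (simp add: simple_reflection_def root_coroot fun_eq_iff)
qed simp

lemma w_prod_apply:
  assumes "independent_nodes \<g> H"
  shows "w_prod \<g> H \<kappa> = (\<lambda>x. \<kappa> x - (\<Sum>i\<in>H. \<kappa> (coroot \<g> i) * root \<g> i x))"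
proof -
  interpret comp_fun_commute_on H "\<lambda>i w. simple_reflection \<g> i \<circ> w"
    by unfold_locales
      (use assms simple_reflections_commute in \<open>auto simp: fun_eq_iff independent_nodes_def\<close>)
  have "Finite_Set.fold (\<lambda>i w. simple_reflection \<g> i \<circ> w) id X \<kappa>
      = (\<lambda>x. \<kappa> x - (\<Sum>i\<in>X. \<kappa> (coroot \<g> i) * root \<g> i x))" if "X \<subseteq> H" for X
    using finite[of X] that
  proof (induction X rule: finite_induct)
    case (insert i X)
    have "root \<g> k (coroot \<g> i) = 0" if "k \<in> X" for k
      using insert that assms by (force simp: independent_nodes_def adjacent_def root_coroot)
    then have zero: "(\<Sum>k\<in>X. \<kappa> (coroot \<g> k) * root \<g> k (coroot \<g> i)) = 0" by simp
    have "Finite_Set.fold (\<lambda>i w. simple_reflection \<g> i \<circ> w) id (insert i X) \<kappa>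
        = simple_reflection \<g> i (Finite_Set.fold (\<lambda>i w. simple_reflection \<g> i \<circ> w) id X \<kappa>)"
      by (simp only: fold_insert[OF insert.prems insert.hyps] o_apply)
    also have "Finite_Set.fold (\<lambda>i w. simple_reflection \<g> i \<circ> w) id X \<kappa>
        = (\<lambda>x. \<kappa> x - (\<Sum>i\<in>X. \<kappa> (coroot \<g> i) * root \<g> i x))"
      using insert.prems by (intro insert.IH) simp
    finally have eq: "Finite_Set.fold (\<lambda>i w. simple_reflection \<g> i \<circ> w) id (insert i X) \<kappa>
        = simple_reflection \<g> i (\<lambda>x. \<kappa> x - (\<Sum>i\<in>X. \<kappa> (coroot \<g> i) * root \<g> i x))" .
    show ?case
      unfolding eq using insert.hyps zero by (simp add: simple_reflection_def algebra_simps)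
  qed simp
  then show ?thesis by (simp add: w_prod_def)
qed

lemma dot_action_w_prod:
  assumes "weyl_vector \<g> \<rho>" "independent_nodes \<g> H" "H \<subseteq> J_wt \<g> \<Lambda>"
  shows "dot_action \<rho> (w_prod \<g> H) \<Lambda> = singular_weight \<Lambda> H"
  using assms
  by (simp add: lower_weight_eq_singular_weight[OF assms(3), symmetric] dot_action_def w_prod_apply
      lower_weight_def weyl_vector_def fun_eq_iff)

lemma lower_weight_eq_weight_below:
  "lower_weight \<g> \<Lambda> X (\<lambda>i. of_nat (d i)) = weight_below \<Lambda> (\<lambda>i. if i \<in> X then d i else 0)"
  by (auto simp: weight_below_apply lower_weight_def fun_eq_iff
      if_distrib[of of_nat] if_distrib[of "\<lambda>x. x * _"] sum.If_cases cong: if_cong)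

lemma linear_singular_weight:
  assumes "linear_functional_on (cartan \<g>) \<Lambda>"
  shows "linear_functional_on (cartan \<g>) (singular_weight \<Lambda> H)"
  using assms root_linear
  by (simp add: linear_functional_on_def singular_weight_def lower_weight_def algebra_simps
      sum.distrib sum_distrib_left)

lemma singular_weight_inject:
  assumes "\<And>h. h \<in> cartan \<g> \<Longrightarrow> singular_weight \<Lambda> H h = singular_weight \<Lambda> H' h"
  shows "H = H'"
proof -
  let ?n = "\<lambda>H i. if i \<in> H then Suc (dynkin_label \<Lambda> i) else 0"
  have eq: "singular_weight \<Lambda> H = weight_below \<Lambda> (?n H)" for H
    unfolding singular_weight_def by (rule lower_weight_eq_weight_below)
  have "?n H = ?n H'" by (rule weight_below_inject[of \<Lambda>]) (simp only: eq[symmetric] assms)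
  then have "i \<in> H \<longleftrightarrow> i \<in> H'" for i by (metis nat.distinct(1))
  then show ?thesis by auto
qed

lemma singular_weight_coroot:
  "i \<in> J_wt \<g> \<Lambda> \<Longrightarrow> singular_weight \<Lambda> H (coroot \<g> i)
     = of_int (int (dynkin_label \<Lambda> i) - (\<Sum>k\<in>H. int (Suc (dynkin_label \<Lambda> k)) * cartan_matrix \<g> $ i $ k))"
  unfolding singular_weight_def lower_weight_coroot by (simp only: dynkin_label of_int_diff of_int_of_nat_eq)

lemma refined_cut_iff:
  assumes "i \<in> J_wt \<g> \<Lambda>"
  shows "i \<in> refined_cut \<g> \<Lambda> c K H' \<longleftrightarrow> i \<in> H' \<and>
    int (dynkin_label \<Lambda> i) - (\<Sum>j\<in>K - J_wt \<g> \<Lambda>. int (c j) * cartan_matrix \<g> $ i $ j) < int (c i)"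
proof -
  let ?z = "int (dynkin_label \<Lambda> i) - (\<Sum>j\<in>K - J_wt \<g> \<Lambda>. int (c j) * cartan_matrix \<g> $ i $ j)"
  have "\<Lambda> (coroot \<g> i) - (\<Sum>j \<in> K - J_wt \<g> \<Lambda>. of_nat (c j) * root \<g> j (coroot \<g> i)) = of_int ?z"
    using assms by (simp add: dynkin_label root_coroot)
  then have "i \<in> refined_cut \<g> \<Lambda> c K H' \<longleftrightarrow> i \<in> H' \<and> real (c i) > real_of_int ?z"
    by (simp only: refined_cut_def mem_Collect_eq complex_Re_of_int)
  then show ?thesis by (simp only: of_int_less_iff[symmetric, where 'a = real] of_int_of_nat_eq)
qed

lemma refined_cut_subset: "refined_cut \<g> \<Lambda> c K H' \<subseteq> H'"
  by (auto simp: refined_cut_def)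

lemma label_less_of_refined_cut:
  assumes i: "i \<in> refined_cut \<g> \<Lambda> c K H'" "i \<in> J_wt \<g> \<Lambda>"
    and j: "j \<in> K - J_wt \<g> \<Lambda>" "cartan_matrix \<g> $ i $ j \<noteq> 0"
  shows "int (dynkin_label \<Lambda> i) + int (c j) < int (c i)"
proof -
  have "cartan_matrix \<g> $ i $ j \<le> -1" using matrix_off_diag[of i j] i j by fastforce
  then have "int (c j) * cartan_matrix \<g> $ i $ j \<le> int (c j) * (-1)" by (intro mult_left_mono) auto
  moreover have "(\<Sum>k\<in>K - J_wt \<g> \<Lambda>. int (c k) * cartan_matrix \<g> $ i $ k)
      \<le> (\<Sum>k\<in>{j}. int (c k) * cartan_matrix \<g> $ i $ k)"
    using i j by (intro sum_matrix_antimono) auto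
  ultimately show ?thesis using i refined_cut_iff[OF i(2), of c K H'] by simp
qed

lemma label_less_exponent:
  assumes "i \<in> refined_cut \<g> \<Lambda> c K H'" "i \<in> J_wt \<g> \<Lambda>"
  shows "dynkin_label \<Lambda> i < c i"
proof -
  have "(\<Sum>j\<in>K - J_wt \<g> \<Lambda>. int (c j) * cartan_matrix \<g> $ i $ j) \<le> (\<Sum>j\<in>{}. int (c j) * cartan_matrix \<g> $ i $ j)"
    using assms(2) by (intro sum_matrix_antimono) auto
  then show ?thesis using assms refined_cut_iff[OF assms(2), of c K H'] by simp
qed

text \<open>The exponents left over once the singular vector of \<open>H\<close> has been reached. On a refined cut \<open>c i\<close>
  exceeds the label, so the subtraction is not truncated.\<close>

definition residual :: "('g \<Rightarrow> complex) \<Rightarrow> 'i set \<Rightarrow> ('i \<Rightarrow> nat) \<Rightarrow> 'i \<Rightarrow> nat" where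
  "residual \<Lambda> H c i = (if i \<in> H then c i - Suc (dynkin_label \<Lambda> i) else c i)"

lemma lower_weight_residual:
  assumes "H \<subseteq> K" "\<And>i. i \<in> H \<Longrightarrow> dynkin_label \<Lambda> i < c i"
  shows "lower_weight \<g> (singular_weight \<Lambda> H) K (\<lambda>i. of_nat (residual \<Lambda> H c i))
    = lower_weight \<g> \<Lambda> K (\<lambda>i. of_nat (c i))"
proof
  fix x
  have "of_nat (Suc (dynkin_label \<Lambda> i)) + of_nat (residual \<Lambda> H c i) = (of_nat (c i) :: complex)"
    if "i \<in> H" for i
    using assms(2)[OF that] that by (simp only: residual_def if_True of_nat_add[symmetric]) simp
  then have "(\<Sum>i\<in>H. of_nat (Suc (dynkin_label \<Lambda> i)) * root \<g> i x) + (\<Sum>i\<in>H. of_nat (residual \<Lambda> H c i) * root \<g> i x)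
      = (\<Sum>i\<in>H. of_nat (c i) * root \<g> i x)"
    unfolding sum.distrib[symmetric] distrib_right[symmetric] by (intro sum.cong) auto
  moreover have "(\<Sum>i\<in>K - H. of_nat (residual \<Lambda> H c i) * root \<g> i x) = (\<Sum>i\<in>K - H. of_nat (c i) * root \<g> i x)"
    by (intro sum.cong) (auto simp: residual_def)
  moreover have "(\<Sum>i\<in>K. a i) = (\<Sum>i\<in>K - H. a i) + (\<Sum>i\<in>H. a i)" for a :: "'i \<Rightarrow> complex"
    using assms(1) by (intro sum.subset_diff) auto
  ultimately show "lower_weight \<g> (singular_weight \<Lambda> H) K (\<lambda>i. of_nat (residual \<Lambda> H c i)) x
      = lower_weight \<g> \<Lambda> K (\<lambda>i. of_nat (c i)) x"
    by (simp add: lower_weight_def singular_weight_def algebra_simps)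
qed

text \<open>A hole inside the complement of \<open>J_mod \<g> \<Lambda> V\<close> would contain a minimal one, which is contained
  in \<open>J_mod \<g> \<Lambda> V\<close> as well and hence empty; but \<open>\<Lambda>\<close> itself is a weight.\<close>

lemma is_weight_singular_weight:
  assumes \<Lambda>: "is_weight \<g> V \<Lambda>" and H: "H \<subseteq> J_wt \<g> \<Lambda>" "independent_nodes \<g> H" "H \<inter> J_mod \<g> \<Lambda> V = {}"
  shows "is_weight \<g> V (singular_weight \<Lambda> H)"
proof (rule ccontr)
  assume "\<not> is_weight \<g> V (singular_weight \<Lambda> H)"
  then have "is_hole \<g> \<Lambda> V H" using H by (simp add: is_hole_def lower_weight_eq_singular_weight)
  then have "{X. X \<subseteq> H \<and> is_hole \<g> \<Lambda> V X} \<noteq> {}" by blast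
  then obtain X where "X \<in> {X. X \<subseteq> H \<and> is_hole \<g> \<Lambda> V X}"
    "\<forall>Y\<in>{X. X \<subseteq> H \<and> is_hole \<g> \<Lambda> V X}. Y \<subseteq> X \<longrightarrow> X = Y"
    using finite_has_minimal[OF finite, of "{X. X \<subseteq> H \<and> is_hole \<g> \<Lambda> V X}"] by blast
  then have X: "X \<subseteq> H" "is_hole \<g> \<Lambda> V X" "\<And>Y. Y \<subset> X \<Longrightarrow> \<not> is_hole \<g> \<Lambda> V Y"
    by (blast, blast, blast)
  then have "X \<subseteq> J_mod \<g> \<Lambda> V" unfolding J_mod_def by blast
  then have "X = {}" using X(1) H(3) by blast
  then show False using X(2) \<Lambda> by (simp add: is_hole_def lower_weight_def)
qed

end

context levi_module
begin

lemma singular_vector_nonzero: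
  assumes v: "maximal_vector \<Lambda> v" "vspace M = generated_by v"
    and hs: "independent_nodes \<g> (set hs)" "distinct hs" "set hs \<subseteq> I"
    and wt: "is_weight \<g> M (singular_weight \<Lambda> (set hs))"
  shows "f_monomial \<g> M (\<lambda>i. Suc (dynkin_label \<Lambda> i)) hs v \<noteq> 0"
proof
  assume zero: "f_monomial \<g> M (\<lambda>i. Suc (dynkin_label \<Lambda> i)) hs v = 0"
  let ?n = "\<lambda>i. if i \<in> set hs then Suc (dynkin_label \<Lambda> i) else 0"
  have eq: "singular_weight \<Lambda> (set hs) = weight_below \<Lambda> ?n"
    unfolding singular_weight_def by (rule lower_weight_eq_weight_below)
  have "f_word M w v = 0" if w: "w \<in> lists I" "count_list w = ?n" for w
  proof -
    have "w \<in> lists (set hs)"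
    proof -
      have "i \<in> set hs" if "i \<in> set w" for i
      proof (rule ccontr)
        assume "i \<notin> set hs"
        then have "count_list w i = 0" unfolding w(2) by simp
        then show False using that by (simp add: count_list_0_iff)
      qed
      then show ?thesis by auto
    qed
    then have "f_word M w v = f_monomial \<g> M (count_list w) hs v"
      using f_word_independent[OF hs maximal_vector_closed[OF v(1)]] by blast
    also have "\<dots> = f_monomial \<g> M (\<lambda>i. Suc (dynkin_label \<Lambda> i)) hs v"
      by (rule f_monomial_cong) (simp add: w(2))
    finally show ?thesis using zero by simp
  qed
  then have "(\<lambda>w. f_word M w v) ` {w \<in> lists I. count_list w = ?n} \<subseteq> {0}" by auto
  then have "cvs.span ((\<lambda>w. f_word M w v) ` {w \<in> lists I. count_list w = ?n}) \<subseteq> {0}"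
    by (rule cvs.span_minimal) simp
  then have "wt_space \<g> M (singular_weight \<Lambda> (set hs)) \<subseteq> {0}"
    using weight_space_subset_span_words[OF v, of ?n] unfolding eq by (rule order_trans[rotated])
  then show False
    using wt cvs.subspace_0[OF subspace_wt_space, of "singular_weight \<Lambda> (set hs)"]
    by (auto simp: is_weight_def)
qed

text \<open>For \<open>j\<close> in the independent set the factor \<open>f\<^sub>j\<close> can be moved to the front. It then meets a vector
  whose label at \<open>j\<close> is still \<open>\<Lambda>(\<alpha>\<^sub>j\<^sup>\<or>)\<close>, and the exponent \<open>\<Lambda>(\<alpha>\<^sub>j\<^sup>\<or>) + 1\<close> is the one at which
  \<open>e\<^sub>j\<close> gives zero.\<close>

lemma maximal_singular_vector:
  assumes v: "maximal_vector \<Lambda> v"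
    and hs: "independent_nodes \<g> (set hs)" "distinct hs" "set hs \<subseteq> I" "set hs \<subseteq> J_wt \<g> \<Lambda>"
  shows "maximal_vector (singular_weight \<Lambda> (set hs)) (f_monomial \<g> M (\<lambda>i. Suc (dynkin_label \<Lambda> i)) hs v)"
  unfolding maximal_vector_def
proof (intro conjI ballI)
  let ?d = "\<lambda>i. Suc (dynkin_label \<Lambda> i)"
  note vc = maximal_vector_closed[OF v]
  have vw: "v \<in> wt_space \<g> M \<Lambda>" and Ev: "\<And>i. i \<in> I \<Longrightarrow> E i v = 0"
    using v by (auto simp: maximal_vector_def)
  show "f_monomial \<g> M ?d hs v \<in> wt_space \<g> M (singular_weight \<Lambda> (set hs))"
    unfolding singular_weight_def by (rule f_monomial_wt_space[OF vw hs(3,2)])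
  fix j assume j: "j \<in> I"
  show "E j (f_monomial \<g> M ?d hs v) = 0"
  proof (cases "j \<in> set hs")
    case False
    then show ?thesis
      using E_f_monomial[OF j hs(3) _ vc] Ev[OF j] f_monomial_zero[OF hs(3)] by simp
  next
    case True
    define ks where "ks = remove1 j hs"
    have ks: "distinct (j # ks)" "set (j # ks) = set hs"
      using True hs(2) by (auto simp: ks_def)
    have ksI: "set ks \<subseteq> I" "j \<notin> set ks" using ks hs(3) by auto
    let ?y = "f_monomial \<g> M ?d ks v"
    let ?\<kappa> = "lower_weight \<g> \<Lambda> (set ks) (\<lambda>i. of_nat (?d i))"
    have y: "?y \<in> wt_space \<g> M ?\<kappa>" using f_monomial_wt_space[OF vw ksI(1), of ?d] ks(1)
      by (simp del: of_nat_Suc)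
    have Ey: "E j ?y = 0"
      using E_f_monomial[OF j ksI vc] Ev[OF j] f_monomial_zero[OF ksI(1)] by simp
    have "cartan_matrix \<g> $ j $ k = 0" if "k \<in> set ks" for k
    proof -
      have "k \<in> set hs" "j \<noteq> k" using ks that by auto
      then show ?thesis using hs(1) True by (auto simp: independent_nodes_def adjacent_def)
    qed
    then have "?\<kappa> (coroot \<g> j) = of_nat (dynkin_label \<Lambda> j)"
      unfolding lower_weight_coroot using True hs(4) by (simp add: dynkin_label subset_iff)
    then have "E j ((F j ^^ Suc (dynkin_label \<Lambda> j)) ?y) = 0"
      using E_F_power[OF y j Ey, of "dynkin_label \<Lambda> j"] by simp
    moreover have "f_monomial \<g> M ?d hs v = f_monomial \<g> M ?d (j # ks) v"
      by (rule f_monomial_reorder[OF hs(1,2) ks(1) ks(2) hs(3) vc, symmetric])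
    ultimately show ?thesis by simp
  qed
qed

text \<open>The nodes outside \<open>J_wt \<g> \<Lambda>\<close> split into those whose label for \<open>\<nu> = singular_weight \<Lambda> H\<close> is
  not a natural number, which together with \<open>H\<close> can be stripped off, and those whose label became a
  natural number in passing from \<open>\<Lambda>\<close> to \<open>\<nu>\<close>. The latter have a neighbour in \<open>H\<close>, and the definition of the refined cut makes the
  residual exponent there large enough for them.\<close>

lemma refined_monomial_nonzero:
  assumes run: "basic_run \<g> c (J_wt \<g> \<Lambda> \<inter> K) rs H'" and H: "H = refined_cut \<g> \<Lambda> c K H'"
    and KI: "K \<subseteq> I" and m: "maximal_vector (singular_weight \<Lambda> H) m" "m \<noteq> 0"
    and ds: "listing ds (H' - H)" and hs: "listing hs H"
  obtains as bs where "distinct (as @ bs)" "set (as @ bs) = K - J_wt \<g> \<Lambda>"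
    "f_monomial \<g> M (residual \<Lambda> H c) (rs @ ds @ as @ hs @ bs) m \<noteq> 0"
proof -
  let ?\<nu> = "singular_weight \<Lambda> H" and ?d = "residual \<Lambda> H c" and ?J = "J_wt \<g> \<Lambda>"
  let ?A = "\<lambda>i k. cartan_matrix \<g> $ i $ k" and ?l = "dynkin_label \<Lambda>"
  note facts = basic_run_facts[OF run]
  have HH': "H \<subseteq> H'" using H refined_cut_subset by simp
  have H'J: "H' \<subseteq> ?J \<inter> K" using facts by auto
  have ind: "?A i k = 0" if "i \<in> H'" "k \<in> H'" "i \<noteq> k" for i k
    using facts that by (auto simp: independent_nodes_def adjacent_def)
  obtain as where as: "set as = {i \<in> K - ?J. ?\<nu> (coroot \<g> i) \<in> \<nat>}" "distinct as"
    using finite_distinct_list[OF finite] by blast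
  obtain bs where bs: "set bs = {i \<in> K - ?J. ?\<nu> (coroot \<g> i) \<notin> \<nat>}" "distinct bs"
    using finite_distinct_list[OF finite] by blast
  have sets: "set ds = H' - H" "distinct ds" "set hs = H" "distinct hs"
    using ds hs by (auto simp: listing_def)
  have rs: "set rs \<inter> H' = {}" "set rs \<subseteq> ?J \<inter> K" "distinct rs" using facts by blast+
  have ab: "set as \<inter> set bs = {}" "set as \<subseteq> K - ?J" "set bs \<subseteq> K - ?J"
    unfolding as bs by blast+
  have dist: "distinct (rs @ ds @ as @ hs @ bs)"
  proof -
    have "set rs \<inter> set ds = {}" "set rs \<inter> set as = {}" "set rs \<inter> set hs = {}" "set rs \<inter> set bs = {}"
      "set ds \<inter> set as = {}" "set ds \<inter> set hs = {}" "set ds \<inter> set bs = {}"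
      "set as \<inter> set hs = {}" "set hs \<inter> set bs = {}"
      unfolding sets(1,3) using rs ab HH' H'J by blast+
    then show ?thesis using rs(3) sets(2,4) as(2) bs(2) ab(1) by (simp add: Int_Un_distrib)
  qed
  have "set rs \<subseteq> I" "set ds \<subseteq> I" "set as \<subseteq> I" "set hs \<subseteq> I" "set bs \<subseteq> I"
    unfolding sets(1,3) using rs(2) ab(2,3) HH' H'J KI by blast+
  then have sub: "set (rs @ ds @ as @ hs @ bs) \<subseteq> I" by simp
  have mw: "m \<in> wt_space \<g> M ?\<nu>" and Em: "\<And>i. i \<in> I \<Longrightarrow> E i m = 0"
    using m by (auto simp: maximal_vector_def)
  have label: "?l k < c k" if "k \<in> H" for k
  proof -
    have "k \<in> ?J" using that HH' H'J by blast
    then show ?thesis using label_less_exponent[of k \<Lambda> c K H'] that unfolding H by blast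
  qed
  have \<nu>H: "?\<nu> (coroot \<g> i) \<notin> \<nat>" if i: "i \<in> H" for i
  proof
    assume "?\<nu> (coroot \<g> i) \<in> \<nat>"
    have single: "(\<Sum>k\<in>H. int (Suc (?l k)) * ?A i k) = (\<Sum>k\<in>{i}. int (Suc (?l k)) * ?A i k)"
      using i HH' ind by (intro sum.mono_neutral_right) auto
    have "?\<nu> (coroot \<g> i) = of_int (- int (?l i) - 2)"
    proof -
      have "i \<in> ?J" using i HH' H'J by blast
      from singular_weight_coroot[OF this, of H]
      have "?\<nu> (coroot \<g> i) = of_int (int (?l i) - int (Suc (?l i)) * 2)"
        unfolding single by (simp only: sum.insert sum.empty finite.emptyI empty_iff not_False_eq_True
            matrix_diag add_0_right)
      also have "int (?l i) - int (Suc (?l i)) * 2 = - int (?l i) - 2" by simp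
      finally show ?thesis .
    qed
    moreover obtain n where "?\<nu> (coroot \<g> i) = of_nat n"
      using \<open>?\<nu> (coroot \<g> i) \<in> \<nat>\<close> by (rule Nats_cases)
    ultimately have "(of_int (int n) :: complex) = of_int (- int (?l i) - 2)"
      by (simp only: of_int_of_nat_eq)
    then show False unfolding of_int_eq_iff by simp
  qed
  have step1: "f_monomial \<g> M ?d (hs @ bs) m \<noteq> 0"
  proof -
    have "f_monomial \<g> M ?d ([] @ hs @ bs) m \<noteq> 0"
    proof (rule f_monomial_nonzero_strip_list[OF mw])
      fix j assume "j \<in> set (hs @ bs)"
      then show "?\<nu> (coroot \<g> j) \<notin> \<nat>" using \<nu>H sets(3) bs(1) by auto
    qed (use m(2) dist sub Em in auto)
    then show ?thesis by simp
  qed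
  have step2: "f_monomial \<g> M ?d (as @ hs @ bs) m \<noteq> 0"
  proof (rule f_monomial_nonzero_append[OF mw step1])
    fix i assume i: "i \<in> set as"
    then have iK: "i \<in> K - ?J" "?\<nu> (coroot \<g> i) \<in> \<nat>" using as by auto
    then obtain n where n: "?\<nu> (coroot \<g> i) = of_int (int n)" by (auto elim: Nats_cases)
    \<comment> \<open>The label at \<open>i\<close> was not a natural number for \<open>\<Lambda>\<close>, so \<open>i\<close> has a neighbour in \<open>H\<close>.\<close>
    have "\<exists>k\<in>H. ?A i k \<noteq> 0"
    proof (rule ccontr)
      assume "\<not> (\<exists>k\<in>H. ?A i k \<noteq> 0)"
      then have "?\<nu> (coroot \<g> i) = \<Lambda> (coroot \<g> i)"
        by (simp add: singular_weight_def lower_weight_def root_coroot)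
      then show False using iK by (auto simp: J_wt_def)
    qed
    then obtain k where k: "k \<in> H" "?A i k \<noteq> 0" by blast
    then have ki: "?A k i \<noteq> 0" "k \<in> ?J" using matrix_zero_sym HH' H'J by auto
    have "int (?l k) + int (c i) < int (c k)"
      using label_less_of_refined_cut[of k \<Lambda> c K H' i] k ki iK H by simp
    then have "int (c i) \<le> int (?d k)" using k by (simp add: residual_def)
    moreover have "?A i k \<le> -1" using matrix_off_diag[of i k] k ki iK by fastforce
    then have "int (?d k) * ?A i k \<le> int (?d k) * (-1)" by (intro mult_left_mono) auto
    moreover have "(\<Sum>k\<in>set (hs @ bs). int (?d k) * ?A i k) \<le> (\<Sum>k\<in>{k}. int (?d k) * ?A i k)"
      using k sets dist i by (intro sum_matrix_antimono) auto
    moreover have "?d i = c i" using iK HH' H'J by (auto simp: residual_def)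
    ultimately have "int (?d i) \<le> int n - (\<Sum>k\<in>set (hs @ bs). int (?d k) * ?A i k)" by simp
    with n show "\<exists>z. ?\<nu> (coroot \<g> i) = of_int z \<and>
        int (?d i) \<le> z - (\<Sum>k\<in>set (hs @ bs). int (?d k) * ?A i k)" by blast
  qed (use dist sub Em in auto)
  have step3: "f_monomial \<g> M ?d (ds @ as @ hs @ bs) m \<noteq> 0"
  proof (rule f_monomial_nonzero_append[OF mw step2])
    fix i assume "i \<in> set ds"
    then have i: "i \<in> H'" "i \<notin> H" "i \<in> ?J" using sets H'J by auto
    \<comment> \<open>Passing from \<open>\<Lambda>\<close> to \<open>\<nu>\<close> does not change the label at \<open>i\<close>, and not being cut bounds \<open>c i\<close>.\<close>
    have "(\<Sum>k\<in>H. int (Suc (?l k)) * ?A i k) = 0"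
      using i HH' ind by (intro sum.neutral) auto
    then have "?\<nu> (coroot \<g> i) = of_int (int (?l i))"
      using singular_weight_coroot[OF i(3), of H] by simp
    moreover have "int (c i) \<le> int (?l i) - (\<Sum>j\<in>K - ?J. int (c j) * ?A i j)"
      using i refined_cut_iff[OF i(3), of c K H'] H by auto
    moreover have "(\<Sum>k\<in>set (as @ hs @ bs). int (?d k) * ?A i k) \<le> (\<Sum>k\<in>K - ?J. int (?d k) * ?A i k)"
      using as bs sets i by (intro sum_matrix_antimono) auto
    moreover have "(\<Sum>k\<in>K - ?J. int (?d k) * ?A i k) = (\<Sum>k\<in>K - ?J. int (c k) * ?A i k)"
      using HH' H'J by (intro sum.cong) (auto simp: residual_def)
    moreover have "?d i = c i" using i by (simp add: residual_def)
    ultimately show "\<exists>z. ?\<nu> (coroot \<g> i) = of_int z \<and>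
        int (?d i) \<le> z - (\<Sum>k\<in>set (as @ hs @ bs). int (?d k) * ?A i k)"
      by (intro exI[of _ "int (?l i)"]) auto
  qed (use dist sub Em in auto)
  have "f_monomial \<g> M ?d (rs @ ds @ as @ hs @ bs) m \<noteq> 0"
  proof (rule f_monomial_nonzero_run[OF run mw step3])
    fix i assume i: "i \<in> set rs"
    then have iJ: "i \<in> ?J" "i \<notin> H'" using facts by auto
    then show "?d i = c i" using HH' by (auto simp: residual_def)
    \<comment> \<open>At \<open>k \<in> H\<close> the residual exponent and the exponent already used for \<open>\<nu>\<close> add up to \<open>c k\<close>, so
      the label at \<open>i\<close> is as large as if all of \<open>H'\<close> had been applied to a vector of weight \<open>\<Lambda>\<close>.\<close>
    let ?zs = "ds @ as @ hs @ bs"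
    let ?z = "int (?l i) - (\<Sum>k\<in>H. int (Suc (?l k)) * ?A i k)"
    have "(\<Sum>k\<in>set ?zs. int (?d k) * ?A i k) \<le> (\<Sum>k\<in>H'. int (?d k) * ?A i k)"
      using as bs sets iJ HH' by (intro sum_matrix_antimono) auto
    also have "\<dots> = (\<Sum>k\<in>H' - H. int (c k) * ?A i k) + (\<Sum>k\<in>H. int (?d k) * ?A i k)"
      using HH' by (subst sum.subset_diff[of H]) (auto simp: residual_def intro!: sum.cong)
    finally have "(\<Sum>k\<in>set ?zs. int (?d k) * ?A i k) + (\<Sum>k\<in>H. int (Suc (?l k)) * ?A i k)
        \<le> (\<Sum>k\<in>H' - H. int (c k) * ?A i k)
          + ((\<Sum>k\<in>H. int (?d k) * ?A i k) + (\<Sum>k\<in>H. int (Suc (?l k)) * ?A i k))" by simp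
    also have "(\<Sum>k\<in>H. int (?d k) * ?A i k) + (\<Sum>k\<in>H. int (Suc (?l k)) * ?A i k)
        = (\<Sum>k\<in>H. int (c k) * ?A i k)"
      unfolding sum.distrib[symmetric] distrib_right[symmetric]
    proof (intro sum.cong refl)
      fix k assume k: "k \<in> H"
      then have "int (?d k) + int (Suc (?l k)) = int (c k)" using label[OF k] by (simp add: residual_def)
      then show "(int (?d k) + int (Suc (?l k))) * ?A i k = int (c k) * ?A i k" by (simp only:)
    qed
    also have "(\<Sum>k\<in>H' - H. int (c k) * ?A i k) + (\<Sum>k\<in>H. int (c k) * ?A i k)
        = (\<Sum>k\<in>H'. int (c k) * ?A i k)"
      using HH' by (subst sum.subset_diff[of H H']) auto
    finally have "- (\<Sum>k\<in>H'. int (c k) * ?A i k) \<le> ?z - (\<Sum>k\<in>set ?zs. int (?d k) * ?A i k)"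
      by simp
    then show "\<exists>z. ?\<nu> (coroot \<g> i) = of_int z \<and>
        - (\<Sum>k\<in>H'. int (c k) * ?A i k) \<le> z - (\<Sum>k\<in>set ?zs. int (?d k) * ?A i k)"
      using singular_weight_coroot[OF iJ(1), of H] by blast
  qed (use dist sub Em in auto)
  moreover have "distinct (as @ bs)" "set (as @ bs) = K - ?J" using dist as bs by auto
  ultimately show ?thesis using that by blast
qed

text \<open>Here the refined cut is taken relative to \<open>J_wt \<g> \<Lambda> \<inter> K\<close>, so that it consists of the nodes of the
  terminal set whose exponent exceeds their label. Since the factors at independent nodes commute,
  the monomial with residual exponents applied to the singular vector of \<open>H\<close> is the full
  monomial applied to \<open>v\<close>. The nodes outside \<open>J_wt \<g> \<Lambda>\<close> are then added by stripping.\<close>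

lemma basic_monomial_nonzero:
  assumes run: "basic_run \<g> c (J_wt \<g> \<Lambda> \<inter> K) rs H'" and KI: "K \<subseteq> I"
    and v: "maximal_vector \<Lambda> v" "vspace M = generated_by v"
    and wt: "\<And>H. H \<subseteq> J_wt \<g> \<Lambda> \<inter> K \<Longrightarrow> independent_nodes \<g> H \<Longrightarrow> is_weight \<g> M (singular_weight \<Lambda> H)"
    and hs': "listing hs' H'" and ns: "listing ns (K - J_wt \<g> \<Lambda>)"
  shows "f_monomial \<g> M c ((rs @ hs') @ ns) v \<noteq> 0"
proof -
  let ?J = "J_wt \<g> \<Lambda>" and ?d1 = "\<lambda>i. Suc (dynkin_label \<Lambda> i)"
  define H where "H = refined_cut \<g> \<Lambda> c (?J \<inter> K) H'"
  let ?d = "residual \<Lambda> H c"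
  note facts = basic_run_facts[OF run]
  note vc = maximal_vector_closed[OF v(1)]
  have run': "basic_run \<g> c (?J \<inter> (?J \<inter> K)) rs H'" using run by (simp only: Int_left_absorb)
  have HH': "H \<subseteq> H'" unfolding H_def by (rule refined_cut_subset)
  have H'J: "H' \<subseteq> ?J \<inter> K" using facts by blast
  obtain hs where hs: "set hs = H" "distinct hs" using finite_distinct_list[OF finite] by blast
  obtain ds where ds: "set ds = H' - H" "distinct ds" using finite_distinct_list[OF finite] by blast
  have indH: "independent_nodes \<g> H" using facts HH' unfolding independent_nodes_def by blast
  let ?m = "f_monomial \<g> M ?d1 hs v"
  have HI: "set hs \<subseteq> I" "set hs \<subseteq> ?J" "independent_nodes \<g> (set hs)" unfolding hs(1) using HH' H'J KI indH by blast+
  have m: "maximal_vector (singular_weight \<Lambda> H) ?m"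
    using maximal_singular_vector[OF v(1) HI(3) hs(2) HI(1,2)] by (simp only: hs(1))
  have "H \<subseteq> ?J \<inter> K" using HH' H'J by (rule order_trans)
  then have "is_weight \<g> M (singular_weight \<Lambda> (set hs))" unfolding hs(1) using indH by (rule wt)
  then have m0: "?m \<noteq> 0" by (rule singular_vector_nonzero[OF v HI(3) hs(2) HI(1)])
  obtain as bs where ab: "set (as @ bs) = ?J \<inter> K - ?J"
    "f_monomial \<g> M ?d (rs @ ds @ as @ hs @ bs) ?m \<noteq> 0"
  proof (rule refined_monomial_nonzero[OF run' H_def _ m m0])
    show "listing ds (H' - H)" "listing hs H" using ds hs by (simp_all add: listing_def)
    show "?J \<inter> K \<subseteq> I" using KI by blast
    fix as bs
    assume "set (as @ bs) = ?J \<inter> K - ?J" "f_monomial \<g> M ?d (rs @ ds @ as @ hs @ bs) ?m \<noteq> 0"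
    then show thesis by (rule that)
  qed
  have "?J \<inter> K - ?J = {}" by blast
  with ab(1) have "set (as @ bs) = {}" by (rule trans)
  then have "as = []" "bs = []" by simp_all
  then have nonzero: "f_monomial \<g> M ?d (rs @ ds @ hs) ?m \<noteq> 0" using ab(2) by simp
  have label: "dynkin_label \<Lambda> i < c i" if "i \<in> H" for i
  proof -
    have "i \<in> ?J" using that HH' H'J by blast
    with that show ?thesis unfolding H_def by (rule label_less_exponent)
  qed
  have "f_monomial \<g> M ?d hs ?m = f_monomial \<g> M (\<lambda>i. ?d i + ?d1 i) hs v"
    by (rule f_monomial_add[OF HI(3) hs(2) HI(1) vc])
  also have "\<dots> = f_monomial \<g> M c hs v"
  proof (rule f_monomial_cong)
    fix i assume "i \<in> set hs"
    then show "?d i + ?d1 i = c i" using label[of i] by (simp add: residual_def hs(1))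
  qed
  finally have 1: "f_monomial \<g> M ?d hs ?m = f_monomial \<g> M c hs v" .
  have 2: "f_monomial \<g> M ?d rs x = f_monomial \<g> M c rs x" "f_monomial \<g> M ?d ds x = f_monomial \<g> M c ds x" for x
  proof -
    have "i \<notin> H" if "i \<in> set rs \<or> i \<in> set ds" for i using facts HH' ds(1) that by blast
    then show "f_monomial \<g> M ?d rs x = f_monomial \<g> M c rs x"
      "f_monomial \<g> M ?d ds x = f_monomial \<g> M c ds x"
      by (simp_all add: residual_def cong: f_monomial_cong)
  qed
  have hs'': "set hs' = H'" "distinct hs'" using hs' by (auto simp: listing_def)
  have "f_monomial \<g> M c (ds @ hs) v = f_monomial \<g> M c hs' v"
  proof (rule f_monomial_reorder)
    show "set (ds @ hs) = set hs'" "distinct (ds @ hs)"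
      using hs(2) ds(2) HH' by (auto simp: hs(1) ds(1) hs''(1))
    show "set hs' \<subseteq> I" unfolding hs''(1) using H'J KI by blast
  qed (use hs'' facts vc in simp_all)
  then have "f_monomial \<g> M c (rs @ hs') v \<noteq> 0"
    using nonzero unfolding f_monomial_append 1 2 by simp
  moreover have "distinct ((rs @ hs') @ ns)" "set (rs @ hs') \<subseteq> I" "set ns \<subseteq> I"
    using hs''(2) facts ns H'J KI unfolding listing_def hs''(1)[symmetric] by auto
  moreover have "\<Lambda> (coroot \<g> j) \<notin> \<nat>" if "j \<in> set ns" for j
    using that ns by (auto simp: listing_def J_wt_def)
  moreover have "v \<in> wt_space \<g> M \<Lambda>" "\<And>j. j \<in> I \<Longrightarrow> E j v = 0"
    using v(1) by (auto simp: maximal_vector_def)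
  ultimately show ?thesis using f_monomial_nonzero_strip_list[of v \<Lambda> "rs @ hs'" c ns] by blast
qed

end

section \<open>Dimensions of weight spaces\<close>

lemma (in levi_module) weight_space_subset_finite_span:
  assumes "maximal_vector \<Lambda> v" "vspace M = generated_by v"
  obtains B where "finite B"
    "wt_space \<g> M (lower_weight \<g> \<Lambda> K (\<lambda>i. of_nat (c i))) \<subseteq> cvs.span B"
proof -
  let ?n = "\<lambda>i. if i \<in> K then c i else 0"
  show ?thesis
  proof (rule that)
    show "finite ((\<lambda>w. f_word M w v) ` {w \<in> lists I. count_list w = ?n})"
      using finite_words_of_content[of ?n] by simp
    show "wt_space \<g> M (lower_weight \<g> \<Lambda> K (\<lambda>i. of_nat (c i)))
        \<subseteq> cvs.span ((\<lambda>w. f_word M w v) ` {w \<in> lists I. count_list w = ?n})"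
      unfolding lower_weight_eq_weight_below by (rule weight_space_subset_span_words[OF assms])
  qed
qed

lemma dim_pos_if_nonzero:
  assumes "cvs.subspace S" "S \<subseteq> cvs.span B" "finite B" "x \<in> S" "x \<noteq> (0 :: 'v::complex_vector)"
  shows "cvs.dim S > 0"
proof -
  have "card {()} \<le> cvs.dim S"
    by (rule card_le_dim_of_independent_family[where x = "\<lambda>_. x" and B = B])
      (use assms in auto)
  then show ?thesis by simp
qed

context kac_moody_algebra
begin

lemma refined_terminal_setE:
  assumes "H \<in> refined_terminal_sets \<g> \<Lambda> c K"
  obtains rs H' where "basic_run \<g> c (J_wt \<g> \<Lambda> \<inter> K) rs H'" "H = refined_cut \<g> \<Lambda> c K H'"
    "H \<subseteq> J_wt \<g> \<Lambda> \<inter> K" "independent_nodes \<g> H" "\<And>i. i \<in> H \<Longrightarrow> dynkin_label \<Lambda> i < c i"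
proof -
  obtain rs H' where r: "basic_run \<g> c (J_wt \<g> \<Lambda> \<inter> K) rs H'" "H = refined_cut \<g> \<Lambda> c K H'"
    using assms unfolding refined_terminal_sets_def basic_terminal_sets_def by blast
  have HH': "H \<subseteq> H'" unfolding r(2) by (rule refined_cut_subset)
  have H'J: "H' \<subseteq> J_wt \<g> \<Lambda> \<inter> K" and ind: "independent_nodes \<g> H'"
    using basic_run_facts[OF r(1)] by blast+
  show ?thesis
  proof (rule that[OF r])
    show "H \<subseteq> J_wt \<g> \<Lambda> \<inter> K" using HH' H'J by (rule order_trans)
    show "independent_nodes \<g> H" using HH' ind unfolding independent_nodes_def by blast
    fix i assume i: "i \<in> H"
    then have "i \<in> J_wt \<g> \<Lambda>" using HH' H'J by blast
    with i[unfolded r(2)] show "dynkin_label \<Lambda> i < c i" by (rule label_less_exponent)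
  qed
qed

text \<open>The refined monomial with residual exponents takes the highest weight vector, of weight
  \<open>w\<^sub>H \<bullet> \<Lambda>\<close>, to a nonzero vector of weight \<open>\<mu>\<close>.\<close>

lemma dim_simple_positive:
  assumes H: "H \<in> refined_terminal_sets \<g> \<Lambda> c K"
    and L: "simple_levi_module \<g> UNIV L (singular_weight \<Lambda> H) z"
  shows "cvs.dim (wt_space \<g> L (lower_weight \<g> \<Lambda> K (\<lambda>i. of_nat (c i)))) > 0"
proof -
  interpret L: simple_levi_module \<g> UNIV L "singular_weight \<Lambda> H" z by (rule L)
  obtain rs H' where r: "basic_run \<g> c (J_wt \<g> \<Lambda> \<inter> K) rs H'" "H = refined_cut \<g> \<Lambda> c K H'"
    "H \<subseteq> J_wt \<g> \<Lambda> \<inter> K" "\<And>i. i \<in> H \<Longrightarrow> dynkin_label \<Lambda> i < c i"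
    using refined_terminal_setE[OF H] by metis
  note facts = basic_run_facts[OF r(1)]
  have HH': "H \<subseteq> H'" unfolding r(2) by (rule refined_cut_subset)
  obtain ds where ds: "set ds = H' - H" "distinct ds" using finite_distinct_list[OF finite] by blast
  obtain hs where hs: "set hs = H" "distinct hs" using finite_distinct_list[OF finite] by blast
  have listings: "listing ds (H' - H)" "listing hs H" using ds hs by (simp_all add: listing_def)
  obtain as bs where ab: "distinct (as @ bs)" "set (as @ bs) = K - J_wt \<g> \<Lambda>"
    "f_monomial \<g> L (residual \<Lambda> H c) (rs @ ds @ as @ hs @ bs) z \<noteq> 0" (is "f_monomial \<g> L ?d ?js z \<noteq> 0")
    by (rule L.refined_monomial_nonzero[OF r(1,2) subset_UNIV L.max L.nonzero listings])
  have J: "set rs \<inter> H' = {}" "set rs \<union> H' = J_wt \<g> \<Lambda> \<inter> K" "distinct rs" using facts by blast+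
  have "set ?js = set rs \<union> (H' - H) \<union> H \<union> set (as @ bs)" using ds hs by auto
  also have "\<dots> = K" unfolding ab(2) using HH' J by blast
  finally have K: "set ?js = K" .
  have "distinct ?js"
  proof -
    have "set rs \<inter> set ds = {}" "set rs \<inter> set (as @ bs) = {}" "set rs \<inter> set hs = {}"
      "set ds \<inter> set (as @ bs) = {}" "set ds \<inter> set hs = {}" "set hs \<inter> set (as @ bs) = {}"
      unfolding ab(2) ds(1) hs(1) using HH' J by blast+
    then show ?thesis using J(3) ds(2) hs(2) ab(1) by (simp add: Int_Un_distrib) blast
  qed
  then have "f_monomial \<g> L ?d ?js z
      \<in> wt_space \<g> L (lower_weight \<g> (singular_weight \<Lambda> H) K (\<lambda>i. of_nat (?d i)))"
    using L.f_monomial_wt_space[of z "singular_weight \<Lambda> H" ?js ?d] L.max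
    unfolding K L.maximal_vector_def by blast
  moreover obtain B where "finite B"
    "wt_space \<g> L (lower_weight \<g> (singular_weight \<Lambda> H) K (\<lambda>i. of_nat (?d i))) \<subseteq> cvs.span B"
    by (rule L.weight_space_subset_finite_span[OF L.max L.gen])
  moreover have "H \<subseteq> K" using r(3) by blast
  then have "lower_weight \<g> (singular_weight \<Lambda> H) K (\<lambda>i. of_nat (?d i)) = lower_weight \<g> \<Lambda> K (\<lambda>i. of_nat (c i))"
    by (rule lower_weight_residual) (rule r(4))
  ultimately show ?thesis
    using dim_pos_if_nonzero[OF L.subspace_wt_space _ _ _ ab(3)] by metis
qed

text \<open>The singular vectors of \<open>V\<close> attached to the refined terminal sets have pairwise different
  weights, so the general inequality applies to them.\<close>

lemma sum_dim_refined_le: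
  fixes L :: "'i set \<Rightarrow> ('g, 'l::complex_vector) rep"
  assumes V: "levi_module \<g> UNIV V" and v: "levi_module.maximal_vector \<g> UNIV V \<Lambda> v"
    "vspace V = levi_module.generated_by \<g> UNIV V v"
    and wt: "\<And>H. H \<subseteq> J_wt \<g> \<Lambda> \<inter> K \<Longrightarrow> independent_nodes \<g> H \<Longrightarrow> is_weight \<g> V (singular_weight \<Lambda> H)"
    and L: "\<And>H. H \<in> refined_terminal_sets \<g> \<Lambda> c K \<Longrightarrow>
      \<exists>z. simple_levi_module \<g> (J H) (L H) (singular_weight \<Lambda> H) z"
  shows "(\<Sum>H\<in>refined_terminal_sets \<g> \<Lambda> c K. cvs.dim (wt_space \<g> (L H) (lower_weight \<g> \<Lambda> K (\<lambda>i. of_nat (c i)))))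
    \<le> cvs.dim (wt_space \<g> V (lower_weight \<g> \<Lambda> K (\<lambda>i. of_nat (c i))))"
proof -
  interpret V: levi_module \<g> UNIV V by (rule V)
  let ?T = "refined_terminal_sets \<g> \<Lambda> c K"
  obtain B where B: "finite B" "wt_space \<g> V (lower_weight \<g> \<Lambda> K (\<lambda>i. of_nat (c i))) \<subseteq> cvs.span B"
    by (rule V.weight_space_subset_finite_span[OF v])
  have "\<exists>m. V.maximal_vector (singular_weight \<Lambda> H) m \<and> m \<noteq> 0" if H: "H \<in> ?T" for H
  proof -
    obtain hs where hs: "set hs = H" "distinct hs" using finite_distinct_list[OF finite] by blast
    have HJ: "H \<subseteq> J_wt \<g> \<Lambda> \<inter> K" "independent_nodes \<g> H" using refined_terminal_setE[OF H] by metis+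
    have s: "independent_nodes \<g> (set hs)" "set hs \<subseteq> J_wt \<g> \<Lambda>" "is_weight \<g> V (singular_weight \<Lambda> (set hs))"
      unfolding hs(1) using HJ wt[OF HJ] by blast+
    show ?thesis
      using V.maximal_singular_vector[OF v(1) s(1) hs(2) subset_UNIV s(2)]
        V.singular_vector_nonzero[OF v s(1) hs(2) subset_UNIV s(3)] unfolding hs(1) by blast
  qed
  then obtain m where m: "\<And>H. H \<in> ?T \<Longrightarrow> V.maximal_vector (singular_weight \<Lambda> H) (m H)"
    "\<And>H. H \<in> ?T \<Longrightarrow> m H \<noteq> 0" by metis
  show ?thesis
  proof (rule V.sum_dim_simple_le[where T = ?T and \<nu> = "singular_weight \<Lambda>" and m = m and J = J
        and n = "\<lambda>H i. if i \<in> K then residual \<Lambda> H c i else 0", OF finite B(2,1)])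
    fix H assume H: "H \<in> ?T"
    show "V.maximal_vector (singular_weight \<Lambda> H) (m H)" "m H \<noteq> 0" by (rule m[OF H])+
    show "\<exists>z. simple_levi_module \<g> (J H) (L H) (singular_weight \<Lambda> H) z" by (rule L[OF H])
    have HK: "H \<subseteq> K" "\<And>i. i \<in> H \<Longrightarrow> dynkin_label \<Lambda> i < c i" using refined_terminal_setE[OF H] by blast+
    show "lower_weight \<g> \<Lambda> K (\<lambda>i. of_nat (c i))
        = weight_below (singular_weight \<Lambda> H) (\<lambda>i. if i \<in> K then residual \<Lambda> H c i else 0)"
      using lower_weight_residual[OF HK] unfolding lower_weight_eq_weight_below by simp
  next
    fix H H' :: "'i set" assume "H \<noteq> H'"
    then show "\<exists>h\<in>cartan \<g>. singular_weight \<Lambda> H h \<noteq> singular_weight \<Lambda> H' h"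
      using singular_weight_inject[of \<Lambda> H H'] by blast
  qed simp
qed

end

theorem proposition1p16:
  fixes \<g> :: "('i::finite, 'g::complex_lie_algebra) km_data"
    and \<Lambda> \<rho> \<mu> :: "'g \<Rightarrow> complex"
    and V :: "('g, 'v::complex_vector) rep"
    and K :: "'i set"
    and c :: "'i \<Rightarrow> nat"
    and L :: "('g \<Rightarrow> complex) \<Rightarrow> ('g, 'l::complex_vector) rep"
    and hsub :: "'i set \<Rightarrow> 'g set"
    and Lsub :: "'i set \<Rightarrow> ('g \<Rightarrow> complex) \<Rightarrow> ('g, 'k::complex_vector) rep"
  assumes km: "kac_moody \<g>"
    and wt: "linear_functional_on (cartan \<g>) \<Lambda>"
    and rho: "weyl_vector \<g> \<rho>"
    and hw: "highest_weight_module \<g> \<Lambda> V"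
    and simples: "\<And>\<nu>. linear_functional_on (cartan \<g>) \<nu> \<Longrightarrow> simple_hw_module \<g> \<nu> (L \<nu>)"
    and sub_cartan: "\<And>I. hsub I \<subseteq> cartan \<g> \<and> realization \<g> I (hsub I)"
    and sub_simples: "\<And>I \<nu>. linear_functional_on (cartan \<g>) \<nu> \<Longrightarrow>
          levi_simple_hw_module \<g> (hsub I) I \<nu> (Lsub I \<nu>)"
    and K_eq: "K = - J_mod \<g> \<Lambda> V"
    and K_ne: "K \<noteq> {}"
    and mu_eq: "\<mu> = lower_weight \<g> \<Lambda> K (\<lambda>i. of_nat (c i))"
  shows
    \<comment> \<open>(a)\<close>
    "(\<Lambda> \<in> dominant_integral \<g> \<longrightarrow>
        (\<forall>is. basic_enumeration \<g> c K is \<longrightarrow> f_monomial \<g> V c is ` wt_space \<g> V \<Lambda> \<noteq> {0})) \<and>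
    \<comment> \<open>(b)\<close>
     (\<Lambda> \<in> dominant_integral \<g> \<longrightarrow>
        (let Hs = basic_cut \<g> \<Lambda> c ` basic_terminal_sets \<g> c K in
          cvs.dim (wt_space \<g> V \<mu>)
            \<ge> (\<Sum>H\<in>Hs. cvs.dim (wt_space \<g> (L (dot_action \<rho> (w_prod \<g> H) \<Lambda>)) \<mu>)) \<and>
          (\<forall>H\<in>Hs. cvs.dim (wt_space \<g> (L (dot_action \<rho> (w_prod \<g> H) \<Lambda>)) \<mu>) > 0) \<and>
          cvs.dim (wt_space \<g> V \<mu>)
            \<ge> (\<Sum>H\<in>Hs. cvs.dim (wt_space \<g> (Lsub (K - H) (dot_action \<rho> (w_prod \<g> H) \<Lambda>)) \<mu>)))) \<and>
    \<comment> \<open>(c')\<close>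
     (\<forall>is ns. basic_enumeration \<g> c (J_wt \<g> \<Lambda> \<inter> K) is \<and> listing ns (K - J_wt \<g> \<Lambda>) \<longrightarrow>
        (f_monomial \<g> V c is \<circ> f_monomial \<g> V c ns) ` wt_space \<g> V \<Lambda> \<noteq> {0}) \<and>
    \<comment> \<open>(c)\<close>
     (\<forall>js. refined_enumeration \<g> \<Lambda> c K js \<longrightarrow> f_monomial \<g> V c js ` wt_space \<g> V \<Lambda> \<noteq> {0}) \<and>
     (let Hs = refined_terminal_sets \<g> \<Lambda> c K in
        cvs.dim (wt_space \<g> V \<mu>)
          \<ge> (\<Sum>H\<in>Hs. cvs.dim (wt_space \<g> (L (dot_action \<rho> (w_prod \<g> H) \<Lambda>)) \<mu>)) \<and>
        (\<forall>H\<in>Hs. cvs.dim (wt_space \<g> (L (dot_action \<rho> (w_prod \<g> H) \<Lambda>)) \<mu>) > 0) \<and>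
        cvs.dim (wt_space \<g> V \<mu>)
          \<ge> (\<Sum>H\<in>Hs. cvs.dim (wt_space \<g> (Lsub (K - H) (dot_action \<rho> (w_prod \<g> H) \<Lambda>)) \<mu>)))"
proof -
  interpret kac_moody_algebra \<g> by unfold_locales (rule km)
  let ?J = "J_wt \<g> \<Lambda>" and ?T = "refined_terminal_sets \<g> \<Lambda> c K"
  have V: "levi_module \<g> UNIV V" by (rule highest_weight_module_generator(1)[OF hw])
  interpret V: levi_module \<g> UNIV V by (rule V)
  obtain v where v: "v \<noteq> 0" "V.maximal_vector \<Lambda> v" "vspace V = V.generated_by v"
    using highest_weight_module_generator(2)[OF hw] by blast
  have vwt: "v \<in> wt_space \<g> V \<Lambda>" using v(2) by (simp add: V.maximal_vector_def)
  then have "is_weight \<g> V \<Lambda>" using v(1) by (auto simp: is_weight_def)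
  then have hole: "is_weight \<g> V (singular_weight \<Lambda> H)"
    if "H \<subseteq> ?J \<inter> K" "independent_nodes \<g> H" for H
    by (rule is_weight_singular_weight) (use that K_eq in auto)
  have nonzero: "f_monomial \<g> V c ((rs @ hs) @ ns) v \<noteq> 0"
    if "basic_run \<g> c (?J \<inter> K) rs H'" "listing hs H'" "listing ns (K - ?J)" for rs hs ns H'
    by (rule V.basic_monomial_nonzero[OF that(1) subset_UNIV v(2,3) hole that(2,3)])
  have cprime: "(f_monomial \<g> V c is \<circ> f_monomial \<g> V c ns) ` wt_space \<g> V \<Lambda> \<noteq> {0}"
    if enum: "basic_enumeration \<g> c (?J \<inter> K) is" and ns: "listing ns (K - ?J)" for "is" ns
  proof -
    obtain rs H' hs where e: "basic_run \<g> c (?J \<inter> K) rs H'" "listing hs H'" "is = rs @ hs"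
      using enum unfolding basic_enumeration_def by blast
    have "(f_monomial \<g> V c is \<circ> f_monomial \<g> V c ns) v \<noteq> 0"
      using nonzero[OF e(1,2) ns] by (simp add: e(3) f_monomial_append)
    then show ?thesis using vwt by blast
  qed
  have c1: "f_monomial \<g> V c js ` wt_space \<g> V \<Lambda> \<noteq> {0}"
    if enum: "refined_enumeration \<g> \<Lambda> c K js" for js
  proof -
    obtain rs H' ds hs ns where e: "basic_run \<g> c (?J \<inter> K) rs H'"
      "listing ds (H' - refined_cut \<g> \<Lambda> c K H')" "listing hs (refined_cut \<g> \<Lambda> c K H')"
      "listing ns (K - ?J)" "js = rs @ ds @ hs @ ns"
      using enum unfolding refined_enumeration_def by blast
    have "listing (ds @ hs) H'"
      using e(2,3) refined_cut_subset[of \<Lambda> c K H'] by (auto simp: listing_def)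
    from nonzero[OF e(1) this e(4)] have "f_monomial \<g> V c js v \<noteq> 0" by (simp add: e(5))
    then show ?thesis using vwt by blast
  qed
  have dot: "dot_action \<rho> (w_prod \<g> H) \<Lambda> = singular_weight \<Lambda> H" if H: "H \<in> ?T" for H
  proof -
    have "independent_nodes \<g> H" "H \<subseteq> ?J" using refined_terminal_setE[OF H] by blast+
    then show ?thesis by (rule dot_action_w_prod[OF rho])
  qed
  note lin = linear_singular_weight[OF wt]
  have L: "\<exists>z. simple_levi_module \<g> UNIV (L (singular_weight \<Lambda> H)) (singular_weight \<Lambda> H) z" for H
    by (rule simple_hw_module_levi[OF simples[OF lin]])
  have Lsub: "\<exists>z. simple_levi_module \<g> (K - H) (Lsub (K - H) (singular_weight \<Lambda> H)) (singular_weight \<Lambda> H) z" for H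
    by (rule levi_simple_hw_module_levi[OF sub_simples[OF lin]]) (use sub_cartan in blast)
  have ineq: "(\<Sum>H\<in>?T. cvs.dim (wt_space \<g> (L (dot_action \<rho> (w_prod \<g> H) \<Lambda>)) \<mu>)) \<le> cvs.dim (wt_space \<g> V \<mu>)"
    using sum_dim_refined_le[OF V v(2,3) hole L, where c = c] by (simp add: dot mu_eq)
  have ineq_sub: "(\<Sum>H\<in>?T. cvs.dim (wt_space \<g> (Lsub (K - H) (dot_action \<rho> (w_prod \<g> H) \<Lambda>)) \<mu>))
      \<le> cvs.dim (wt_space \<g> V \<mu>)"
    using sum_dim_refined_le[OF V v(2,3) hole Lsub, where c = c] by (simp add: dot mu_eq)
  have pos: "cvs.dim (wt_space \<g> (L (dot_action \<rho> (w_prod \<g> H) \<Lambda>)) \<mu>) > 0" if H: "H \<in> ?T" for H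
  proof -
    obtain z where "simple_levi_module \<g> UNIV (L (singular_weight \<Lambda> H)) (singular_weight \<Lambda> H) z"
      using L by blast
    then show ?thesis unfolding dot[OF H] mu_eq by (rule dim_simple_positive[OF H])
  qed
  \<comment> \<open>For dominant integral \<open>\<Lambda>\<close> every node lies in \<open>J_wt \<g> \<Lambda>\<close> and the refined procedure is the basic one.\<close>
  have J: "?J = UNIV" if "\<Lambda> \<in> dominant_integral \<g>"
    using that by (auto simp: dominant_integral_def J_wt_def)
  have a: "f_monomial \<g> V c is ` wt_space \<g> V \<Lambda> \<noteq> {0}"
    if "\<Lambda> \<in> dominant_integral \<g>" "basic_enumeration \<g> c K is" for "is"
  proof -
    have "f_monomial \<g> V c [] = id" by (simp add: fun_eq_iff)
    then show ?thesis
      using cprime[of "is" "[]"] that(2) J[OF that(1)] by (simp add: listing_def)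
  qed
  have T: "basic_cut \<g> \<Lambda> c ` basic_terminal_sets \<g> c K = ?T" if "\<Lambda> \<in> dominant_integral \<g>"
  proof -
    have "refined_cut \<g> \<Lambda> c K = basic_cut \<g> \<Lambda> c"
      by (simp add: fun_eq_iff refined_cut_def basic_cut_def J[OF that])
    then show ?thesis by (simp add: refined_terminal_sets_def J[OF that])
  qed
  show ?thesis
    unfolding Let_def using a T cprime c1 ineq ineq_sub pos by (intro conjI impI allI ballI) auto
qed

end
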